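(* Let $G$ be a finite connected graph of minimal degree at least $2$ which is not a cycle, with maximal degree $D$, and let $W:V(G)\to\mathbb{R}$. Let $\psi_\lambda$ be an eigenfunction of $H_G=\mathcal{A}_G+W$ with eigenvalue $\lambda$ and $\|\psi_\lambda\|_2=1$. (1) If $\lambda$ is in the bulk spectrum, then $\|\psi_\lambda\|_\infty\le \frac{8D\,z_\lambda(G)^{-4}}{\sqrt{\ell_G}}$. (2) If $\lambda\notin\sigma(H_{\widetilde G})$ and $\delta_\lambda=\operatorname{dist}(\lambda,\sigma(H_{\widetilde G}))$, then $\|\psi_\lambda\|_\infty\le \frac{8D}{\delta_\lambda}\left(1+\frac{\delta_\lambda}{2D}\right)^{-\ell_G}$.
   Context: $\mathcal{A}_G$ is the adjacency matrix of $G$ and $H_G=\mathcal{A}_G+W$ acts on $\ell^2(V(G))$. $(\widetilde G,\widetilde W)$ is the universal cover of $G$ (a tree) with covering map $\pi$ and lifted potential $\widetilde W=W\circ\pi$; $H_{\widetilde G}=\mathcal{A}_{\widetilde G}+\widetilde W$ on $\ell^2(V(\widetilde G))$. For a tree $\mathcal{T}$ with potential and adjacent vertices $v\sim w$, let $\mathcal{T}^{(v|w)}$ be the connected component containing $v$ of $\mathcal{T}$ with the edge $\{v,w\}$ removed, $H^{(v|w)}$ the restriction of the Schr\"odinger operator to it, and for $\Im\gamma>0$ set $\zeta^\gamma_w(v)=-(H^{(v|w)}-\gamma)^{-1}(v,v)$. For an oriented edge $(x,y)$ of $G$ set $\zeta^\gamma_y(x):=\zeta^\gamma_{\tilde y}(\tilde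 x)$ for adjacent lifts $\tilde x\sim\tilde y$ in $\widetilde G$ (independent of the choice), and $\zeta^{\lambda+i0}_y(x)=\lim_{\eta\downarrow0}\zeta^{\lambda+i\eta}_y(x)$. Under the assumptions (connected, minimal degree $\ge2$, not a cycle), $\sigma(H_{\widetilde G})=(J_1\cup\dots\cup J_\ell)\sqcup\mathfrak F\sqcup\mathfrak F'$ with $J_r$ finitely many (at least one) disjoint open intervals on which the spectrum is absolutely continuous, $\mathfrak F$ a finite set of eigenvalues, and $\mathfrak F'$ the set of endpoints of the $J_r$; $\lambda$ is in the bulk spectrum if $\lambda\in\bigcup_r J_r$, and then all limits $\zeta^{\lambda+i0}_y(x)$ exist with nonzero imaginary part. Define $z_\lambda(G)=\min_{(x,y)}|\Im\zeta^{\lambda+i0}_y(x)|$, the minimum over oriented edges of $G$. $\ell_G$ is the largest integer $\ell$ such that every ball $B_G(x,\ell)$ (graph distance) contains at most one cycle. *)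

theory Defs
  imports "HOL-Analysis.Analysis"
begin

definition fin_graph :: "'a set \<Rightarrow> ('a \<Rightarrow> 'a \<Rightarrow> bool) \<Rightarrow> bool" where
  "fin_graph V E \<longleftrightarrow> finite V \<and> (\<forall>x y. E x y \<longrightarrow> x \<in> V \<and> y \<in> V)
     \<and> (\<forall>x y. E x y \<longrightarrow> E y x) \<and> (\<forall>x. \<not> E x x)"

definition deg :: "'a set \<Rightarrow> ('a \<Rightarrow> 'a \<Rightarrow> bool) \<Rightarrow> 'a \<Rightarrow> nat" where
  "deg V E v = card {w \<in> V. E v w}"

definition max_deg :: "'a set \<Rightarrow> ('a \<Rightarrow> 'a \<Rightarrow> bool) \<Rightarrow> nat" where
  "max_deg V E = Max (deg V E ` V)"

definition g_connected :: "'a set \<Rightarrow> ('a \<Rightarrow> 'a \<Rightarrow> bool) \<Rightarrow> bool" where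
  "g_connected V E \<longleftrightarrow> V \<noteq> {} \<and>
     (\<forall>u\<in>V. \<forall>v\<in>V. (\<lambda>a b. E a b \<and> a \<in> V \<and> b \<in> V)\<^sup>*\<^sup>* u v)"

definition is_cycle_graph :: "'a set \<Rightarrow> ('a \<Rightarrow> 'a \<Rightarrow> bool) \<Rightarrow> bool" where
  "is_cycle_graph V E \<longleftrightarrow> g_connected V E \<and> (\<forall>v\<in>V. deg V E v = 2)"

definition is_walk :: "'a set \<Rightarrow> ('a \<Rightarrow> 'a \<Rightarrow> bool) \<Rightarrow> 'a list \<Rightarrow> bool" where
  "is_walk V E p \<longleftrightarrow> p \<noteq> [] \<and> set p \<subseteq> V \<and> (\<forall>i. Suc i < length p \<longrightarrow> E (p!i) (p!Suc i))"

definition ball_G :: "'a set \<Rightarrow> ('a \<Rightarrow> 'a \<Rightarrow> bool) \<Rightarrow> 'a \<Rightarrow> nat \<Rightarrow> 'a set" where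
  "ball_G V E x l = {y. \<exists>p. is_walk V E p \<and> hd p = x \<and> last p = y \<and> length p \<le> Suc l}"

definition is_cycle_list :: "('a \<Rightarrow> 'a \<Rightarrow> bool) \<Rightarrow> 'a set \<Rightarrow> 'a list \<Rightarrow> bool" where
  "is_cycle_list E B c \<longleftrightarrow> length c \<ge> 3 \<and> distinct c \<and> set c \<subseteq> B
     \<and> (\<forall>i. Suc i < length c \<longrightarrow> E (c!i) (c!Suc i)) \<and> E (last c) (hd c)"

definition cycle_edges :: "'a list \<Rightarrow> 'a set set" where
  "cycle_edges c = {{c!i, c!(Suc i mod length c)} | i. i < length c}"

definition cycles_in :: "('a \<Rightarrow> 'a \<Rightarrow> bool) \<Rightarrow> 'a set \<Rightarrow> 'a set set set" where
  "cycles_in E B = {cycle_edges c | c. is_cycle_list E B c}"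

definition at_most_one_cycle :: "('a \<Rightarrow> 'a \<Rightarrow> bool) \<Rightarrow> 'a set \<Rightarrow> bool" where
  "at_most_one_cycle E B \<longleftrightarrow> (\<forall>C1\<in>cycles_in E B. \<forall>C2\<in>cycles_in E B. C1 = C2)"

definition ell_G :: "'a set \<Rightarrow> ('a \<Rightarrow> 'a \<Rightarrow> bool) \<Rightarrow> nat" where
  "ell_G V E = (GREATEST l. \<forall>x\<in>V. at_most_one_cycle E (ball_G V E x l))"

section \<open>The universal cover as the tree of non-backtracking walks\<close>

definition nb_walk :: "'a set \<Rightarrow> ('a \<Rightarrow> 'a \<Rightarrow> bool) \<Rightarrow> 'a list \<Rightarrow> bool" where
  "nb_walk V E p \<longleftrightarrow> is_walk V E p \<and> (\<forall>i. i + 2 < length p \<longrightarrow> p!(i+2) \<noteq> p!i)"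

text \<open>Vertices of the universal cover rooted at r; the covering map is last.\<close>
definition cover_verts :: "'a set \<Rightarrow> ('a \<Rightarrow> 'a \<Rightarrow> bool) \<Rightarrow> 'a \<Rightarrow> 'a list set" where
  "cover_verts V E r = {p. nb_walk V E p \<and> hd p = r}"

definition tadj :: "'a list \<Rightarrow> 'a list \<Rightarrow> bool" where
  "tadj p q \<longleftrightarrow> (\<exists>z. q = p @ [z]) \<or> (\<exists>z. p = q @ [z])"

definition schr :: "('a \<Rightarrow> real) \<Rightarrow> 'a list set \<Rightarrow> ('a list \<Rightarrow> complex) \<Rightarrow> 'a list \<Rightarrow> complex" where
  "schr W S f p = (if p \<in> S then (\<Sum>q\<in>{q\<in>S. tadj p q}. f q) + of_real (W (last p)) * f p else 0)"

definition l2 :: "'b set \<Rightarrow> ('b \<Rightarrow> complex) set" where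
  "l2 S = {f. (\<forall>p. p \<notin> S \<longrightarrow> f p = 0) \<and> (\<lambda>p. (cmod (f p))\<^sup>2) summable_on S}"

definition l2norm :: "'b set \<Rightarrow> ('b \<Rightarrow> complex) \<Rightarrow> real" where
  "l2norm S f = sqrt (infsum (\<lambda>p. (cmod (f p))\<^sup>2) S)"

definition in_resolvent_set :: "('a \<Rightarrow> real) \<Rightarrow> 'a list set \<Rightarrow> complex \<Rightarrow> bool" where
  "in_resolvent_set W S z \<longleftrightarrow> (\<exists>R. (\<forall>f\<in>l2 S. R f \<in> l2 S)
     \<and> (\<exists>C. \<forall>f\<in>l2 S. l2norm S (R f) \<le> C * l2norm S f)
     \<and> (\<forall>f\<in>l2 S. (\<lambda>p. schr W S (R f) p - z * R f p) = f)
     \<and> (\<forall>f\<in>l2 S. R (\<lambda>p. schr W S f p - z * f p) = f))"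

definition cover_root :: "'a set \<Rightarrow> 'a" where
  "cover_root V = (SOME v. v \<in> V)"

text \<open>Spectrum of H on the universal cover (real, as H is self-adjoint).\<close>
definition cover_spectrum :: "'a set \<Rightarrow> ('a \<Rightarrow> 'a \<Rightarrow> bool) \<Rightarrow> ('a \<Rightarrow> real) \<Rightarrow> real set" where
  "cover_spectrum V E W =
     {lam. \<not> in_resolvent_set W (cover_verts V E (cover_root V)) (of_real lam)}"

text \<open>Diagonal resolvent entry (H_S - z)^{-1}(o,o), via the unique l2 solution of
(H_S - z) u = delta_o.\<close>
definition green :: "('a \<Rightarrow> real) \<Rightarrow> 'a list set \<Rightarrow> 'a list \<Rightarrow> complex \<Rightarrow> complex" where
  "green W S r z = (THE u. u \<in> l2 S \<and>
      (\<forall>p\<in>S. schr W S u p - z * u p = (if p = r then 1 else 0))) r"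

text \<open>For the oriented edge (x,y): lifts ytilde = [y], xtilde = [y,x] in the cover
rooted at y; the component of xtilde after removing the edge {xtilde,ytilde} consists
of the non-backtracking walks with prefix [y,x].\<close>
definition subtree :: "'a set \<Rightarrow> ('a \<Rightarrow> 'a \<Rightarrow> bool) \<Rightarrow> 'a \<Rightarrow> 'a \<Rightarrow> 'a list set" where
  "subtree V E y x = {p. nb_walk V E p \<and> take 2 p = [y, x]}"

definition zeta :: "'a set \<Rightarrow> ('a \<Rightarrow> 'a \<Rightarrow> bool) \<Rightarrow> ('a \<Rightarrow> real) \<Rightarrow> 'a \<Rightarrow> 'a \<Rightarrow> complex \<Rightarrow> complex" where
  "zeta V E W y x z = - green W (subtree V E y x) [y, x] z"

definition zeta0 :: "'a set \<Rightarrow> ('a \<Rightarrow> 'a \<Rightarrow> bool) \<Rightarrow> ('a \<Rightarrow> real) \<Rightarrow> 'a \<Rightarrow> 'a \<Rightarrow> real \<Rightarrow> complex" where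
  "zeta0 V E W y x lam =
     Lim (at_right (0::real)) (\<lambda>eta. zeta V E W y x (of_real lam + \<i> * of_real eta))"

definition bulk_spectrum :: "'a set \<Rightarrow> ('a \<Rightarrow> 'a \<Rightarrow> bool) \<Rightarrow> ('a \<Rightarrow> real) \<Rightarrow> real \<Rightarrow> bool" where
  "bulk_spectrum V E W lam \<longleftrightarrow> lam \<in> cover_spectrum V E W \<and>
     (\<forall>x\<in>V. \<forall>y\<in>V. E x y \<longrightarrow> (\<exists>L. ((\<lambda>eta. zeta V E W y x (of_real lam + \<i> * of_real eta))
         \<longlongrightarrow> L) (at_right (0::real)) \<and> Im L \<noteq> 0))"

definition z_lambda :: "'a set \<Rightarrow> ('a \<Rightarrow> 'a \<Rightarrow> bool) \<Rightarrow> ('a \<Rightarrow> real) \<Rightarrow> real \<Rightarrow> real" where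
  "z_lambda V E W lam = Min {\<bar>Im (zeta0 V E W y x lam)\<bar> | x y. x \<in> V \<and> y \<in> V \<and> E x y}"

definition sup_norm :: "'a set \<Rightarrow> ('a \<Rightarrow> complex) \<Rightarrow> real" where
  "sup_norm V psi = Max ((\<lambda>v. cmod (psi v)) ` V)"

end

theory Submission
  imports Defs
begin

text \<open>Counting distinct edges fails only when a walk laps a cycle, since then its generations
  overlap. If two walks leave x in different directions, take fewer than K further steps and both
  traverse the deleted edge, they enter it from opposite ends, and their forest parts close to a
  cycle through x of length at most 2 K - 1. This is why K is about half of the radius. A flow that
  never left such a cycle would force all its vertices to have degree 2, and connectedness would
  then make the whole graph a cycle. Dividing by |Im zeta| is what gives the one-step inequality the
  constant 1, so that it survives any number of iterations. Constants in the bulk: |F|^2 <= (1 / z)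
  * (4 D / (z^2 K)) * (4 D / z^3), recovering psi costs another 1 / z, and the square root of the
  radius is at most 2 sqrt K; together 8 D / z^4. Outside the spectrum there are two boundary
  layers, each contributing 2 D from the cut-off function times 2 / delta from the weighted
  resolvent.\<close>

text \<open>
A ball of radius \<open>\<ell>\<close> with at most one cycle becomes a forest after deleting one edge. Hence between
two given vertices it has at most three non-backtracking walks of any prescribed length, and
non-backtracking walks that never meet the cycle are determined by their end points.

In the bulk, the boundary values \<open>\<zeta>\<close> satisfy the Schur complement recursion, so
\<open>F(w,v) = \<psi>(v) - \<zeta>\<^sub>w(v) \<psi>(w)\<close> equals \<open>\<zeta>\<^sub>w(v)\<close> times the sum of \<open>F\<close> over the non-backtracking
successors of \<open>(w,v)\<close>. The imaginary part of the recursion and Cauchy--Schwarz show that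
\<open>\<Phi> = \<bar>F\<bar>\<^sup>2 / \<bar>Im \<zeta>\<bar>\<close> is at most its sum over the successors. Iterating along \<open>K \<approx> \<ell> / 2\<close>
generations of distinct edges bounds \<open>K \<Phi>\<close> by the total mass of \<open>\<Phi>\<close>. An edge on a short cycle is
compared with the edge maximising \<open>\<Phi>\<close> among such edges: a definite proportion of its flow leaves
the cycle at a branching vertex. Finally \<open>\<psi>\<close> is recovered from \<open>F\<close> and its analogue for the
complex conjugate of \<open>\<zeta>\<close>.

Outside the spectrum, the resolvent of the cover has norm at most \<open>1 / \<delta>\<close> and decays exponentially
(Combes--Thomas). Pairing it with the lift of \<open>\<psi>\<close> cut off at depth \<open>\<ell>\<close> leaves only boundary terms
near the sphere of radius \<open>\<ell>\<close>, where each vertex of the graph is hit at most three times.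
\<close>

section \<open>The space of square summable functions\<close>

lemma l2_outside: "f \<in> l2 S \<Longrightarrow> p \<notin> S \<Longrightarrow> f p = 0"
  by (simp add: l2_def)

lemma l2norm_nonneg [simp]: "0 \<le> l2norm S f"
  by (simp add: l2norm_def infsum_nonneg)

lemma l2norm_sq: "(l2norm S f)\<^sup>2 = infsum (\<lambda>p. (cmod (f p))\<^sup>2) S"
  by (simp add: l2norm_def infsum_nonneg)

lemma L2_set_le_l2norm:
  assumes "f \<in> l2 S" "finite F"
  shows "L2_set (\<lambda>p. cmod (f p)) F \<le> l2norm S f"
proof -
  have "(\<Sum>p\<in>F. (cmod (f p))\<^sup>2) = (\<Sum>p\<in>F \<inter> S. (cmod (f p))\<^sup>2)"
    using assms by (intro sum.mono_neutral_right) (auto simp: l2_def)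
  also have "\<dots> \<le> infsum (\<lambda>p. (cmod (f p))\<^sup>2) S"
    using assms by (intro finite_sum_le_infsum) (auto simp: l2_def)
  finally show ?thesis
    by (simp add: L2_set_def l2norm_def)
qed

lemma sum_le_l2norm_sq:
  assumes "f \<in> l2 S" "finite F"
  shows "(\<Sum>p\<in>F. (cmod (f p))\<^sup>2) \<le> (l2norm S f)\<^sup>2"
  using power_mono[OF L2_set_le_l2norm[OF assms], of 2] by (simp add: L2_set_def sum_nonneg)

text \<open>A uniform bound on finite subsets gives membership and the norm bound together, so
  finite inequalities for \<open>L2_set\<close> carry over to infinite sums.\<close>

lemma
  assumes "\<And>p. p \<notin> S \<Longrightarrow> f p = 0"
    and "\<And>F. finite F \<Longrightarrow> F \<subseteq> S \<Longrightarrow> L2_set (\<lambda>p. cmod (f p)) F \<le> c"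
  shows l2I: "f \<in> l2 S" and l2norm_le: "l2norm S f \<le> c"
proof -
  have c: "0 \<le> c" using assms(2)[of "{}"] by simp
  have *: "(\<Sum>p\<in>F. (cmod (f p))\<^sup>2) \<le> c\<^sup>2" if "finite F" "F \<subseteq> S" for F
    using power_mono[OF assms(2)[OF that], of 2] by (simp add: L2_set_def sum_nonneg)
  have summable: "(\<lambda>p. (cmod (f p))\<^sup>2) summable_on S"
    using * by (intro nonneg_bdd_above_summable_on bdd_aboveI[where M = "c\<^sup>2"]) auto
  show "f \<in> l2 S" using summable assms(1) by (simp add: l2_def)
  have "infsum (\<lambda>p. (cmod (f p))\<^sup>2) S \<le> c\<^sup>2"
    using summable * by (intro infsum_le_finite_sums)
  then show "l2norm S f \<le> c"
    using c by (simp add: l2norm_def real_le_lsqrt)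
qed

lemma cmod_le_l2norm: "f \<in> l2 S \<Longrightarrow> cmod (f p) \<le> l2norm S f"
  using L2_set_le_l2norm[of f S "{p}"] by simp

lemma l2norm_eq_0_iff: "f \<in> l2 S \<Longrightarrow> l2norm S f = 0 \<longleftrightarrow> f = (\<lambda>p. 0)"
  using cmod_le_l2norm[of f S] by (force simp: l2norm_def)

lemma
  assumes "f \<in> l2 S" "g \<in> l2 S"
  shows l2_add: "(\<lambda>p. f p + g p) \<in> l2 S"
    and l2norm_triangle: "l2norm S (\<lambda>p. f p + g p) \<le> l2norm S f + l2norm S g"
proof -
  have "L2_set (\<lambda>p. cmod (f p + g p)) F \<le> l2norm S f + l2norm S g" if "finite F" for F
  proof -
    have "L2_set (\<lambda>p. cmod (f p + g p)) F \<le> L2_set (\<lambda>p. cmod (f p) + cmod (g p)) F"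
      by (intro L2_set_mono norm_triangle_ineq) auto
    also have "\<dots> \<le> L2_set (\<lambda>p. cmod (f p)) F + L2_set (\<lambda>p. cmod (g p)) F"
      by (rule L2_set_triangle_ineq)
    also have "\<dots> \<le> l2norm S f + l2norm S g"
      using assms that by (intro add_mono L2_set_le_l2norm)
    finally show ?thesis .
  qed
  then show "(\<lambda>p. f p + g p) \<in> l2 S" "l2norm S (\<lambda>p. f p + g p) \<le> l2norm S f + l2norm S g"
    using assms by (auto intro!: l2I l2norm_le simp: l2_outside)
qed

lemma l2_cmult: "f \<in> l2 S \<Longrightarrow> (\<lambda>p. c * f p) \<in> l2 S"
  by (auto simp: l2_def norm_mult power_mult_distrib intro: summable_on_cmult_right)

lemma l2norm_cmult: "l2norm S (\<lambda>p. c * f p) = cmod c * l2norm S f"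
  by (simp add: l2norm_def norm_mult power_mult_distrib infsum_cmult_right' real_sqrt_mult)

lemma l2_zero [simp]: "(\<lambda>p. 0) \<in> l2 S"
  by (simp add: l2_def)

lemma l2_diff: "f \<in> l2 S \<Longrightarrow> g \<in> l2 S \<Longrightarrow> (\<lambda>p. f p - g p) \<in> l2 S"
  using l2_add[of f S "\<lambda>p. (- 1) * g p"] l2_cmult[of g S "- 1"] by simp

lemma l2norm_triangle_diff:
  "f \<in> l2 S \<Longrightarrow> g \<in> l2 S \<Longrightarrow> l2norm S (\<lambda>p. f p - g p) \<le> l2norm S f + l2norm S g"
  using l2norm_triangle[of f S "\<lambda>p. (- 1) * g p"] l2_cmult[of g S "- 1"] l2norm_cmult[of S "- 1" g]
  by simp

lemma l2_sum: "(\<And>i. i \<in> A \<Longrightarrow> f i \<in> l2 S) \<Longrightarrow> (\<lambda>p. \<Sum>i\<in>A. f i p) \<in> l2 S"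
  by (induction A rule: infinite_finite_induct) (auto intro: l2_add)

lemma l2_finite_support:
  assumes "finite F" "F \<subseteq> S" "\<And>p. p \<notin> F \<Longrightarrow> f p = 0"
  shows "f \<in> l2 S"
proof (rule l2I[where c = "L2_set (\<lambda>p. cmod (f p)) F"])
  show "f p = 0" if "p \<notin> S" for p using that assms by auto
  show "L2_set (\<lambda>p. cmod (f p)) X \<le> L2_set (\<lambda>p. cmod (f p)) F" if "finite X" for X
  proof -
    have "(\<Sum>p\<in>X. (cmod (f p))\<^sup>2) = (\<Sum>p\<in>X \<inter> F. (cmod (f p))\<^sup>2)"
      using assms that by (intro sum.mono_neutral_right) auto
    also have "\<dots> \<le> (\<Sum>p\<in>F. (cmod (f p))\<^sup>2)"
      using assms by (intro sum_mono2) auto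
    finally show ?thesis by (simp add: L2_set_def)
  qed
qed

definition delta_at :: "'b \<Rightarrow> 'b \<Rightarrow> complex" where
  "delta_at r p = (if p = r then 1 else 0)"

lemma l2_delta_at: "r \<in> S \<Longrightarrow> delta_at r \<in> l2 S"
  by (rule l2_finite_support[of "{r}"]) (auto simp: delta_at_def)

lemma l2norm_delta_at: "r \<in> S \<Longrightarrow> l2norm S (delta_at r) = 1"
proof -
  assume "r \<in> S"
  then have "infsum (\<lambda>p. (cmod (delta_at r p))\<^sup>2) S = infsum (\<lambda>p. (cmod (delta_at r p))\<^sup>2) {r}"
    by (intro infsum_cong_neutral) (auto simp: delta_at_def)
  then show ?thesis by (simp add: l2norm_def delta_at_def)
qed

lemma l2_dominated:
  assumes f: "f \<in> l2 S" and le: "\<And>p. cmod (g p) \<le> c * cmod (f p)" and c: "0 \<le> c"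
  shows "g \<in> l2 S" "l2norm S g \<le> c * l2norm S f"
proof -
  have "L2_set (\<lambda>p. cmod (g p)) F \<le> c * l2norm S f" if "finite F" for F
  proof -
    have "L2_set (\<lambda>p. cmod (g p)) F \<le> L2_set (\<lambda>p. c * cmod (f p)) F"
      by (intro L2_set_mono le) auto
    also have "\<dots> = c * L2_set (\<lambda>p. cmod (f p)) F"
      using c by (simp add: L2_set_right_distrib)
    also have "\<dots> \<le> c * l2norm S f"
      using c f that by (intro mult_left_mono L2_set_le_l2norm)
    finally show ?thesis .
  qed
  moreover have "g p = 0" if "p \<notin> S" for p
    using le[of p] l2_outside[OF f that] by simp
  ultimately show "g \<in> l2 S" "l2norm S g \<le> c * l2norm S f"
    by (auto intro!: l2I l2norm_le)
qed

text \<open>Serves to extend functions on a branch to a larger branch by prepending the parent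
  vertex, and to compare covers with different roots.\<close>

lemma l2_inj_image:
  assumes f: "f \<in> l2 S" and inj: "inj_on h S" and sub: "h ` S \<subseteq> T"
    and g: "\<And>p. p \<in> S \<Longrightarrow> g (h p) = f p" and g0: "\<And>q. q \<notin> h ` S \<Longrightarrow> g q = 0"
  shows "g \<in> l2 T" "l2norm T g = l2norm S f"
proof -
  have "(\<lambda>q. (cmod (g q))\<^sup>2) summable_on h ` S"
    using f summable_on_reindex[OF inj, of "\<lambda>q. (cmod (g q))\<^sup>2"]
    by (simp add: l2_def o_def g cong: summable_on_cong)
  moreover have "(\<lambda>q. (cmod (g q))\<^sup>2) summable_on T \<longleftrightarrow> (\<lambda>q. (cmod (g q))\<^sup>2) summable_on h ` S"
    using sub g0 by (intro summable_on_cong_neutral) auto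
  ultimately have "(\<lambda>q. (cmod (g q))\<^sup>2) summable_on T" by simp
  moreover have "g q = 0" if "q \<notin> T" for q using that sub g0 by blast
  ultimately show "g \<in> l2 T" by (simp add: l2_def)
  have "infsum (\<lambda>q. (cmod (g q))\<^sup>2) T = infsum (\<lambda>q. (cmod (g q))\<^sup>2) (h ` S)"
    using sub g0 by (intro infsum_cong_neutral) auto
  also have "\<dots> = infsum (\<lambda>p. (cmod (f p))\<^sup>2) S"
    using inj by (simp add: infsum_reindex o_def g cong: infsum_cong)
  finally show "l2norm T g = l2norm S f" by (simp add: l2norm_def)
qed

text \<open>Completeness for sequences with geometrically small steps, as produced by Neumann
  series. The limit is pointwise; the tail bound passes to it on every finite set.\<close>

lemma l2_complete:
  assumes mem: "\<And>n. u n \<in> l2 S"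
    and step: "\<And>n. l2norm S (\<lambda>p. u (Suc n) p - u n p) \<le> c * q ^ n"
    and q: "0 \<le> q" "q < 1"
  obtains v where "v \<in> l2 S" "\<And>n. l2norm S (\<lambda>p. v p - u n p) \<le> c * q ^ n / (1 - q)"
proof -
  have c: "0 \<le> c" using order_trans[OF l2norm_nonneg step[of 0]] by simp
  have tele: "L2_set (\<lambda>p. cmod (u (n + m) p - u n p)) F \<le> c * q ^ n / (1 - q)"
    if "finite F" for F n m
  proof -
    have "L2_set (\<lambda>p. cmod (u (n + m) p - u n p)) F \<le> (\<Sum>j<m. c * q ^ (n + j))"
    proof (induction m)
      case 0
      show ?case by (simp add: L2_set_def)
    next
      case (Suc m)
      have "L2_set (\<lambda>p. cmod (u (n + Suc m) p - u n p)) F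
        \<le> L2_set (\<lambda>p. cmod (u (n + m) p - u n p) + cmod (u (Suc (n + m)) p - u (n + m) p)) F"
        by (intro L2_set_mono) (auto intro: order_trans[OF _ norm_triangle_ineq])
      also have "\<dots> \<le> L2_set (\<lambda>p. cmod (u (n + m) p - u n p)) F
          + L2_set (\<lambda>p. cmod (u (Suc (n + m)) p - u (n + m) p)) F"
        by (rule L2_set_triangle_ineq)
      also have "\<dots> \<le> (\<Sum>j<m. c * q ^ (n + j)) + c * q ^ (n + m)"
        by (rule add_mono[OF Suc order_trans[OF L2_set_le_l2norm step]]) (auto intro: l2_diff mem that)
      finally show ?case by simp
    qed
    also have "\<dots> = c * q ^ n * (\<Sum>j<m. q ^ j)"
      by (simp add: sum_distrib_left power_add mult.assoc)
    also have "\<dots> \<le> c * q ^ n * (1 / (1 - q))"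
      using c q sum_le_suminf[of "\<lambda>j. q ^ j" "{..<m}"]
      by (intro mult_left_mono) (auto simp: suminf_geometric)
    finally show ?thesis by simp
  qed
  have conv: "\<exists>l. (\<lambda>n. u n p) \<longlonglongrightarrow> l" for p
  proof -
    have "summable (\<lambda>n. u (Suc n) p - u n p)"
    proof (rule summable_comparison_test'[where g = "\<lambda>n. c * q ^ n" and N = 0])
      show "summable (\<lambda>n. c * q ^ n)" using q by (simp add: summable_mult)
      show "norm (u (Suc n) p - u n p) \<le> c * q ^ n" for n
        using cmod_le_l2norm[OF l2_diff[OF mem[of "Suc n"] mem[of n]], of p] step[of n] by simp
    qed
    then have "convergent (\<lambda>n. \<Sum>i<n. u (Suc i) p - u i p)"
      by (simp add: summable_iff_convergent)
    then obtain l where "(\<lambda>n. u n p - u 0 p) \<longlonglongrightarrow> l"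
      using sum_lessThan_telescope[of "\<lambda>n. u n p"] by (auto simp: convergent_def)
    from tendsto_add[OF this tendsto_const[of "u 0 p"]] show ?thesis by auto
  qed
  then obtain v where v: "(\<lambda>n. u n p) \<longlonglongrightarrow> v p" for p by metis
  have bound: "L2_set (\<lambda>p. cmod (v p - u n p)) F \<le> c * q ^ n / (1 - q)" if "finite F" for F n
  proof (rule LIMSEQ_le_const2)
    show "(\<lambda>m. L2_set (\<lambda>p. cmod (u (n + m) p - u n p)) F) \<longlonglongrightarrow> L2_set (\<lambda>p. cmod (v p - u n p)) F"
      unfolding L2_set_def
      by (intro tendsto_intros, subst add.commute, intro LIMSEQ_ignore_initial_segment v)
  qed (use tele[OF that] in blast)
  have zero: "v p = 0" if "p \<notin> S" for p
    using v[of p] l2_outside[OF mem that] by (simp add: LIMSEQ_const_iff)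
  have diff: "(\<lambda>p. v p - u n p) \<in> l2 S" "l2norm S (\<lambda>p. v p - u n p) \<le> c * q ^ n / (1 - q)" for n
    using bound zero l2_outside[OF mem] by (auto intro!: l2I l2norm_le)
  have "v \<in> l2 S" using l2_add[OF diff(1)[of 0] mem[of 0]] by simp
  then show thesis using that diff(2) by blast
qed

text \<open>Fixed point of the contraction f -> g + K f by iteration. Only successive differences
  are compared, so compatibility of K with differences takes the place of linearity.\<close>

lemma l2_neumann:
  assumes mem: "\<And>f. f \<in> l2 S \<Longrightarrow> K f \<in> l2 S"
    and diff: "\<And>f g. f \<in> l2 S \<Longrightarrow> g \<in> l2 S \<Longrightarrow> K (\<lambda>p. f p - g p) = (\<lambda>p. K f p - K g p)"
    and bound: "\<And>f. f \<in> l2 S \<Longrightarrow> l2norm S (K f) \<le> q * l2norm S f"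
    and q: "0 \<le> q" "q < 1" and g: "g \<in> l2 S"
  obtains v where "v \<in> l2 S" "v = (\<lambda>p. g p + K v p)"
proof -
  define u where "u n = ((\<lambda>f p. g p + K f p) ^^ n) g" for n
  have u_Suc: "u (Suc n) = (\<lambda>p. g p + K (u n) p)" for n by (simp add: u_def)
  have u_mem: "u n \<in> l2 S" for n
    by (induction n) (auto simp: u_Suc g mem l2_add, simp add: u_def g)
  have step: "l2norm S (\<lambda>p. u (Suc n) p - u n p) \<le> l2norm S (K g) * q ^ n" for n
  proof (induction n)
    case 0
    then show ?case by (simp add: u_def)
  next
    case (Suc n)
    have "(\<lambda>p. u (Suc (Suc n)) p - u (Suc n) p) = K (\<lambda>p. u (Suc n) p - u n p)"
      by (simp add: diff u_mem u_Suc[of "Suc n"]) (simp add: u_Suc[of n])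
    then have "l2norm S (\<lambda>p. u (Suc (Suc n)) p - u (Suc n) p) \<le> q * l2norm S (\<lambda>p. u (Suc n) p - u n p)"
      using bound[OF l2_diff[OF u_mem u_mem]] by simp
    also have "\<dots> \<le> q * (l2norm S (K g) * q ^ n)"
      using Suc q by (intro mult_left_mono)
    finally show ?case by (simp add: mult_ac)
  qed
  obtain v where v: "v \<in> l2 S" "\<And>n. l2norm S (\<lambda>p. v p - u n p) \<le> l2norm S (K g) * q ^ n / (1 - q)"
    using l2_complete[OF u_mem step q] by blast
  define c where "c = l2norm S (K g) / (1 - q)"
  have w: "(\<lambda>p. v p - (g p + K v p)) \<in> l2 S"
    by (intro l2_diff l2_add g mem v)
  \<comment> \<open>The defect of v in the fixed point equation is independent of n and is compared
    with every iterate; the right-hand side tends to 0.\<close>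
  have "l2norm S (\<lambda>p. v p - (g p + K v p)) \<le> c * q ^ Suc n + q * (c * q ^ n)" for n
  proof -
    have eq: "(\<lambda>p. v p - (g p + K v p)) = (\<lambda>p. (v p - u (Suc n) p) - K (\<lambda>p. v p - u n p) p)"
      by (simp add: u_Suc diff v u_mem algebra_simps)
    have "l2norm S (\<lambda>p. v p - (g p + K v p)) \<le> l2norm S (\<lambda>p. v p - u (Suc n) p) + l2norm S (K (\<lambda>p. v p - u n p))"
      unfolding eq by (intro l2norm_triangle_diff l2_diff mem v u_mem)
    also have "\<dots> \<le> c * q ^ Suc n + q * (c * q ^ n)"
    proof (rule add_mono)
      show "l2norm S (\<lambda>p. v p - u (Suc n) p) \<le> c * q ^ Suc n"
        using v(2)[of "Suc n"] by (simp add: c_def)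
      have "l2norm S (K (\<lambda>p. v p - u n p)) \<le> q * l2norm S (\<lambda>p. v p - u n p)"
        by (intro bound l2_diff v u_mem)
      also have "\<dots> \<le> q * (c * q ^ n)"
        using v(2)[of n] q by (intro mult_left_mono) (auto simp: c_def)
      finally show "l2norm S (K (\<lambda>p. v p - u n p)) \<le> q * (c * q ^ n)" .
    qed
    finally show ?thesis .
  qed
  moreover have "(\<lambda>n. c * q ^ Suc n + q * (c * q ^ n)) \<longlonglongrightarrow> c * 0 + q * (c * 0)"
    using q by (intro tendsto_intros LIMSEQ_power_zero LIMSEQ_Suc[of "\<lambda>n. q ^ n"]) auto
  ultimately have "l2norm S (\<lambda>p. v p - (g p + K v p)) \<le> 0"
    using LIMSEQ_le_const by fastforce
  then have "(\<lambda>p. v p - (g p + K v p)) = (\<lambda>p. 0)"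
    using l2norm_eq_0_iff[OF w] by (simp add: order_antisym)
  then have "v = (\<lambda>p. g p + K v p)"
    by (simp add: fun_eq_iff)
  then show thesis using that v by blast
qed

lemma mult_le_sum_squares:
  fixes x y :: real assumes "0 \<le> x" "0 \<le> y" shows "x * y \<le> x\<^sup>2 + y\<^sup>2"
proof -
  have "0 \<le> (x - y)\<^sup>2 + x * y" using assms by simp
  also have "\<dots> = x\<^sup>2 + y\<^sup>2 - x * y" by (simp add: power2_eq_square algebra_simps)
  finally show ?thesis by simp
qed

section \<open>Inner product of square summable functions\<close>

definition l2ip :: "'b set \<Rightarrow> ('b \<Rightarrow> complex) \<Rightarrow> ('b \<Rightarrow> complex) \<Rightarrow> complex" where
  "l2ip S f g = infsum (\<lambda>p. f p * cnj (g p)) S"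

lemma l2ip_summable:
  assumes "f \<in> l2 S" "g \<in> l2 S"
  shows "(\<lambda>p. f p * cnj (g p)) summable_on S"
proof (rule abs_summable_summable, rule Infinite_Sum.abs_summable_on_comparison_test')
  show "(\<lambda>p. (cmod (f p))\<^sup>2 + (cmod (g p))\<^sup>2) summable_on S"
    using assms by (intro summable_on_add) (auto simp: l2_def)
  show "cmod (f p * cnj (g p)) \<le> (cmod (f p))\<^sup>2 + (cmod (g p))\<^sup>2" for p
    by (simp add: norm_mult mult_le_sum_squares)
qed

lemma l2ip_add_left:
  "\<lbrakk>f \<in> l2 S; f' \<in> l2 S; g \<in> l2 S\<rbrakk> \<Longrightarrow> l2ip S (\<lambda>p. f p + f' p) g = l2ip S f g + l2ip S f' g"
  by (simp add: l2ip_def distrib_right infsum_add l2ip_summable)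

lemma l2ip_cmult_left: "l2ip S (\<lambda>p. c * f p) g = c * l2ip S f g"
  by (simp add: l2ip_def infsum_cmult_right' mult.assoc)

lemma l2ip_commute: "l2ip S f g = cnj (l2ip S g f)"
  by (simp add: l2ip_def mult.commute flip: infsum_cnj)

lemma l2ip_diff_left:
  "\<lbrakk>f \<in> l2 S; f' \<in> l2 S; g \<in> l2 S\<rbrakk> \<Longrightarrow> l2ip S (\<lambda>p. f p - f' p) g = l2ip S f g - l2ip S f' g"
  using l2ip_add_left[of f S "\<lambda>p. (- 1) * f' p" g] l2_cmult[of f' S "- 1"] l2ip_cmult_left[of S "-1" f' g]
  by simp

lemma l2ip_self:
  assumes "f \<in> l2 S"
  shows "l2ip S f f = of_real ((l2norm S f)\<^sup>2)"
proof -
  have "(\<lambda>p. f p * cnj (f p)) = (\<lambda>p. of_real ((cmod (f p))\<^sup>2))"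
    by (simp only: complex_norm_square)
  then show ?thesis
    unfolding l2norm_sq l2ip_def
    using assms by (simp only:) (intro infsumI has_sum_of_real has_sum_infsum, simp add: l2_def)
qed

lemma l2ip_delta_at_left: "r \<in> S \<Longrightarrow> l2ip S (delta_at r) g = cnj (g r)"
proof -
  assume "r \<in> S"
  then have "infsum (\<lambda>p. delta_at r p * cnj (g p)) S = infsum (\<lambda>p. delta_at r p * cnj (g p)) {r}"
    by (intro infsum_cong_neutral) (auto simp: delta_at_def)
  then show ?thesis by (simp add: l2ip_def delta_at_def)
qed

lemma l2norm_add_sq:
  assumes "f \<in> l2 S" "g \<in> l2 S"
  shows "(l2norm S (\<lambda>p. f p + g p))\<^sup>2 = (l2norm S f)\<^sup>2 + (l2norm S g)\<^sup>2 + 2 * Re (l2ip S f g)"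
proof -
  let ?h = "\<lambda>p. f p + g p"
  have h: "?h \<in> l2 S" by (intro l2_add assms)
  have "complex_of_real ((l2norm S ?h)\<^sup>2) = l2ip S f ?h + l2ip S g ?h"
    using assms h by (simp only: l2ip_self[symmetric] l2ip_add_left)
  also have "\<dots> = cnj (l2ip S ?h f) + cnj (l2ip S ?h g)"
    by (simp flip: l2ip_commute)
  also have "\<dots> = l2ip S f f + l2ip S g g + (l2ip S f g + cnj (l2ip S f g))"
    using assms by (simp add: l2ip_add_left flip: l2ip_commute)
  finally have "Re (complex_of_real ((l2norm S ?h)\<^sup>2)) = Re \<dots>" by simp
  then show ?thesis using assms by (simp add: l2ip_self)
qed

section \<open>Schroedinger operators on locally finite forests of lists\<close>

lemma tadj_sym: "tadj p q \<longleftrightarrow> tadj q p"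
  by (auto simp: tadj_def)

lemma schr_outside: "p \<notin> S \<Longrightarrow> schr W S f p = 0"
  by (simp add: schr_def)

lemma schr_add: "schr W S (\<lambda>p. f p + g p) = (\<lambda>p. schr W S f p + schr W S g p)"
  by (auto simp: schr_def sum.distrib algebra_simps fun_eq_iff)

lemma schr_cmult: "schr W S (\<lambda>p. c * f p) = (\<lambda>p. c * schr W S f p)"
  by (auto simp: schr_def sum_distrib_left algebra_simps fun_eq_iff)

lemma schr_diff: "schr W S (\<lambda>p. f p - g p) = (\<lambda>p. schr W S f p - schr W S g p)"
  by (auto simp: schr_def sum_subtractf algebra_simps fun_eq_iff)

definition shifted :: "('a \<Rightarrow> real) \<Rightarrow> 'a list set \<Rightarrow> complex \<Rightarrow> ('a list \<Rightarrow> complex) \<Rightarrow> 'a list \<Rightarrow> complex" where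
  "shifted W S z f = (\<lambda>p. schr W S f p - z * f p)"

lemma shifted_add: "shifted W S z (\<lambda>p. f p + g p) = (\<lambda>p. shifted W S z f p + shifted W S z g p)"
  by (auto simp: shifted_def schr_add algebra_simps)

lemma shifted_cmult: "shifted W S z (\<lambda>p. c * f p) = (\<lambda>p. c * shifted W S z f p)"
  by (auto simp: shifted_def schr_cmult algebra_simps)

lemma shifted_diff: "shifted W S z (\<lambda>p. f p - g p) = (\<lambda>p. shifted W S z f p - shifted W S z g p)"
  by (auto simp: shifted_def schr_diff algebra_simps)

lemma sum_sq_le_card: "(\<Sum>i\<in>A. f i)\<^sup>2 \<le> real (card A) * (\<Sum>i\<in>A. (f i)\<^sup>2)" for f :: "'b \<Rightarrow> real"
  using Cauchy_Schwarz_ineq_sum[of "\<lambda>_. 1" f A] by simp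

text \<open>Bounded degree and bounded potential make the operator bounded. The locale is
  instantiated both with the whole cover and with each of its branches.\<close>

locale tree_op =
  fixes W :: "'a \<Rightarrow> real" and S :: "'a list set" and D :: nat and w :: real
  assumes finite_nbr: "p \<in> S \<Longrightarrow> finite {q \<in> S. tadj p q}"
    and card_nbr: "p \<in> S \<Longrightarrow> card {q \<in> S. tadj p q} \<le> D"
    and W_bound: "p \<in> S \<Longrightarrow> \<bar>W (last p)\<bar> \<le> w" and w_nonneg: "0 \<le> w"
begin

abbreviation nbr :: "'a list \<Rightarrow> 'a list set" where "nbr p \<equiv> {q \<in> S. tadj p q}"

text \<open>Schur test: Cauchy--Schwarz over at most D neighbours, then at most D rows meet each
  column. The kernel is 1 for the adjacency operator and a ratio of weights in the Combes--Thomas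
  estimate.\<close>

lemma
  assumes f: "f \<in> l2 S" and k: "\<And>p q. p \<in> S \<Longrightarrow> q \<in> nbr p \<Longrightarrow> cmod (k p q) \<le> c" and c: "0 \<le> c"
  shows l2_band: "(\<lambda>p. if p \<in> S then \<Sum>q\<in>nbr p. k p q * f q else 0) \<in> l2 S" (is "?g \<in> _")
    and l2norm_band: "l2norm S (\<lambda>p. if p \<in> S then \<Sum>q\<in>nbr p. k p q * f q else 0) \<le> c * D * l2norm S f"
proof -
  have "L2_set (\<lambda>p. cmod (?g p)) F \<le> c * D * l2norm S f" if F: "finite F" "F \<subseteq> S" for F
  proof -
    define U where "U = (\<Union>p\<in>F. nbr p)"
    have U: "finite U" "U \<subseteq> S" using F finite_nbr by (auto simp: U_def)
    have "(cmod (?g p))\<^sup>2 \<le> c\<^sup>2 * D * (\<Sum>q\<in>nbr p. (cmod (f q))\<^sup>2)" if "p \<in> F" for p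
    proof -
      have p: "p \<in> S" using that F by auto
      have "cmod (?g p) \<le> (\<Sum>q\<in>nbr p. c * cmod (f q))"
        using p k by (auto intro!: sum_norm_le mult_right_mono simp: norm_mult)
      then have "(cmod (?g p))\<^sup>2 \<le> (\<Sum>q\<in>nbr p. c * cmod (f q))\<^sup>2"
        by (intro power_mono) auto
      also have "\<dots> \<le> card (nbr p) * (\<Sum>q\<in>nbr p. (c * cmod (f q))\<^sup>2)"
        by (rule sum_sq_le_card)
      also have "\<dots> \<le> D * (\<Sum>q\<in>nbr p. (c * cmod (f q))\<^sup>2)"
        using card_nbr[OF p] by (intro mult_right_mono sum_nonneg) auto
      also have "\<dots> = c\<^sup>2 * D * (\<Sum>q\<in>nbr p. (cmod (f q))\<^sup>2)"
        by (simp add: power_mult_distrib sum_distrib_left mult_ac)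
      finally show ?thesis .
    qed
    then have "(\<Sum>p\<in>F. (cmod (?g p))\<^sup>2) \<le> (\<Sum>p\<in>F. c\<^sup>2 * D * (\<Sum>q\<in>nbr p. (cmod (f q))\<^sup>2))"
      by (rule sum_mono)
    also have "\<dots> = c\<^sup>2 * D * (\<Sum>p\<in>F. \<Sum>q\<in>{q \<in> U. tadj p q}. (cmod (f q))\<^sup>2)"
      unfolding sum_distrib_left[symmetric] using U
      by (intro arg_cong[where f = "\<lambda>t. c\<^sup>2 * D * t"] sum.cong) (auto simp: U_def)
    \<comment> \<open>After the exchange each q is counted once for each neighbour in F, hence at
      most D times.\<close>
    also have "(\<Sum>p\<in>F. \<Sum>q\<in>{q \<in> U. tadj p q}. (cmod (f q))\<^sup>2) = (\<Sum>q\<in>U. \<Sum>p\<in>{p \<in> F. tadj p q}. (cmod (f q))\<^sup>2)"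
      using F U by (intro sum.swap_restrict)
    also have "\<dots> \<le> (\<Sum>q\<in>U. D * (cmod (f q))\<^sup>2)"
    proof (rule sum_mono)
      fix q assume q: "q \<in> U"
      have "card {p \<in> F. tadj p q} \<le> card (nbr q)"
        using F U q by (intro card_mono finite_nbr) (auto simp: tadj_sym)
      then have "card {p \<in> F. tadj p q} \<le> D" using card_nbr[of q] q U by auto
      then show "(\<Sum>p\<in>{p \<in> F. tadj p q}. (cmod (f q))\<^sup>2) \<le> D * (cmod (f q))\<^sup>2"
        by (simp add: mult_right_mono)
    qed
    also have "\<dots> \<le> D * (l2norm S f)\<^sup>2"
      using sum_le_l2norm_sq[OF f U(1)] by (simp add: mult_left_mono flip: sum_distrib_left)
    finally have "(\<Sum>p\<in>F. (cmod (?g p))\<^sup>2) \<le> c\<^sup>2 * D * (D * (l2norm S f)\<^sup>2)"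
      by (simp add: mult_left_mono)
    also have "\<dots> = (c * D * l2norm S f)\<^sup>2" by (simp add: power2_eq_square)
    finally show ?thesis
      unfolding L2_set_def using c by (intro real_le_lsqrt) (auto intro: sum_nonneg)
  qed
  then show "?g \<in> l2 S" "l2norm S ?g \<le> c * D * l2norm S f"
    by (auto intro!: l2I l2norm_le)
qed

lemma
  assumes f: "f \<in> l2 S"
  shows schr_l2: "schr W S f \<in> l2 S" and l2norm_schr: "l2norm S (schr W S f) \<le> (D + w) * l2norm S f"
proof -
  let ?g = "\<lambda>p. if p \<in> S then \<Sum>q\<in>nbr p. 1 * f q else 0"
  let ?h = "\<lambda>p. if p \<in> S then complex_of_real (W (last p)) * f p else 0"
  have eq: "schr W S f = (\<lambda>p. ?g p + ?h p)"
    by (auto simp: schr_def fun_eq_iff)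
  have g: "?g \<in> l2 S" "l2norm S ?g \<le> 1 * D * l2norm S f"
    using l2_band[OF f, of "\<lambda>_ _. 1" 1] l2norm_band[OF f, of "\<lambda>_ _. 1" 1] by auto
  have "cmod (?h p) \<le> w * cmod (f p)" for p
    using W_bound[of p] w_nonneg by (auto simp: norm_mult mult_right_mono)
  then have h: "?h \<in> l2 S" "l2norm S ?h \<le> w * l2norm S f"
    using l2_dominated[OF f _ w_nonneg, of ?h] by auto
  show "schr W S f \<in> l2 S" unfolding eq using g h by (intro l2_add)
  show "l2norm S (schr W S f) \<le> (D + w) * l2norm S f"
    unfolding eq using l2norm_triangle[OF g(1) h(1)] g(2) h(2) by (simp add: distrib_right)
qed

lemma shifted_l2: "f \<in> l2 S \<Longrightarrow> shifted W S z f \<in> l2 S"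
  unfolding shifted_def by (intro l2_diff l2_cmult schr_l2)

lemma l2norm_shifted: "f \<in> l2 S \<Longrightarrow> l2norm S (shifted W S z f) \<le> (D + w + cmod z) * l2norm S f"
  unfolding shifted_def
  using l2norm_triangle_diff[OF schr_l2 l2_cmult, of f f z] l2norm_schr[of f] l2norm_cmult[of S z f]
  by (simp add: distrib_right)

text \<open>Absolute convergence over directed edges, which licenses reordering the double sum: the
  product is at most |f q|^2 + |g p|^2, and bounded degree makes each square summable over
  edges.\<close>

lemma adjacency_summable:
  assumes f: "f \<in> l2 S" and g: "g \<in> l2 S"
  shows "(\<lambda>(p, q). f q * cnj (g p)) summable_on Sigma S nbr"
proof (rule abs_summable_summable, rule Infinite_Sum.abs_summable_on_comparison_test')
  have fst_summable: "(\<lambda>(p, q). (cmod (h p))\<^sup>2) summable_on Sigma S nbr" if h: "h \<in> l2 S" for h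
  proof (rule nonneg_bdd_above_summable_on)
    show "bdd_above (sum (\<lambda>(p, q). (cmod (h p))\<^sup>2) ` {F. F \<subseteq> Sigma S nbr \<and> finite F})"
    proof (intro bdd_aboveI[where M = "D * (l2norm S h)\<^sup>2"], clarsimp)
      fix F assume F: "F \<subseteq> Sigma S nbr" "finite F"
      have fin: "finite (fst ` F)" "fst ` F \<subseteq> S" using F by auto
      have "(\<Sum>x\<in>F. case x of (p, q) \<Rightarrow> (cmod (h p))\<^sup>2) \<le> (\<Sum>x\<in>Sigma (fst ` F) nbr. case x of (p, q) \<Rightarrow> (cmod (h p))\<^sup>2)"
        using F fin by (intro sum_mono2 finite_SigmaI finite_nbr) (force+)
      also have "\<dots> = (\<Sum>p\<in>fst ` F. \<Sum>q\<in>nbr p. (cmod (h p))\<^sup>2)"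
        using fin finite_nbr by (subst sum.Sigma) auto
      also have "\<dots> \<le> (\<Sum>p\<in>fst ` F. D * (cmod (h p))\<^sup>2)"
        using fin card_nbr by (intro sum_mono) (auto intro!: mult_right_mono)
      also have "\<dots> \<le> D * (l2norm S h)\<^sup>2"
        using sum_le_l2norm_sq[OF h fin(1)] by (simp add: mult_left_mono flip: sum_distrib_left)
      finally show "(\<Sum>x\<in>F. case x of (p, q) \<Rightarrow> (cmod (h p))\<^sup>2) \<le> D * (l2norm S h)\<^sup>2" .
    qed
  qed auto
  have swap: "prod.swap ` Sigma S nbr = Sigma S nbr" by (force simp: tadj_sym)
  have "(\<lambda>(p, q). (cmod (f q))\<^sup>2) summable_on Sigma S nbr"
    using fst_summable[OF f] summable_on_reindex[of prod.swap "Sigma S nbr" "\<lambda>(p, q). (cmod (f q))\<^sup>2"]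
    unfolding swap by (simp add: o_def case_prod_beta')
  then show "(\<lambda>x. (case x of (p, q) \<Rightarrow> (cmod (f q))\<^sup>2) + (case x of (p, q) \<Rightarrow> (cmod (g p))\<^sup>2)) summable_on Sigma S nbr"
    by (rule summable_on_add[OF _ fst_summable[OF g]])
  show "cmod (case x of (p, q) \<Rightarrow> f q * cnj (g p))
    \<le> (case x of (p, q) \<Rightarrow> (cmod (f q))\<^sup>2) + (case x of (p, q) \<Rightarrow> (cmod (g p))\<^sup>2)" for x
    by (simp add: norm_mult case_prod_beta' mult_le_sum_squares)
qed

lemma l2ip_schr_expand:
  assumes f: "f \<in> l2 S" and g: "g \<in> l2 S"
  shows "l2ip S (schr W S f) g = infsum (\<lambda>(p, q). f q * cnj (g p)) (Sigma S nbr)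
    + infsum (\<lambda>p. complex_of_real (W (last p)) * (f p * cnj (g p))) S"
proof -
  let ?h = "\<lambda>p. if p \<in> S then complex_of_real (W (last p)) * f p else 0"
  let ?a = "\<lambda>p. if p \<in> S then \<Sum>q\<in>nbr p. 1 * f q else 0"
  have "cmod (?h p) \<le> w * cmod (f p)" for p
    using W_bound[of p] w_nonneg by (auto simp: norm_mult mult_right_mono)
  then have h: "?h \<in> l2 S"
    using l2_dominated[OF f _ w_nonneg, of ?h] by auto
  have a: "?a \<in> l2 S" using l2_band[OF f, of "\<lambda>_ _. 1" 1] by simp
  have "schr W S f = (\<lambda>p. ?a p + ?h p)" by (auto simp: schr_def fun_eq_iff)
  then have "l2ip S (schr W S f) g = l2ip S ?a g + l2ip S ?h g"
    using l2ip_add_left[OF a h g] by simp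
  also have "l2ip S ?h g = infsum (\<lambda>p. complex_of_real (W (last p)) * (f p * cnj (g p))) S"
    unfolding l2ip_def by (intro infsum_cong) auto
  also have "l2ip S ?a g = infsum (\<lambda>p. infsum (\<lambda>q. f q * cnj (g p)) (nbr p)) S"
    unfolding l2ip_def by (intro infsum_cong) (simp add: finite_nbr sum_distrib_right)
  also have "\<dots> = infsum (\<lambda>(p, q). f q * cnj (g p)) (Sigma S nbr)"
    using adjacency_summable[OF f g] by (rule infsum_Sigma'_banach)
  finally show ?thesis .
qed

text \<open>Reversing all directed edges exchanges the two adjacency sums, and the potential is
  real.\<close>

lemma schr_symmetric:
  assumes f: "f \<in> l2 S" and g: "g \<in> l2 S"
  shows "l2ip S (schr W S f) g = l2ip S f (schr W S g)"
proof -
  have swap: "prod.swap ` Sigma S nbr = Sigma S nbr" by (force simp: tadj_sym)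
  have "l2ip S f (schr W S g) = cnj (l2ip S (schr W S g) f)"
    by (rule l2ip_commute)
  also have "\<dots> = infsum (\<lambda>(p, q). cnj (g q) * f p) (Sigma S nbr)
    + infsum (\<lambda>p. complex_of_real (W (last p)) * (f p * cnj (g p))) S"
    unfolding l2ip_schr_expand[OF g f] by (simp add: case_prod_beta' mult_ac flip: infsum_cnj)
  also have "infsum (\<lambda>(p, q). cnj (g q) * f p) (Sigma S nbr) = infsum (\<lambda>(p, q). f q * cnj (g p)) (Sigma S nbr)"
    using infsum_reindex[of prod.swap "Sigma S nbr" "\<lambda>(p, q). f q * cnj (g p)"]
    unfolding swap by (simp add: o_def case_prod_beta' mult.commute)
  finally show ?thesis unfolding l2ip_schr_expand[OF f g] by simp
qed

section \<open>Solving (H - z) u = g off the real axis, and Green functions\<close>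

lemma Im_schr_form: "f \<in> l2 S \<Longrightarrow> Im (l2ip S (schr W S f) f) = 0"
  using schr_symmetric[of f f] l2ip_commute[of S "schr W S f" f] by (metis Im_complex_of_real Reals_cnj_iff complex_is_Real_iff)

text \<open>The quadratic form of H is real, so the imaginary part sees only z. This yields
  injectivity off the real axis and the sign of the Green function.\<close>

lemma Im_shifted_form: "f \<in> l2 S \<Longrightarrow> Im (l2ip S (shifted W S z f) f) = - Im z * (l2norm S f)\<^sup>2"
  unfolding shifted_def
  by (subst l2ip_diff_left) (auto simp: schr_l2 l2_cmult Im_schr_form l2ip_cmult_left l2ip_self)

lemma shifted_injective:
  assumes f: "f \<in> l2 S" and "shifted W S z f = (\<lambda>p. 0)" and z: "Im z \<noteq> 0"
  shows "f = (\<lambda>p. 0)"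
proof -
  have "Im z * (l2norm S f)\<^sup>2 = 0" using Im_shifted_form[OF f, of z] assms(2) by (simp add: l2ip_def)
  then show ?thesis using z l2norm_eq_0_iff[OF f] by simp
qed

text \<open>For \<open>\<epsilon> = b / (b\<^sup>2 + h\<^sup>2)\<close> the map \<open>f \<mapsto> f - \<i> \<epsilon> (H - z) f\<close> is a contraction: the
anti-self-adjoint part is orthogonal to the scalar part.\<close>

lemma shifted_surjective:
  assumes g: "g \<in> l2 S" and z: "Im z > 0"
  obtains u where "u \<in> l2 S" "shifted W S z u = g"
proof -
  define b where "b = Im z"
  define h where "h = D + w + \<bar>Re z\<bar>"
  \<comment> \<open>The minimiser over e of 1 - 2 e b + e^2 (b^2 + h^2); the minimum is
    \<open>q\<^sup>2\<close>. Here h bounds the norm of H - Re z.\<close>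
  define e where "e = b / (b\<^sup>2 + h\<^sup>2)"
  define q where "q = sqrt (h\<^sup>2 / (b\<^sup>2 + h\<^sup>2))"
  have b: "b > 0" and h: "h \<ge> 0" using z w_nonneg by (auto simp: b_def h_def)
  have pos: "b\<^sup>2 + h\<^sup>2 > 0" using b by (simp add: add_pos_nonneg)
  have e: "e > 0" using b pos by (simp add: e_def)
  let ?A = "\<lambda>f. shifted W S (complex_of_real (Re z)) f"
  define K where "K f = (\<lambda>p. of_real (1 - e * b) * f p + (- \<i> * e) * ?A f p)" for f
  have K_eq: "K f = (\<lambda>p. f p - \<i> * e * shifted W S z f p)" for f
  proof -
    have "z = complex_of_real (Re z) + \<i> * b" by (simp add: b_def complex_eq)
    from arg_cong[OF this, of "\<lambda>t. t * f p" for p]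
    have sh: "shifted W S z f p = ?A f p - \<i> * b * f p" for p
      unfolding shifted_def by (simp add: distrib_right)
    show ?thesis unfolding K_def sh by (simp add: algebra_simps)
  qed
  have K_l2: "K f \<in> l2 S" if "f \<in> l2 S" for f
    unfolding K_def by (intro l2_add l2_cmult shifted_l2 that)
  have K_diff: "K (\<lambda>p. f p - g p) = (\<lambda>p. K f p - K g p)" for f g
    unfolding K_def shifted_diff by (simp add: algebra_simps)
  have K_bound: "l2norm S (K f) \<le> q * l2norm S f" if f: "f \<in> l2 S" for f
  proof -
    have "l2ip S f (?A f) = cnj (l2ip S (?A f) f)" by (rule l2ip_commute)
    moreover have "Im (l2ip S (?A f) f) = 0" using Im_shifted_form[OF f, of "complex_of_real (Re z)"] by simp
    ultimately have Im0: "Im (l2ip S f (?A f)) = 0" by simp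
    let ?f1 = "\<lambda>p. of_real (1 - e * b) * f p" and ?f2 = "\<lambda>p. (- \<i> * e) * ?A f p"
    have "l2ip S ?f1 ?f2 = of_real (1 - e * b) * cnj (l2ip S ?f2 f)"
      by (simp only: l2ip_cmult_left l2ip_commute[of S f])
    also have "\<dots> = of_real (1 - e * b) * (\<i> * e * l2ip S f (?A f))"
      by (simp only: l2ip_cmult_left complex_cnj_mult) (simp flip: l2ip_commute)
    finally have cross: "Re (l2ip S ?f1 ?f2) = 0" using Im0 by simp
    have "(l2norm S (K f))\<^sup>2 = (l2norm S ?f1)\<^sup>2 + (l2norm S ?f2)\<^sup>2"
      unfolding K_def using l2norm_add_sq[of ?f1 S ?f2] f cross by (simp only: l2_cmult shifted_l2)
    also have "\<dots> = (1 - e * b)\<^sup>2 * (l2norm S f)\<^sup>2 + e\<^sup>2 * (l2norm S (?A f))\<^sup>2"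
      using e by (simp only: l2norm_cmult norm_of_real) (simp add: norm_mult power_mult_distrib)
    also have "\<dots> \<le> (1 - e * b)\<^sup>2 * (l2norm S f)\<^sup>2 + e\<^sup>2 * (h * l2norm S f)\<^sup>2"
      using l2norm_shifted[OF f, of "complex_of_real (Re z)"]
      by (intro add_mono mult_left_mono power_mono) (auto simp: h_def)
    also have "\<dots> = ((1 - e * b)\<^sup>2 + e\<^sup>2 * h\<^sup>2) * (l2norm S f)\<^sup>2"
      by (simp add: power_mult_distrib algebra_simps)
    also have "(1 - e * b)\<^sup>2 + e\<^sup>2 * h\<^sup>2 = 1 - 2 * (e * b) + e\<^sup>2 * (b\<^sup>2 + h\<^sup>2)"
      by (simp add: power2_eq_square algebra_simps)
    also have "e\<^sup>2 * (b\<^sup>2 + h\<^sup>2) = e * b"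
      using pos by (simp add: e_def power2_eq_square)
    also have "1 - 2 * (e * b) + e * b = q\<^sup>2"
    proof -
      have "b\<^sup>2 / (b\<^sup>2 + h\<^sup>2) + h\<^sup>2 / (b\<^sup>2 + h\<^sup>2) = 1"
        using b by (simp flip: add_divide_distrib)
      moreover have "e * b = b\<^sup>2 / (b\<^sup>2 + h\<^sup>2)" "q\<^sup>2 = h\<^sup>2 / (b\<^sup>2 + h\<^sup>2)"
        using pos by (simp_all add: q_def e_def power2_eq_square)
      ultimately show ?thesis by linarith
    qed
    finally have "(l2norm S (K f))\<^sup>2 \<le> (q * l2norm S f)\<^sup>2" by (simp add: power_mult_distrib)
    then show ?thesis
      by (rule power2_le_imp_le) (simp add: q_def)
  qed
  have q: "0 \<le> q" "q < 1" using pos b by (auto simp: q_def)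
  obtain u where u: "u \<in> l2 S" "u = (\<lambda>p. (\<i> * e * g p) + K u p)"
    using l2_neumann[of S K q "\<lambda>p. \<i> * e * g p", OF K_l2 K_diff K_bound q l2_cmult[OF g]] by blast
  have "shifted W S z u p = g p" for p
    using fun_cong[OF u(2), of p] e unfolding K_eq by simp
  then show thesis using that u(1) by blast
qed

text \<open>Resolves the definite description in \<open>green\<close>; two solutions differ by an
  element of the kernel of H - z, which is trivial off the real axis.\<close>

lemma green_eqI:
  assumes u: "u \<in> l2 S" "shifted W S z u = delta_at r" and z: "Im z > 0"
  shows "green W S r z = u r"
proof -
  have "(THE u. u \<in> l2 S \<and> (\<forall>p\<in>S. schr W S u p - z * u p = (if p = r then 1 else 0))) = u"
  proof (rule the_equality)
    show "u \<in> l2 S \<and> (\<forall>p\<in>S. schr W S u p - z * u p = (if p = r then 1 else 0))"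
      using u(1) fun_cong[OF u(2)] unfolding shifted_def delta_at_def by blast
    fix v assume v: "v \<in> l2 S \<and> (\<forall>p\<in>S. schr W S v p - z * v p = (if p = r then 1 else 0))"
    have "shifted W S z (\<lambda>p. v p - u p) p = 0" for p
    proof (cases "p \<in> S")
      case True
      then show ?thesis using v fun_cong[OF u(2), of p] unfolding shifted_diff
        by (simp add: shifted_def delta_at_def)
    next
      case False
      then show ?thesis using l2_outside[OF u(1)] l2_outside[of v S] v
        by (simp add: shifted_def schr_outside)
    qed
    then have "shifted W S z (\<lambda>p. v p - u p) = (\<lambda>p. 0)" by (rule ext)
    moreover have "(\<lambda>p. v p - u p) \<in> l2 S" using v u(1) by (intro l2_diff) simp_all
    ultimately have "(\<lambda>p. v p - u p) = (\<lambda>p. 0)"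
      using z by (intro shifted_injective[of "\<lambda>p. v p - u p" z]) simp_all
    then show "v = u" by (simp add: fun_eq_iff)
  qed
  then show ?thesis by (simp add: green_def)
qed

lemma green_exists:
  assumes "r \<in> S" "Im z > 0"
  obtains u where "u \<in> l2 S" "shifted W S z u = delta_at r" "green W S r z = u r"
  using shifted_surjective[OF l2_delta_at assms(2)] green_eqI assms by metis

text \<open>Pairing (H - z) u = delta with u gives Im (u r) = Im z * ||u||^2.\<close>

lemma Im_green:
  assumes "r \<in> S" "Im z > 0"
  shows "0 \<le> Im (green W S r z)"
proof -
  obtain u where u: "u \<in> l2 S" "shifted W S z u = delta_at r" "green W S r z = u r"
    using green_exists[OF assms] .
  have "- Im (u r) = - Im z * (l2norm S u)\<^sup>2"
    using Im_shifted_form[OF u(1), of z] u(2) assms(1) by (simp add: l2ip_delta_at_left)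
  then show ?thesis using u(3) assms(2) by simp
qed

end

section \<open>Non-backtracking walks in graphs with few cycles\<close>

text \<open>Recursive form of the non-backtracking condition in \<open>nb_walk\<close>, suited to
  induction; \<open>nonback_conv_nth\<close> connects the two.\<close>

fun nonback :: "'a list \<Rightarrow> bool" where
  "nonback (x # y # z # r) \<longleftrightarrow> x \<noteq> z \<and> nonback (y # z # r)"
| "nonback _ \<longleftrightarrow> True"

lemma nonback_Cons: "nonback (x # p) \<longleftrightarrow> nonback p \<and> (2 \<le> length p \<longrightarrow> x \<noteq> p ! 1)"
  by (cases "x # p" rule: nonback.cases) auto

lemma all_nat_split: "(\<forall>i. P i) \<longleftrightarrow> P 0 \<and> (\<forall>i. P (Suc i))"
  by (metis not0_implies_Suc)

lemma nonback_conv_nth: "nonback p \<longleftrightarrow> (\<forall>i. i + 2 < length p \<longrightarrow> p ! (i + 2) \<noteq> p ! i)"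
proof (induction p)
  case (Cons x p)
  have "(\<forall>i. i + 2 < length (x # p) \<longrightarrow> (x # p) ! (i + 2) \<noteq> (x # p) ! i) \<longleftrightarrow>
    (2 < length (x # p) \<longrightarrow> (x # p) ! 2 \<noteq> x) \<and> (\<forall>i. i + 2 < length p \<longrightarrow> p ! (i + 2) \<noteq> p ! i)"
    by (subst all_nat_split) (auto simp: numeral_2_eq_2)
  then show ?case using Cons by (auto simp: nonback_Cons numeral_2_eq_2)
qed simp

text \<open>Both pieces keep the cut vertex c, so the only triple seen by neither is the one centred
  at c.\<close>

lemma nonback_append:
  "nonback (s @ c # t) \<longleftrightarrow> nonback (s @ [c]) \<and> nonback (c # t) \<and> (s \<noteq> [] \<longrightarrow> t \<noteq> [] \<longrightarrow> last s \<noteq> hd t)"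
proof (induction s)
  case (Cons a s)
  show ?case
  proof (cases s)
    case Nil
    then show ?thesis by (cases t) auto
  next
    case (Cons b s')
    then show ?thesis using Cons.IH by (cases s') auto
  qed
qed simp

lemma nonback_rev [simp]: "nonback (rev p) \<longleftrightarrow> nonback p"
proof (induction p)
  case (Cons a p)
  show ?case
  proof (cases p)
    case p: (Cons b q)
    have "nonback (rev (a # p)) \<longleftrightarrow> nonback (rev p) \<and> (q \<noteq> [] \<longrightarrow> hd q \<noteq> a)"
      using p nonback_append[of "rev q" b "[a]"] by (auto simp: last_rev)
    then show ?thesis using Cons.IH p by (cases q) auto
  qed simp
qed simp

lemma nonback_distinct: "distinct p \<Longrightarrow> nonback p"
  by (induction p rule: nonback.induct) auto

text \<open>The adjacency is a parameter because the notion is applied to the graph itself and to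
  the graph with one edge deleted; vertex sets are handled separately.\<close>

definition nbl :: "('a \<Rightarrow> 'a \<Rightarrow> bool) \<Rightarrow> 'a list \<Rightarrow> bool" where
  "nbl E p \<longleftrightarrow> successively E p \<and> nonback p"

lemma nbl_append:
  "nbl E (s @ c # t) \<longleftrightarrow> nbl E (s @ [c]) \<and> nbl E (c # t) \<and> (s \<noteq> [] \<longrightarrow> t \<noteq> [] \<longrightarrow> last s \<noteq> hd t)"
  unfolding nbl_def by (subst nonback_append) (auto simp: successively_append_iff)

lemma nbl_appendD:
  assumes "nbl E (s @ c # t)"
  shows "nbl E (s @ [c])" "nbl E (c # t)"
  using iffD1[OF nbl_append assms] by simp_all

lemma nbl_Cons_Cons:
  "nbl E (x # y # p) \<longleftrightarrow> E x y \<and> nbl E (y # p) \<and> (p \<noteq> [] \<longrightarrow> hd p \<noteq> x)"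
  by (cases p) (auto simp: nbl_def)

lemma nbl_singleton [simp]: "nbl E [x]"
  by (simp add: nbl_def)

lemma nbl_rev: "symp E \<Longrightarrow> nbl E (rev p) \<longleftrightarrow> nbl E p"
proof -
  assume "symp E"
  then have "(\<lambda>x y. E y x) = E" by (auto simp: fun_eq_iff dest: sympD)
  then have "successively (\<lambda>x y. E y x) p = successively E p"
    by (rule arg_cong)
  then show ?thesis by (simp only: nbl_def successively_rev nonback_rev)
qed

lemma nbl_tl: "nbl E (x # p) \<Longrightarrow> nbl E p"
  by (cases p) (auto simp: nbl_def nonback_Cons)

lemma is_walk_iff: "is_walk V E p \<longleftrightarrow> p \<noteq> [] \<and> set p \<subseteq> V \<and> successively E p"
proof -
  have "successively E p \<longleftrightarrow> (\<forall>i. Suc i < length p \<longrightarrow> E (p ! i) (p ! Suc i))"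
  proof (induction p)
    case (Cons x p)
    have "(\<forall>i. Suc i < length (x # p) \<longrightarrow> E ((x # p) ! i) ((x # p) ! Suc i)) \<longleftrightarrow>
      (p \<noteq> [] \<longrightarrow> E x (p ! 0)) \<and> (\<forall>i. Suc i < length p \<longrightarrow> E (p ! i) (p ! Suc i))"
      by (subst all_nat_split) auto
    then show ?case using Cons by (auto simp: successively_Cons hd_conv_nth)
  qed simp
  then show ?thesis by (auto simp: is_walk_def)
qed

lemma nb_walk_iff: "nb_walk V E p \<longleftrightarrow> p \<noteq> [] \<and> set p \<subseteq> V \<and> nbl E p"
  by (auto simp: nb_walk_def is_walk_iff nbl_def nonback_conv_nth)

section \<open>Non-backtracking walks in forests\<close>

lemma is_cycle_list_iff:
  "is_cycle_list E B c \<longleftrightarrow> length c \<ge> 3 \<and> distinct c \<and> set c \<subseteq> B \<and> successively E c \<and> E (last c) (hd c)"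
  using is_walk_iff[of UNIV E c] by (cases "c = []") (auto simp: is_cycle_list_def is_walk_def)

text \<open>The piece up to the first return to the starting vertex would be a cycle: irreflexivity
  excludes length 1 and non-backtracking excludes length 2.\<close>

lemma acyclic_nbl_distinct:
  assumes acyclic: "\<And>c. \<not> is_cycle_list E B c" and irrefl: "\<And>x. \<not> E x x"
  shows "nbl E p \<Longrightarrow> set p \<subseteq> B \<Longrightarrow> distinct p"
proof (induction p)
  case (Cons a q)
  have q: "distinct q" using Cons nbl_tl[of E a q] by auto
  have False if "a \<in> set q"
  proof -
    obtain l1 l2 where q_eq: "q = l1 @ a # l2" "a \<notin> set l1"
      using split_list_first[OF \<open>a \<in> set q\<close>] by blast
    have "nbl E ((a # l1) @ a # l2)" using Cons.prems q_eq by simp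
    then have nb: "nbl E ((a # l1) @ [a])" by (rule nbl_appendD)
    then have succ: "successively E (a # l1)" "E (last (a # l1)) a"
      by (auto simp: nbl_def successively_append_iff simp del: append.simps)
    have "length (a # l1) \<ge> 3"
    proof (cases l1)
      case Nil
      then show ?thesis using succ irrefl by auto
    next
      case (Cons b l)
      then show ?thesis using nb by (cases l) (auto simp: nbl_def)
    qed
    moreover have "distinct (a # l1)" using q q_eq by auto
    ultimately have "is_cycle_list E B (a # l1)"
      unfolding is_cycle_list_iff using succ Cons.prems q_eq by auto
    then show False using acyclic by blast
  qed
  then show ?case using q by auto
qed simp

text \<open>Where two walks part, the reversal of one followed by the other does not backtrack, yet
  its two ends coincide, against \<open>acyclic_nbl_distinct\<close>.\<close>

lemma acyclic_nbl_unique: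
  assumes acyclic: "\<And>c. \<not> is_cycle_list E B c" and irrefl: "\<And>x. \<not> E x x" and sym: "symp E"
  shows "\<lbrakk>nbl E p; nbl E q; set p \<subseteq> B; set q \<subseteq> B; p \<noteq> []; q \<noteq> []; hd p = hd q; last p = last q\<rbrakk> \<Longrightarrow> p = q"
proof (induction p arbitrary: q)
  case (Cons x p)
  obtain q' where q: "q = x # q'" using Cons.prems by (cases q) auto
  have dist: "distinct (x # p)" "distinct (x # q')"
    using acyclic_nbl_distinct[OF acyclic irrefl Cons.prems(1,3)]
      acyclic_nbl_distinct[OF acyclic irrefl Cons.prems(2,4)] q by simp_all
  show ?case
  proof (cases p)
    case Nil
    have "q' = []"
    proof (rule ccontr)
      assume "q' \<noteq> []"
      then have "last q' = x" "last q' \<in> set q'" using Cons.prems(8) q Nil by simp_all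
      then show False using dist(2) by simp
    qed
    then show ?thesis using q Nil by simp
  next
    case p: (Cons y p')
    have "q' \<noteq> []"
    proof
      assume "q' = []"
      then have "last p = x" using Cons.prems q p by simp
      moreover have "last p \<in> set p" using p by (intro last_in_set) simp
      ultimately show False using dist(1) by simp
    qed
    then obtain y' q'' where q': "q' = y' # q''" by (cases q') auto
    show ?thesis
    proof (cases "y = y'")
      case True
      have "p = q'"
        using Cons.prems(3,4,8) p q q' True nbl_tl[OF Cons.prems(1)] nbl_tl[of E x q'] Cons.prems(2)
        by (intro Cons.IH) simp_all
      then show ?thesis using q by simp
    next
      case False
      let ?r = "rev p @ x # q'"
      have "nbl E (rev p @ [x])" using nbl_rev[OF sym, of "x # p"] Cons.prems by simp
      then have "nbl E ?r"
        
        using nbl_append[of E "rev p" x q'] Cons.prems(2) q p q' False by simp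
      then have "distinct ?r"
        using Cons.prems(3,4) q by (intro acyclic_nbl_distinct[OF acyclic irrefl]) auto
      moreover have "last p = last q'" using Cons.prems p q q' by simp
      moreover have "last p \<in> set p" "last q' \<in> set q'" using p q' by simp_all
      ultimately show ?thesis by auto
    qed
  qed
qed simp

section \<open>Walks in a graph that becomes a forest when one edge is deleted\<close>

abbreviation del_edge :: "('a \<Rightarrow> 'a \<Rightarrow> bool) \<Rightarrow> 'a \<Rightarrow> 'a \<Rightarrow> 'a \<Rightarrow> 'a \<Rightarrow> bool" where
  "del_edge E a b \<equiv> \<lambda>u v. E u v \<and> {u, v} \<noteq> {a, b}"

lemma first_crossing:
  assumes "successively E p" "\<not> successively (del_edge E a b) p"
  obtains s c d t where "p = s @ c # d # t" "successively (del_edge E a b) (s @ [c])" "{c, d} = {a, b}"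
  using assms
proof (induction p arbitrary: thesis rule: induct_list012)
  case (3 x y p)
  show ?case
  proof (cases "{x, y} = {a, b}")
    case True
    then show ?thesis using "3.prems"(1)[of "[]" x y p] by simp
  next
    case False
    then obtain s c d t where *: "y # p = s @ c # d # t" "successively (del_edge E a b) (s @ [c])" "{c, d} = {a, b}"
      using "3.prems"(2,3) by (auto intro: "3.IH"(2))
    have "hd (s @ [c]) = y" using * by (cases s) auto
    moreover have "E x y" using "3.prems"(2) by simp
    ultimately have "successively (del_edge E a b) ((x # s) @ [c])"
      unfolding append_Cons successively_Cons using *(2) False by simp
    then show ?thesis using "3.prems"(1)[of "x # s" c d t] * by simp
  qed
qed auto

text \<open>The choice a = b is allowed: in a loopless graph it deletes nothing, which covers sets B
  that contain no cycle.\<close>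

locale almost_acyclic =
  fixes E :: "'a \<Rightarrow> 'a \<Rightarrow> bool" and B :: "'a set" and a b :: 'a
  assumes sym: "E x y \<Longrightarrow> E y x" and irrefl: "\<not> E x x"
    and acyclic: "\<not> is_cycle_list (del_edge E a b) B c"
begin

lemma swap: "almost_acyclic E B b a"
  using sym irrefl acyclic by unfold_locales (auto simp: insert_commute)

lemma del_distinct: "nbl (del_edge E a b) p \<Longrightarrow> set p \<subseteq> B \<Longrightarrow> distinct p"
  by (rule acyclic_nbl_distinct[OF acyclic]) (auto simp: irrefl)

lemma del_unique:
  "\<lbrakk>nbl (del_edge E a b) p; nbl (del_edge E a b) q; set p \<subseteq> B; set q \<subseteq> B; p \<noteq> []; q \<noteq> [];
    hd p = hd q; last p = last q\<rbrakk> \<Longrightarrow> p = q"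
  by (rule acyclic_nbl_unique[OF acyclic]) (auto simp: irrefl insert_commute intro!: sympI sym)

lemma nbl_crossing:
  assumes "nbl E p" "\<not> nbl (del_edge E a b) p"
  obtains s c d t where "p = s @ c # d # t" "nbl (del_edge E a b) (s @ [c])" "{c, d} = {a, b}" "c \<noteq> d"
proof -
  obtain s c d t where *: "p = s @ c # d # t" "successively (del_edge E a b) (s @ [c])" "{c, d} = {a, b}"
    using first_crossing[of E p a b] assms unfolding nbl_def by blast
  have "nbl E (s @ [c])" "nbl E (c # d # t)"
    using nbl_appendD[of E s c "d # t"] assms(1) *(1) by simp_all
  then have "nbl (del_edge E a b) (s @ [c])" "c \<noteq> d"
    using * irrefl by (auto simp: nbl_def)
  then show thesis using that * by blast
qed

text \<open>A walk that has just traversed \<open>a \<rightarrow> b\<close> can only traverse the deleted edge in the same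
direction again, because the piece in between would otherwise be a closed walk in a forest.\<close>

lemma crossing_again:
  assumes p: "nbl E (b # p)" "set (b # p) \<subseteq> B" "p \<noteq> [] \<longrightarrow> hd p \<noteq> a"
    and cross: "\<not> nbl (del_edge E a b) (b # p)"
  obtains s t where "b # p = s @ a # b # t" "nbl (del_edge E a b) (s @ [a])" "s \<noteq> []" "hd (s @ [a]) = b"
    "nbl E (b # t)" "t \<noteq> [] \<longrightarrow> hd t \<noteq> a"
proof -
  obtain s c d t where *: "b # p = s @ c # d # t" "nbl (del_edge E a b) (s @ [c])" "{c, d} = {a, b}" "c \<noteq> d"
    by (rule nbl_crossing[OF p(1) cross])
  have hd: "hd (s @ [c]) = b" using *(1) by (cases s) auto
  have sub: "set (s @ [c]) \<subseteq> B" using p(2) unfolding *(1) by auto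
  have "c \<noteq> b"
  proof
    assume "c = b"
    then have "s @ [c] = [b]"
      using * sub hd by (intro del_unique) auto
    then have "p = d # t" "d = a" using * by auto
    then show False using p by simp
  qed
  then have cd: "c = a" "d = b" using *(3) by (auto simp: doubleton_eq_iff)
  then have "s \<noteq> []" using hd \<open>c \<noteq> b\<close> by auto
  have "nbl E (c # d # t)" using nbl_appendD(2)[of E s c "d # t"] p(1) *(1) by simp
  then have "nbl E (b # t)" "t \<noteq> [] \<longrightarrow> hd t \<noteq> a" by (auto simp: nbl_Cons_Cons cd)
  then show thesis using that *(1,2) hd cd \<open>s \<noteq> []\<close> by blast
qed

text \<open>Cutting out the piece from b to the next crossing a -> b keeps both ends and shortens
  the walk; repeated, this ends at the forest walk r.\<close>

lemma del_shortest:
  assumes "nbl (del_edge E a b) r" "set r \<subseteq> B" "r \<noteq> []" "hd r = b"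
  shows "\<lbrakk>nbl E (b # p); set (b # p) \<subseteq> B; p \<noteq> [] \<longrightarrow> hd p \<noteq> a; last (b # p) = last r\<rbrakk>
    \<Longrightarrow> length r \<le> length (b # p)"
proof (induction "length p" arbitrary: p rule: less_induct)
  case less
  show ?case
  proof (cases "nbl (del_edge E a b) (b # p)")
    case True
    then have "b # p = r" using assms less.prems by (intro del_unique) auto
    then show ?thesis by simp
  next
    case False
    then obtain s t where *: "b # p = s @ a # b # t" "nbl E (b # t)" "t \<noteq> [] \<longrightarrow> hd t \<noteq> a"
      using crossing_again[OF less.prems(1-3) False] by blast
    have "set (b # t) \<subseteq> B" "last (b # t) = last r" using less.prems unfolding *(1) by auto
    moreover have len: "length p = length s + 1 + length t" using arg_cong[OF *(1), of length] by simp
    ultimately have "length r \<le> length (b # t)" using *(2,3) by (intro less.hyps) simp_all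
    then show ?thesis using len by simp
  qed
qed

text \<open>Such walks can differ only in the number of laps around the cycle, and the common length
  fixes that number.\<close>

lemma unique_after_crossing:
  "\<lbrakk>nbl E (b # p); nbl E (b # q); set (b # p) \<subseteq> B; set (b # q) \<subseteq> B; p \<noteq> [] \<longrightarrow> hd p \<noteq> a;
    q \<noteq> [] \<longrightarrow> hd q \<noteq> a; last (b # p) = last (b # q); length p = length q\<rbrakk> \<Longrightarrow> p = q"
proof (induction "length p" arbitrary: p q rule: less_induct)
  case less
  \<comment> \<open>The forest walk is still no longer than the crossing walk with one lap removed,
    so the two lengths cannot agree.\<close>
  have no_mix: False
    if pq: "nbl E (b # p)" "set (b # p) \<subseteq> B" "p \<noteq> [] \<longrightarrow> hd p \<noteq> a" "set (b # q) \<subseteq> B"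
      "last (b # p) = last (b # q)" "length p = length q"
      "\<not> nbl (del_edge E a b) (b # p)" "nbl (del_edge E a b) (b # q)" for p q
  proof -
    obtain s t where *: "b # p = s @ a # b # t" "nbl E (b # t)" "t \<noteq> [] \<longrightarrow> hd t \<noteq> a"
      using crossing_again[OF pq(1,2,3,7)] by blast
    have "set (b # t) \<subseteq> B" "last (b # t) = last (b # q)" using pq unfolding *(1) by auto
    then have "length (b # q) \<le> length (b # t)" using pq * by (intro del_shortest) auto
    moreover have "length p = length s + 1 + length t" using arg_cong[OF *(1), of length] by simp
    ultimately show False using pq(6) by simp
  qed
  show ?case
  proof (cases "nbl (del_edge E a b) (b # p)")
    case True
    then have "nbl (del_edge E a b) (b # q)" 
      using no_mix[OF less.prems(2,4,6,3) less.prems(7)[symmetric] less.prems(8)[symmetric]] by blast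
    then have "b # p = b # q" using True less.prems by (intro del_unique) auto
    then show ?thesis by simp
  next
    case False
    obtain s t where p: "b # p = s @ a # b # t" "nbl (del_edge E a b) (s @ [a])" "hd (s @ [a]) = b"
        "nbl E (b # t)" "t \<noteq> [] \<longrightarrow> hd t \<noteq> a"
      using crossing_again[OF less.prems(1,3,5) False] by blast
    have nq: "\<not> nbl (del_edge E a b) (b # q)"
      using no_mix[OF less.prems(1,3,5,4,7,8) False] by blast
    obtain s' t' where q: "b # q = s' @ a # b # t'" "nbl (del_edge E a b) (s' @ [a])" "hd (s' @ [a]) = b"
        "nbl E (b # t')" "t' \<noteq> [] \<longrightarrow> hd t' \<noteq> a"
      using crossing_again[OF less.prems(2,4,6) nq] by blast
    have sub: "set (s @ [a]) \<subseteq> B" "set (b # t) \<subseteq> B" "set (s' @ [a]) \<subseteq> B" "set (b # t') \<subseteq> B"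
      using less.prems unfolding p(1) q(1) by auto
    have "s @ [a] = s' @ [a]" using p q sub by (intro del_unique) auto
    then have s: "s = s'" by simp
    have len: "length p = length s + 1 + length t" "length q = length s' + 1 + length t'"
      using arg_cong[OF p(1), of length] arg_cong[OF q(1), of length] by simp_all
    have "last (b # t) = last (b # t')" using less.prems unfolding p(1) q(1) by simp
    moreover have "length t < length p" "length t = length t'"
      using len less.prems(8) s by simp_all
    ultimately have "t = t'"
      using less.hyps p(4,5) q(4,5) sub(2,4) by blast
    then have "b # p = b # q" unfolding p(1) q(1) s by simp
    then show ?thesis by simp
  qed
qed

lemma unique_first_crossing:
  assumes p: "nbl E p" "set p \<subseteq> B" "p = s @ a # b # t" "nbl (del_edge E a b) (s @ [a])"
    and q: "nbl E q" "set q \<subseteq> B" "q = s' @ a # b # t'" "nbl (del_edge E a b) (s' @ [a])"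
    and eq: "hd p = hd q" "last p = last q" "length p = length q"
  shows "p = q"
proof -
  have "s @ [a] = s' @ [a]"
  proof (rule del_unique)
    show "hd (s @ [a]) = hd (s' @ [a])" using eq(1) p(3) q(3) by (cases s; cases s') auto
  qed (use p q in auto)
  then have s: "s = s'" by simp
  have nb: "nbl E (a # b # t)" "nbl E (a # b # t')" 
    using nbl_appendD(2)[of E s a "b # t"] nbl_appendD(2)[of E s' a "b # t'"] p(1,3) q(1,3) by simp_all
  have "t = t'"
    using p q eq s nb by (intro unique_after_crossing) (auto simp: nbl_Cons_Cons)
  then show ?thesis using p q s by simp
qed

text \<open>The three classes are: no crossing of the deleted edge, first crossing a -> b, first
  crossing b -> a. Each contains at most one walk with given ends and length.\<close>

lemma card_nbl_le_3:
  assumes fin: "finite B"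
  shows "card {p. nbl E p \<and> set p \<subseteq> B \<and> p \<noteq> [] \<and> hd p = x \<and> last p = y \<and> length p = n} \<le> 3"
    (is "card ?P \<le> 3")
proof -
  have "?P \<subseteq> {p. set p \<subseteq> B \<and> length p = n}" by auto
  then have finP: "finite ?P" using finite_lists_length_eq[OF fin] by (rule finite_subset)
  define P0 where "P0 = {p \<in> ?P. nbl (del_edge E a b) p}"
  define P1 where "P1 = {p \<in> ?P. \<exists>s t. p = s @ a # b # t \<and> nbl (del_edge E a b) (s @ [a])}"
  define P2 where "P2 = {p \<in> ?P. \<exists>s t. p = s @ b # a # t \<and> nbl (del_edge E a b) (s @ [b])}"
  have cover: "?P \<subseteq> P0 \<union> P1 \<union> P2"
  proof
    fix p assume p: "p \<in> ?P"
    show "p \<in> P0 \<union> P1 \<union> P2"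
    proof (cases "nbl (del_edge E a b) p")
      case True
      then show ?thesis using p by (simp add: P0_def)
    next
      case False
      moreover have "nbl E p" using p by simp
      ultimately obtain s c d t where "p = s @ c # d # t" "nbl (del_edge E a b) (s @ [c])" "{c, d} = {a, b}"
        by (blast elim: nbl_crossing)
      then show ?thesis using p by (auto simp: P1_def P2_def doubleton_eq_iff)
    qed
  qed
  have eq: "del_edge E b a = del_edge E a b" by (simp add: insert_commute)
  have fin012: "finite P0" "finite P1" "finite P2"
    unfolding P0_def P1_def P2_def by (rule finite_subset[OF _ finP]; blast)+
  have "card P0 \<le> Suc 0"
    unfolding card_le_Suc0_iff_eq[OF fin012(1)] using del_unique by (simp add: P0_def)
  moreover have "card P1 \<le> Suc 0"
    unfolding card_le_Suc0_iff_eq[OF fin012(2)]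
  proof (intro ballI)
    fix p q assume "p \<in> P1" "q \<in> P1"
    then obtain s t s' t' where "p = s @ a # b # t" "nbl (del_edge E a b) (s @ [a])"
      "q = s' @ a # b # t'" "nbl (del_edge E a b) (s' @ [a])" "p \<in> ?P" "q \<in> ?P"
      unfolding P1_def by blast
    then show "p = q" by (intro unique_first_crossing[of p s t q s' t']) simp_all
  qed
  moreover have "card P2 \<le> Suc 0"
    unfolding card_le_Suc0_iff_eq[OF fin012(3)]
  proof (intro ballI)
    fix p q assume "p \<in> P2" "q \<in> P2"
    then obtain s t s' t' where "p = s @ b # a # t" "nbl (del_edge E b a) (s @ [b])"
      "q = s' @ b # a # t'" "nbl (del_edge E b a) (s' @ [b])" "p \<in> ?P" "q \<in> ?P"
      unfolding P2_def eq by blast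
    then show "p = q"
      by (intro almost_acyclic.unique_first_crossing[OF swap, of p s t q s' t']) simp_all
  qed
  moreover have "card ?P \<le> card (P0 \<union> P1 \<union> P2)"
    using cover fin012 by (intro card_mono) simp_all
  ultimately show ?thesis
    using card_Un_le[of "P0 \<union> P1" P2] card_Un_le[of P0 P1] by linarith
qed

end

section \<open>What first crossings say about the first step and about cycles through the
  start\<close>

context almost_acyclic
begin

text \<open>The forest walk from x to c is unique, so both walks begin alike. If x = c, the first
  step is the crossing itself, and c determines its other end.\<close>

lemma same_crossing_same_start:
  assumes p: "nbl E (x # y1 # p)" "set (x # y1 # p) \<subseteq> B" "x # y1 # p = s @ c # d # t"
      "nbl (del_edge E a b) (s @ [c])" "{c, d} = {a, b}"
    and q: "nbl E (x # y2 # q)" "set (x # y2 # q) \<subseteq> B" "x # y2 # q = s' @ c # d' # t'"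
      "nbl (del_edge E a b) (s' @ [c])" "{c, d'} = {a, b}"
  shows "y1 = y2"
proof -
  have "s @ [c] = s' @ [c]"
  proof (rule del_unique)
    show "hd (s @ [c]) = hd (s' @ [c])" using p(3) q(3) by (cases s; cases s') auto
    show "set (s @ [c]) \<subseteq> B" "set (s' @ [c]) \<subseteq> B"
      using p(2) q(2) unfolding p(3) q(3) by auto
  qed (use p q in auto)
  then have s: "s = s'" by simp
  have d: "d = d'" using p(5) q(5) by (metis doubleton_eq_iff)
  have "y1 = (s @ c # d # t) ! 1" "y2 = (s @ c # d # t') ! 1"
    using arg_cong[OF p(3), of "\<lambda>l. l ! 1"] arg_cong[OF q(3), of "\<lambda>l. l ! 1"] s d by simp_all
  then show ?thesis by (cases s) (auto simp: nth_append nth_Cons' split: if_splits)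
qed

text \<open>The forest walks from x to a and from x to b leave x in different directions. Joined at
  x they form a forest path from a to b, which the edge between a and b closes.\<close>

lemma cycle_through_start:
  assumes p: "set (x # y1 # p) \<subseteq> B" "x # y1 # p = s @ a # d # t" "nbl (del_edge E a b) (s @ [a])"
    and q: "set (x # y2 # q) \<subseteq> B" "x # y2 # q = s' @ b # d' # t'" "nbl (del_edge E a b) (s' @ [b])"
    and y: "y1 \<noteq> y2" and ab: "E a b"
  obtains c where "is_cycle_list E B c" "x \<in> set c" "length c + 1 \<le> length (y1 # p) + length (y2 # q)"
proof -
  obtain u where u: "s @ [a] = x # u" "u \<noteq> [] \<longrightarrow> hd u = y1"
    using p(2) by (cases s) (auto simp: Cons_eq_append_conv hd_append)
  obtain u' where u': "s' @ [b] = x # u'" "u' \<noteq> [] \<longrightarrow> hd u' = y2"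
    using q(2) by (cases s') (auto simp: Cons_eq_append_conv hd_append)
  let ?r = "rev u @ x # u'"
  have symp: "symp (del_edge E a b)" by (auto intro!: sympI sym simp: insert_commute)
  have "nbl (del_edge E a b) (rev u @ [x])"
    using nbl_rev[OF symp, of "x # u"] p(3) u(1) by simp
  then have nb: "nbl (del_edge E a b) ?r"
    using q(3) u u' y nbl_append[of "del_edge E a b" "rev u" x u'] by (auto simp: last_rev)
  have "set (s @ [a]) \<subseteq> B" "set (s' @ [b]) \<subseteq> B"
    using p(1) q(1) unfolding p(2) q(2) by auto
  then have sub: "set ?r \<subseteq> B" unfolding u(1) u'(1) by auto
  have dist: "distinct ?r" using del_distinct nb sub by blast
  have hd: "hd ?r = a"
  proof -
    have "hd ?r = last (x # u)" by (cases u rule: rev_cases) auto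
    also have "\<dots> = a" by (metis u(1) last_snoc)
    finally show ?thesis .
  qed
  have last: "last ?r = b"
    using u'(1) by (metis last_appendR last_snoc list.distinct(1))
  have ne: "a \<noteq> b" using ab irrefl by auto
  have succ: "successively (del_edge E a b) ?r" using nb by (simp add: nbl_def)
  \<comment> \<open>A shorter path would be a single vertex or the deleted edge itself.\<close>
  have len3: "length ?r \<ge> 3"
  proof (rule ccontr)
    assume "\<not> length ?r \<ge> 3"
    moreover obtain r1 r2 where r: "?r = r1 # r2" by (cases ?r) auto
    ultimately have "r2 = [] \<or> (\<exists>z. r2 = [z])" by (cases r2; cases "tl r2") auto
    then show False
      using hd last succ ne unfolding r by auto
  qed
  have "successively E ?r" using succ by (rule successively_mono) auto
  then have cyc: "is_cycle_list E B ?r"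
    unfolding is_cycle_list_iff using len3 dist sub hd last sym[OF ab] by simp
  have "length s + 2 \<le> length (x # y1 # p)" "length s' + 2 \<le> length (x # y2 # q)"
    using arg_cong[OF p(2), of length] arg_cong[OF q(2), of length] by simp_all
  moreover have "length s = length u" "length s' = length u'"
    using arg_cong[OF u(1), of length] arg_cong[OF u'(1), of length] by simp_all
  ultimately have "length ?r + 1 \<le> length (y1 # p) + length (y2 # q)" by simp
  then show thesis using that[OF cyc] by simp
qed

end

section \<open>From at most one cycle to a deleted edge\<close>

lemma cycle_edges_subset:
  assumes "is_cycle_list E B c" "e \<in> cycle_edges c"
  obtains u v where "e = {u, v}" "E u v"
proof -
  obtain i where i: "i < length c" "e = {c ! i, c ! (Suc i mod length c)}"
    using assms(2) by (auto simp: cycle_edges_def)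
  show thesis
  proof (cases "Suc i < length c")
    case True
    then show ?thesis using that i assms(1) by (auto simp: is_cycle_list_def)
  next
    case False
    then have "Suc i = length c" using i by simp
    then have "e = {last c, hd c}"
      using i by (metis diff_Suc_1 hd_conv_nth last_conv_nth length_0_conv mod_self not_less_zero)
    then show ?thesis using that assms(1) by (auto simp: is_cycle_list_def)
  qed
qed

text \<open>A cycle surviving the deletion would be a second one, because its edge set misses {v,
  w}.\<close>

lemma almost_acyclicI_cycle:
  assumes sym: "\<And>x y. E x y \<Longrightarrow> E y x" and irrefl: "\<And>x. \<not> E x x"
    and one: "at_most_one_cycle E B" and cyc: "is_cycle_list E B (v # w # c)"
  shows "almost_acyclic E B v w"
proof
  fix c' show "\<not> is_cycle_list (del_edge E v w) B c'"
  proof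
    assume c': "is_cycle_list (del_edge E v w) B c'"
    then have "is_cycle_list E B c'" by (auto simp: is_cycle_list_def)
    then have "cycle_edges c' = cycle_edges (v # w # c)"
      using one cyc by (auto simp: at_most_one_cycle_def cycles_in_def)
    moreover have "{v, w} \<in> cycle_edges (v # w # c)"
      unfolding cycle_edges_def by (auto intro!: exI[of _ 0])
    ultimately show False using cycle_edges_subset[OF c'] by (metis (no_types, lifting))
  qed
qed (use sym irrefl in auto)

lemma almost_acyclicI:
  assumes sym: "\<And>x y. E x y \<Longrightarrow> E y x" and irrefl: "\<And>x. \<not> E x x"
    and one: "at_most_one_cycle E B"
  obtains a b where "almost_acyclic E B a b"
proof (cases "\<exists>c. is_cycle_list E B c")
  case True
  then obtain c where c: "is_cycle_list E B c" by blast
  then obtain v w c' where "c = v # w # c'"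
    by (cases c; cases "tl c") (auto simp: is_cycle_list_def)
  then show ?thesis using that almost_acyclicI_cycle[OF sym irrefl one] c by blast
next
  case False
  \<comment> \<open>Without a cycle there is nothing to break, so the degenerate pair a, a
    serves.\<close>
  have "almost_acyclic E B a a" for a
  proof
    fix c show "\<not> is_cycle_list (del_edge E a a) B c"
      using False by (auto simp: is_cycle_list_def)
  qed (use sym irrefl in auto)
  then show ?thesis using that by blast
qed

lemma is_cycle_list_rotate1:
  assumes "is_cycle_list E B c" shows "is_cycle_list E B (rotate1 c)"
proof (cases c)
  case (Cons x l)
  then show ?thesis using assms
    by (cases l) (auto simp: is_cycle_list_iff successively_append_iff successively_Cons hd_append)
qed (use assms in simp)

lemma is_cycle_list_rotate: "is_cycle_list E B c \<Longrightarrow> is_cycle_list E B (rotate n c)"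
  by (induction n) (auto intro: is_cycle_list_rotate1)

lemma is_cycle_list_start_at:
  assumes "is_cycle_list E B c" "x \<in> set c"
  obtains y l where "is_cycle_list E B (x # y # l)" "length (x # y # l) = length c"
proof -
  obtain l1 l2 where c: "c = l1 @ x # l2" using split_list[OF assms(2)] by blast
  have "is_cycle_list E B (rotate (length l1) c)" using is_cycle_list_rotate[OF assms(1)] .
  moreover have rot: "rotate (length l1) c = x # l2 @ l1" by (simp add: c rotate_append)
  ultimately have cyc: "is_cycle_list E B (x # l2 @ l1)" by simp
  then obtain y l where yl: "l2 @ l1 = y # l" by (cases "l2 @ l1") (auto simp: is_cycle_list_def)
  have "length (x # l2 @ l1) = length c" by (simp add: c)
  then show thesis using that cyc unfolding yl by blast
qed

section \<open>Balls of radius \<open>ell_G\<close>, tree-like edges and edges on short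
  cycles\<close>

locale graph =
  fixes V :: "'a set" and E :: "'a \<Rightarrow> 'a \<Rightarrow> bool"
  assumes fin_graph: "fin_graph V E" and connected: "g_connected V E"
    and deg_ge_2: "v \<in> V \<Longrightarrow> deg V E v \<ge> 2" and not_cycle: "\<not> is_cycle_graph V E"
begin

lemma finite_V: "finite V" and edge_V: "E x y \<Longrightarrow> x \<in> V" "E x y \<Longrightarrow> y \<in> V"
  and sym: "E x y \<Longrightarrow> E y x" and irrefl: "\<not> E x x"
  using fin_graph by (auto simp: fin_graph_def)

lemma finite_nbrs: "finite {w \<in> V. E v w}"
  using finite_V by simp

lemma walk_subset_ball:
  assumes "is_walk V E p" "length p \<le> Suc l"
  shows "set p \<subseteq> ball_G V E (hd p) l"
proof
  fix y assume "y \<in> set p"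
  then obtain p1 p2 where p: "p = p1 @ y # p2" using split_list by metis
  have "is_walk V E (p1 @ [y])" "hd (p1 @ [y]) = hd p"
    using assms(1) unfolding p is_walk_iff by (auto simp: successively_append_iff hd_append)
  moreover have "length (p1 @ [y]) \<le> Suc l" using assms(2) unfolding p by simp
  ultimately show "y \<in> ball_G V E (hd p) l" unfolding ball_G_def by force
qed

lemma nb_walk_subset_ball:
  "nb_walk V E (x # p) \<Longrightarrow> length p \<le> l \<Longrightarrow> set (x # p) \<subseteq> ball_G V E x l"
  using walk_subset_ball[of "x # p" l] by (simp add: nb_walk_def)

lemma ball_subset: "ball_G V E x l \<subseteq> V"
  using last_in_set by (fastforce simp: ball_G_def is_walk_iff)

text \<open>Minimal degree 2 always leaves a continuation other than the vertex just left.\<close>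

lemma nb_walk_exists:
  assumes "E x y" obtains p where "nb_walk V E (x # y # p)" "length p = n"
proof -
  have "\<exists>p. nb_walk V E (x # y # p) \<and> length p = n"
  proof (induction n)
    case 0
    then show ?case using assms edge_V by (auto simp: nb_walk_iff nbl_Cons_Cons)
  next
    case (Suc n)
    then obtain p where p: "nb_walk V E (x # y # p)" "length p = n" by blast
    let ?q = "x # y # p"
    define v where "v = last ?q"
    define w where "w = last (butlast ?q)"
    have v: "v \<in> V" using p(1) last_in_set[of ?q] by (auto simp: v_def nb_walk_iff)
    have q: "?q = butlast ?q @ [v]" unfolding v_def by (rule append_butlast_last_id[symmetric]) simp
    have "\<exists>u. u \<in> {u \<in> V. E v u} \<and> u \<noteq> w"
    proof (rule ccontr)
      assume "\<not> ?thesis"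
      then have "{u \<in> V. E v u} \<subseteq> {w}" by auto
      then have "deg V E v \<le> 1" unfolding deg_def using card_mono[of "{w}"] by fastforce
      then show False using deg_ge_2[OF v] by simp
    qed
    then obtain u where u: "u \<in> V" "E v u" "u \<noteq> w" by blast
    have nb: "nbl E (butlast ?q @ [v])" using p(1) q by (simp add: nb_walk_iff)
    moreover have "nbl E [v, u]" using u by (simp add: nbl_Cons_Cons)
    ultimately have "nbl E (butlast ?q @ v # [u])"
      using u(3) nbl_append[of E "butlast ?q" v "[u]"] by (simp add: w_def)
    then have "nbl E (?q @ [u])" using q by (metis append.assoc append_Cons append_Nil)
    then have "nb_walk V E (x # y # (p @ [u]))" using p(1) u by (simp add: nb_walk_iff)
    then show ?case using p(2) by (intro exI[of _ "p @ [u]"]) simp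
  qed
  then show thesis using that by blast
qed

lemma branch_vertex: obtains v where "v \<in> V" "deg V E v \<ge> 3"
proof -
  have "\<exists>v\<in>V. deg V E v \<noteq> 2" using not_cycle connected by (auto simp: is_cycle_graph_def)
  then obtain v where "v \<in> V" "deg V E v \<noteq> 2" by blast
  then show thesis using that[of v] deg_ge_2[of v] by simp
qed

text \<open>\<open>GREATEST\<close> is meaningful once the admissible radii are bounded. Take a
  vertex of degree at least 3 and a radius above card V + 1. Walks with more than card V vertices
  repeat a vertex, so in each of three directions there is a walk crossing the deleted edge. Two of
  these first crossings begin at the same end, and then the two directions agree.\<close>

lemma ell_G_spec:
  assumes "x \<in> V" shows "at_most_one_cycle E (ball_G V E x (ell_G V E))"
proof -
  define P where "P l \<longleftrightarrow> (\<forall>x\<in>V. at_most_one_cycle E (ball_G V E x l))" for l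
  have "P 0"
    unfolding P_def
  proof
    fix x
    have "ball_G V E x 0 \<subseteq> {x}"
    proof
      fix y assume "y \<in> ball_G V E x 0"
      then obtain p where "p \<noteq> []" "hd p = x" "last p = y" "length p \<le> Suc 0"
        by (auto simp: ball_G_def is_walk_iff)
      then show "y \<in> {x}" by (cases p) auto
    qed
    then have "card (set c) \<le> 1" if "set c \<subseteq> ball_G V E x 0" for c
      using card_mono[OF _ subset_trans[OF that], of "{x}"] by simp
    then have "\<not> is_cycle_list E (ball_G V E x 0) c" for c
      using distinct_card[of c] by (fastforce simp: is_cycle_list_def)
    then show "at_most_one_cycle E (ball_G V E x 0)"
      by (simp add: at_most_one_cycle_def cycles_in_def)
  qed
  moreover have "\<forall>l. P l \<longrightarrow> l \<le> Suc (card V)"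
  proof (intro allI impI, rule ccontr)
    fix l assume l: "P l" "\<not> l \<le> Suc (card V)"
    obtain x where x: "x \<in> V" "deg V E x \<ge> 3" by (rule branch_vertex)
    let ?B = "ball_G V E x l"
    have "at_most_one_cycle E ?B" using l x by (simp add: P_def)
    then obtain a b where "almost_acyclic E ?B a b"
      using almost_acyclicI[of E ?B] sym irrefl by blast
    then interpret A: almost_acyclic E ?B a b .
    have cross: "\<exists>p s c d t. nbl E (x # y # p) \<and> set (x # y # p) \<subseteq> ?B \<and> x # y # p = s @ c # d # t \<and>
        nbl (del_edge E a b) (s @ [c]) \<and> {c, d} = {a, b}" if xy: "E x y" for y
    proof -
      obtain p where p: "nb_walk V E (x # y # p)" "length p = card V"
        using nb_walk_exists[OF xy] by blast
      have sub: "set (x # y # p) \<subseteq> ?B" using nb_walk_subset_ball[OF p(1)] p(2) l(2) by simp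
      have "\<not> distinct (x # y # p)"
      proof
        assume "distinct (x # y # p)"
        then have "length (x # y # p) \<le> card V"
          using p(1) card_mono[OF finite_V, of "set (x # y # p)"] distinct_card[of "x # y # p"]
          by (simp add: nb_walk_iff)
        then show False using p by simp
      qed
      then have n: "\<not> nbl (del_edge E a b) (x # y # p)" using A.del_distinct sub by blast
      have nb: "nbl E (x # y # p)" using p by (simp add: nb_walk_iff)
      show ?thesis using A.nbl_crossing[OF nb n] nb sub by (metis (no_types, lifting))
    qed
    obtain N where "N \<subseteq> {w \<in> V. E x w}" "card N = 3"
      using obtain_subset_with_card_n[of 3 "{w \<in> V. E x w}"] x by (auto simp: deg_def)
    then obtain y1 y2 y3 where y: "E x y1" "E x y2" "E x y3" "y1 \<noteq> y2" "y2 \<noteq> y3" "y1 \<noteq> y3"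
      by (auto simp: card_3_iff)
    obtain p1 s1 c1 d1 t1 where 1: "nbl E (x # y1 # p1)" "set (x # y1 # p1) \<subseteq> ?B" "x # y1 # p1 = s1 @ c1 # d1 # t1"
        "nbl (del_edge E a b) (s1 @ [c1])" "{c1, d1} = {a, b}" using cross[OF y(1)] by blast
    obtain p2 s2 c2 d2 t2 where 2: "nbl E (x # y2 # p2)" "set (x # y2 # p2) \<subseteq> ?B" "x # y2 # p2 = s2 @ c2 # d2 # t2"
        "nbl (del_edge E a b) (s2 @ [c2])" "{c2, d2} = {a, b}" using cross[OF y(2)] by blast
    obtain p3 s3 c3 d3 t3 where 3: "nbl E (x # y3 # p3)" "set (x # y3 # p3) \<subseteq> ?B" "x # y3 # p3 = s3 @ c3 # d3 # t3"
        "nbl (del_edge E a b) (s3 @ [c3])" "{c3, d3} = {a, b}" using cross[OF y(3)] by blast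
    have "c1 \<in> {a, b}" "c2 \<in> {a, b}" "c3 \<in> {a, b}" using 1(5) 2(5) 3(5) by blast+
    then consider "c1 = c2" | "c2 = c3" | "c1 = c3" by auto
    then show False
    proof cases
      case 1
      then show ?thesis using A.same_crossing_same_start[OF \<open>nbl E (x # y1 # p1)\<close> \<open>set (x # y1 # p1) \<subseteq> ?B\<close> \<open>x # y1 # p1 = _\<close> \<open>nbl _ (s1 @ [c1])\<close> \<open>{c1, d1} = _\<close>] 2 y by blast
    next
      case 2
      then show ?thesis using A.same_crossing_same_start[OF \<open>nbl E (x # y2 # p2)\<close> \<open>set (x # y2 # p2) \<subseteq> ?B\<close> \<open>x # y2 # p2 = _\<close> \<open>nbl _ (s2 @ [c2])\<close> \<open>{c2, d2} = _\<close>] 3 y by blast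
    next
      case 3
      then show ?thesis using A.same_crossing_same_start[OF 1] \<open>nbl E (x # y3 # p3)\<close> \<open>set (x # y3 # p3) \<subseteq> ?B\<close> \<open>x # y3 # p3 = _\<close> \<open>nbl _ (s3 @ [c3])\<close> \<open>{c3, d3} = _\<close> y by blast
    qed
  qed
  ultimately have "P (GREATEST l. P l)" using GreatestI_nat[of P 0 "Suc (card V)"] by blast
  then show ?thesis using assms by (simp add: P_def ell_G_def)
qed

text \<open>Injectivity ranges over all lengths below K at once, so the last edges of these walks
  are distinct across generations too.\<close>

definition tree_like :: "nat \<Rightarrow> 'a \<Rightarrow> 'a \<Rightarrow> bool" where
  "tree_like K x y \<longleftrightarrow> inj_on (\<lambda>p. last (x # y # p)) {p. nb_walk V E (x # y # p) \<and> length p < K}"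

text \<open>The length bound keeps the whole cycle inside the ball of radius \<open>ell_G\<close>
  around each of its vertices.\<close>

definition cyclic :: "'a \<Rightarrow> 'a \<Rightarrow> bool" where
  "cyclic x y \<longleftrightarrow> (\<exists>c. is_cycle_list E V (x # y # c) \<and> length (x # y # c) \<le> ell_G V E)"

text \<open>Walks avoiding the deleted edge are determined by their ends, so a collision of end
  points forces a crossing.\<close>

lemma not_tree_like_crossing:
  assumes "almost_acyclic E (ball_G V E x l) a b" "K \<le> l" "\<not> tree_like K x y"
  obtains p where "nbl E (x # y # p)" "set (x # y # p) \<subseteq> ball_G V E x l" "length p < K"
    "\<not> nbl (del_edge E a b) (x # y # p)"
proof -
  let ?B = "ball_G V E x l"
  interpret A: almost_acyclic E ?B a b by fact
  have sub: "set (x # y # p) \<subseteq> ?B" if "nb_walk V E (x # y # p)" "length p < K" for p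
    using nb_walk_subset_ball[OF that(1)] that(2) assms(2) by simp
  have "\<exists>p. nb_walk V E (x # y # p) \<and> length p < K \<and> \<not> nbl (del_edge E a b) (x # y # p)"
  proof (rule ccontr)
    assume *: "\<not> ?thesis"
    have "tree_like K x y"
      unfolding tree_like_def
    proof (rule inj_onI, goal_cases)
      case (1 p q)
      then have "x # y # p = x # y # q"
        using * sub[of p] sub[of q] by (intro A.del_unique) simp_all
      then show ?case by simp
    qed
    then show False using assms by blast
  qed
  then show thesis using that sub by (auto simp: nb_walk_iff)
qed

text \<open>Delete the cycle edge {v, w}. A first crossing v -> w can only be the very first step,
  and a first crossing w -> v must be preceded by the rest of the cycle run backwards. Either way
  the walk leaves v along the cycle.\<close>

lemma tree_like_off_cycle:
  assumes cyc: "is_cycle_list E V (v # w # c)" and len: "length (v # w # c) \<le> ell_G V E"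
    and u: "u \<noteq> w" "u \<noteq> last (w # c)" and K: "K \<le> ell_G V E"
  shows "tree_like K v u"
proof (rule ccontr)
  let ?B = "ball_G V E v (ell_G V E)"
  assume not: "\<not> tree_like K v u"
  have v: "v \<in> V" and c: "c \<noteq> []" "distinct (v # w # c)" "successively E (v # w # c)" "E (last c) v"
    using cyc by (cases c; auto simp: is_cycle_list_iff)+
  have "set (v # w # c) \<subseteq> ?B"
    using walk_subset_ball[of "v # w # c" "ell_G V E"] cyc len by (auto simp: is_walk_iff is_cycle_list_iff)
  then have cycB: "is_cycle_list E ?B (v # w # c)" using cyc by (auto simp: is_cycle_list_iff)
  then have A: "almost_acyclic E ?B v w"
    using almost_acyclicI_cycle[of E ?B] sym irrefl ell_G_spec[OF v] by blast
  then interpret A: almost_acyclic E ?B v w .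
  obtain p where p: "nbl E (v # u # p)" "set (v # u # p) \<subseteq> ?B" "\<not> nbl (del_edge E v w) (v # u # p)"
    using not_tree_like_crossing[OF A K not] by blast
  obtain s e d t where *: "v # u # p = s @ e # d # t" "nbl (del_edge E v w) (s @ [e])" "{e, d} = {v, w}" "e \<noteq> d"
    using A.nbl_crossing[OF p(1,3)] by (metis (no_types, lifting))
  have hd: "hd (s @ [e]) = v" using *(1) by (cases s) auto
  have sub: "set (s @ [e]) \<subseteq> ?B" using p(2) unfolding *(1) by auto
  consider "e = v" "d = w" | "e = w" "d = v" using *(3) by (auto simp: doubleton_eq_iff)
  then show False
  proof cases
    case 1
    have "s @ [e] = [v]" using * hd sub 1 by (intro A.del_unique) auto
    then show ?thesis using *(1) 1 u by auto
  next
    case 2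
    \<comment> \<open>The way from v to w around the cycle that avoids the deleted edge; by
      uniqueness it is the part before the crossing.\<close>
    let ?r = "v # rev (w # c)"
    have "successively E ?r"
      using c sym by (auto simp: successively_Cons successively_append_iff hd_append hd_rev last_rev elim: successively_mono)
    then have "successively E (rev (w # c))" by (simp add: successively_Cons)
    then have "successively (del_edge E v w) (rev (w # c))"
      by (rule successively_mono) (use c(2) in \<open>auto simp: doubleton_eq_iff\<close>)
    moreover have "{v, hd (rev (w # c))} \<noteq> {v, w}"
      using c(1,2) by (auto simp: hd_append hd_rev doubleton_eq_iff)
    ultimately have "successively (del_edge E v w) ?r"
      using \<open>successively E ?r\<close> by (simp add: successively_Cons)
    moreover have "nonback ?r" using c by (intro nonback_distinct) auto
    ultimately have "nbl (del_edge E v w) ?r" by (simp add: nbl_def)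
    then have "s @ [e] = ?r"
      using * hd sub 2 cycB by (intro A.del_unique) (auto simp: is_cycle_list_iff)
    then have "(s @ [e]) ! 1 = last (w # c)" using c(1) by (simp add: nth_append hd_rev flip: hd_conv_nth)
    moreover have "s \<noteq> []" using hd 2 c(2) by auto
    then have "(s @ [e]) ! 1 = (v # u # p) ! 1" unfolding *(1) by (cases s) (auto simp: nth_append)
    ultimately show ?thesis using u by simp
  qed
qed

text \<open>If two neighbours both fail, their crossing walks enter the deleted edge from opposite
  ends and reveal a cycle through x of length at most 2 K - 1. The neighbour returned is then the
  next vertex on that cycle.\<close>

lemma tree_like_or_cyclic:
  assumes x: "x \<in> V" and K: "2 * K \<le> ell_G V E + 1"
  obtains y where "E x y" "tree_like K x y \<or> cyclic x y"
proof -
  let ?B = "ball_G V E x (ell_G V E)"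
  have "2 \<le> card {w \<in> V. E x w}" using deg_ge_2[OF x] by (simp add: deg_def)
  then obtain N where "N \<subseteq> {w \<in> V. E x w}" "card N = 2"
    using obtain_subset_with_card_n[of 2 "{w \<in> V. E x w}"] by auto
  then obtain y1 y2 where y: "E x y1" "E x y2" "y1 \<noteq> y2" by (auto simp: card_2_iff)
  show thesis
  proof (cases "tree_like K x y1 \<or> tree_like K x y2")
    case True
    then show ?thesis using that y by blast
  next
    case False
    obtain a b where A: "almost_acyclic E ?B a b"
      using almost_acyclicI[of E ?B] sym irrefl ell_G_spec[OF x] by blast
    then interpret A: almost_acyclic E ?B a b .
    have "K \<le> ell_G V E"
    proof (cases "K = 0")
      case True
      then show ?thesis by simp
    next
      case False
      then show ?thesis using K by simp
    qed
    then obtain p1 p2 where p: "nbl E (x # y1 # p1)" "set (x # y1 # p1) \<subseteq> ?B" "length p1 < K"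
        "\<not> nbl (del_edge E a b) (x # y1 # p1)"
        "nbl E (x # y2 # p2)" "set (x # y2 # p2) \<subseteq> ?B" "length p2 < K"
        "\<not> nbl (del_edge E a b) (x # y2 # p2)"
      using not_tree_like_crossing[OF A] False by (metis (no_types, lifting))
    obtain s1 c1 d1 t1 where 1: "x # y1 # p1 = s1 @ c1 # d1 # t1"
        "nbl (del_edge E a b) (s1 @ [c1])" "{c1, d1} = {a, b}" "c1 \<noteq> d1"
      by (rule A.nbl_crossing[OF p(1,4)])
    obtain s2 c2 d2 t2 where 2: "x # y2 # p2 = s2 @ c2 # d2 # t2"
        "nbl (del_edge E a b) (s2 @ [c2])" "{c2, d2} = {a, b}" "c2 \<noteq> d2"
      by (rule A.nbl_crossing[OF p(5,8)])
    have "nbl E (c1 # d1 # t1)" using nbl_appendD(2)[of E s1 c1 "d1 # t1"] p(1) 1(1) by simp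
    then have "E c1 d1" by (simp add: nbl_Cons_Cons)
    then have ab: "E a b" using sym 1(3) by (auto simp: doubleton_eq_iff)
    have "c1 \<noteq> c2"
      using A.same_crossing_same_start[OF p(1,2) 1(1-3) p(5,6)] 2 y by blast
    then consider "c1 = a" "c2 = b" | "c1 = b" "c2 = a" using 1(3) 2(3) by (auto simp: doubleton_eq_iff)
    then obtain c where c: "is_cycle_list E ?B c" "x \<in> set c" "length c + 1 \<le> length (y1 # p1) + length (y2 # p2)"
    proof cases
      case c12: 1
      show ?thesis
        using A.cycle_through_start[OF p(2) 1(1,2)[unfolded c12] p(6) 2(1,2)[unfolded c12] y(3) ab] that by blast
    next
      case c12: 2
      show ?thesis
        using A.cycle_through_start[OF p(6) 2(1,2)[unfolded c12] p(2) 1(1,2)[unfolded c12] y(3)[symmetric] ab] that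
        by (metis add.commute)
    qed
    then obtain z l where zl: "is_cycle_list E ?B (x # z # l)" "length (x # z # l) = length c"
      using is_cycle_list_start_at by metis
    have "is_cycle_list E V (x # z # l)" using zl(1) ball_subset by (fastforce simp: is_cycle_list_def)
    moreover have "length (x # z # l) \<le> ell_G V E" using zl(2) c(3) p(3,7) K by simp
    ultimately have "cyclic x z" unfolding cyclic_def by blast
    moreover have "E x z" using zl(1) by (auto simp: is_cycle_list_iff)
    ultimately show ?thesis using that by blast
  qed
qed

end

section \<open>Green functions of the universal cover\<close>

context graph
begin

lemma deg_le_max_deg: "v \<in> V \<Longrightarrow> deg V E v \<le> max_deg V E"
  unfolding max_deg_def using finite_V by (intro Max_ge) auto

lemma nb_walk_last: "nb_walk V E p \<Longrightarrow> last p \<in> V"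
  by (auto simp: nb_walk_iff)

lemma nb_walk_snoc_iff:
  "nb_walk V E (p @ [v, z]) \<longleftrightarrow> nb_walk V E (p @ [v]) \<and> E v z \<and> (p \<noteq> [] \<longrightarrow> last p \<noteq> z)"
  using nbl_append[of E p v "[z]"] edge_V by (auto simp: nb_walk_iff nbl_Cons_Cons)

lemma tadj_cases:
  assumes "nb_walk V E p" "nb_walk V E q" "tadj p q"
  obtains (child) p' z where "p = p' @ [last p]" "q = p' @ [last p, z]" "E (last p) z" "last q = z"
  | (parent) q' where "q = q' @ [last q]" "p = q' @ [last q, last p]" "E (last p) (last q)"
proof -
  have id: "p = butlast p @ [last p]" "q = butlast q @ [last q]"
    using assms by (auto simp: nb_walk_iff)
  consider z where "q = p @ [z]" | z where "p = q @ [z]" using assms(3) by (auto simp: tadj_def)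
  then show thesis
  proof cases
    case 1
    then have q: "q = butlast p @ [last p, z]" using id(1) by (metis append.assoc append_Cons append_Nil)
    then have "E (last p) z" using assms(2) nb_walk_snoc_iff[of "butlast p" "last p" z] by simp
    then show ?thesis using child[of "butlast p" z] id q 1 by simp
  next
    case 2
    then have p: "p = butlast q @ [last q, z]" using id(2) by (metis append.assoc append_Cons append_Nil)
    then have "E (last q) z" using assms(1) nb_walk_snoc_iff[of "butlast q" "last q" z] by simp
    then show ?thesis using parent[of "butlast q"] id p 2 sym by simp
  qed
qed

text \<open>A child and the parent of p cannot lie over the same vertex, since the child would then
  be a backtracking walk.\<close>

lemma inj_on_last_nbr:
  assumes S: "S \<subseteq> {p. nb_walk V E p}" and p: "p \<in> S"
  shows "inj_on last {q \<in> S. tadj p q}"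
proof (rule inj_onI)
  fix q q' assume *: "q \<in> {q \<in> S. tadj p q}" "q' \<in> {q \<in> S. tadj p q}" "last q = last q'"
  have nb: "nb_walk V E p" "nb_walk V E q" "nb_walk V E q'" and adj: "tadj p q" "tadj p q'"
    using * S p by auto
  have mixed: False if nb: "nb_walk V E p" "nb_walk V E q" "nb_walk V E q'" and eq: "last q = last q'"
    and q: "p = p1 @ [last p]" "q = p1 @ [last p, z]" "last q = z"
    and q': "q' = p2 @ [last q']" "p = p2 @ [last q', last p]" for q q' p1 p2 z
  proof -
    have "p1 = p2 @ [last q']" using q(1) q'(2) by (metis append.assoc append_Cons append_Nil butlast_snoc)
    then have "last p1 = last q'" "p1 \<noteq> []" by simp_all
    moreover have "p1 \<noteq> [] \<longrightarrow> last p1 \<noteq> z" using nb(2) nb_walk_snoc_iff[of p1 "last p" z] q(2) by simp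
    ultimately show False using eq q(3) by simp
  qed
  from nb(1,2) adj(1) show "q = q'"
  proof (cases rule: tadj_cases)
    case c1: (child p1 z)
    from nb(1,3) adj(2) show ?thesis
    proof (cases rule: tadj_cases)
      case (child p2 z2)
      then show ?thesis using c1 *(3) by (metis butlast_snoc)
    next
      case (parent p2)
      then show ?thesis using mixed[OF nb *(3) c1(1,2,4)] by blast
    qed
  next
    case c1: (parent p1)
    from nb(1,3) adj(2) show ?thesis
    proof (cases rule: tadj_cases)
      case (child p2 z2)
      then show ?thesis using mixed[OF nb(1,3,2) *(3)[symmetric] child(1,2,4)] c1 by blast
    next
      case (parent p2)
      then show ?thesis using c1 *(3) by (metis append.assoc append_Cons append_Nil butlast_snoc)
    qed
  qed
qed

lemma last_nbr_subset:
  assumes S: "S \<subseteq> {p. nb_walk V E p}" and p: "p \<in> S"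
  shows "last ` {q \<in> S. tadj p q} \<subseteq> {v \<in> V. E (last p) v}"
proof clarify
  fix q assume q: "q \<in> S" "tadj p q"
  have nb: "nb_walk V E p" "nb_walk V E q" using S p q by auto
  then have "E (last p) (last q)"
    using q(2) by (cases rule: tadj_cases) auto
  then show "last q \<in> V \<and> E (last p) (last q)" using edge_V by blast
qed

text \<open>A crude bound for |W| that makes the operator bounded; it enters no final
  constant.\<close>

definition W_norm :: "('a \<Rightarrow> real) \<Rightarrow> real" where
  "W_norm W = (\<Sum>v\<in>V. \<bar>W v\<bar>)"

lemma tree_op_nb_walks:
  assumes S: "S \<subseteq> {p. nb_walk V E p}"
  shows "tree_op W S (max_deg V E) (W_norm W)"
proof
  fix p assume p: "p \<in> S"
  have inj: "inj_on last {q \<in> S. tadj p q}" and sub: "last ` {q \<in> S. tadj p q} \<subseteq> {v \<in> V. E (last p) v}"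
    using inj_on_last_nbr[OF S p] last_nbr_subset[OF S p] .
  have lp: "last p \<in> V" using S p nb_walk_last by auto
  show "finite {q \<in> S. tadj p q}"
    using finite_subset[OF sub finite_nbrs] finite_imageD[OF _ inj] by blast
  have "card {q \<in> S. tadj p q} \<le> deg V E (last p)"
    unfolding deg_def using card_inj_on_le[OF inj sub finite_nbrs] .
  then show "card {q \<in> S. tadj p q} \<le> max_deg V E" using deg_le_max_deg[OF lp] by simp
  show "\<bar>W (last p)\<bar> \<le> W_norm W"
    unfolding W_norm_def using lp finite_V by (intro member_le_sum) auto
next
  show "0 \<le> W_norm W" by (simp add: W_norm_def sum_nonneg)
qed

text \<open>The covering property: a neighbour v is reached by the parent if the walk has just come
  from v, and by a child otherwise. It lets eigenfunctions be lifted.\<close>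

lemma bij_betw_last_cover:
  assumes p: "p \<in> cover_verts V E r"
  shows "bij_betw last {q \<in> cover_verts V E r. tadj p q} {v \<in> V. E (last p) v}"
proof -
  let ?S = "cover_verts V E r"
  have S: "?S \<subseteq> {p. nb_walk V E p}" by (auto simp: cover_verts_def)
  have nb: "nb_walk V E p" "hd p = r" using p by (auto simp: cover_verts_def)
  have id: "p = butlast p @ [last p]" using nb by (auto simp: nb_walk_iff)
  have "v \<in> last ` {q \<in> ?S. tadj p q}" if v: "E (last p) v" for v
  proof (cases "butlast p \<noteq> [] \<and> last (butlast p) = v")
    case True
    then have bl: "butlast p = butlast (butlast p) @ [v]" by (metis append_butlast_last_id)
    then have "p = butlast (butlast p) @ [v, last p]" using id by (metis append.assoc append_Cons append_Nil)
    then have "nb_walk V E (butlast (butlast p) @ [v])"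
      using nb(1) nb_walk_snoc_iff[of "butlast (butlast p)" v "last p"] by simp
    then have "nb_walk V E (butlast p)" using bl by simp
    moreover have "hd (butlast p) = r" using id True nb(2) by (metis hd_append2)
    moreover have "tadj p (butlast p)" using id by (auto simp: tadj_def)
    ultimately show ?thesis using True by (intro image_eqI[of _ _ "butlast p"]) (auto simp: cover_verts_def)
  next
    case False
    have "nb_walk V E (butlast p @ [last p, v])"
      using nb_walk_snoc_iff[of "butlast p" "last p" v] id nb(1) v False by auto
    then have "nb_walk V E (p @ [v])" using id by (metis append.assoc append_Cons append_Nil)
    moreover have "hd (p @ [v]) = r" using nb by (auto simp: nb_walk_iff)
    ultimately show ?thesis
      by (intro image_eqI[of _ _ "p @ [v]"]) (auto simp: cover_verts_def tadj_def)
  qed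
  then show ?thesis
    using inj_on_last_nbr[OF S p] last_nbr_subset[OF S p] by (auto simp: bij_betw_def)
qed

section \<open>Branches of the cover and the recursion for zeta\<close>

lemma subtree_iff: "p \<in> subtree V E y x \<longleftrightarrow> (\<exists>r. p = y # x # r \<and> nb_walk V E (y # x # r))"
proof -
  have "take 2 p = [y, x] \<longleftrightarrow> (\<exists>r. p = y # x # r)"
    by (cases p; cases "tl p") (auto simp: numeral_2_eq_2)
  then show ?thesis by (auto simp: subtree_def)
qed

lemma subtree_subset: "subtree V E y x \<subseteq> {p. nb_walk V E p}"
  by (auto simp: subtree_def)

lemma root_in_subtree: "E y x \<Longrightarrow> [y, x] \<in> subtree V E y x"
  using edge_V by (auto simp: subtree_iff nb_walk_iff nbl_Cons_Cons)

definition succs :: "'a \<Rightarrow> 'a \<Rightarrow> 'a set" where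
  "succs w v = {u \<in> V. E v u \<and> u \<noteq> w}"

lemma finite_succs: "finite (succs w v)"
  using finite_V by (simp add: succs_def)

lemma succs_edge: "u \<in> succs w v \<Longrightarrow> E v u"
  by (simp add: succs_def)

lemma Cons_in_subtree_iff:
  "w # t \<in> subtree V E w v \<longleftrightarrow> E w v \<and> (t = [v] \<or> (\<exists>u\<in>succs w v. t \<in> subtree V E v u))"
  using edge_V by (cases t; cases "tl t") (auto simp: subtree_iff nb_walk_iff nbl_Cons_Cons succs_def)

lemma subtree_disjoint: "t \<in> subtree V E v u \<Longrightarrow> t \<in> subtree V E v u' \<Longrightarrow> u = u'"
  by (auto simp: subtree_iff)

text \<open>Schur complement at the root of the subtree.\<close>

lemma green_recursion:
  assumes E: "E w v" and z: "Im z > 0"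
  shows "green W (subtree V E w v) [w, v] z *
    (of_real (W v) - z - (\<Sum>u\<in>succs w v. green W (subtree V E v u) [v, u] z)) = 1"
proof -
  let ?S = "subtree V E w v"
  let ?C = "succs w v"
  interpret T: tree_op W ?S "max_deg V E" "W_norm W" by (rule tree_op_nb_walks[OF subtree_subset])
  have "\<exists>f. f \<in> l2 (subtree V E v u) \<and> shifted W (subtree V E v u) z f = delta_at [v, u] \<and>
      green W (subtree V E v u) [v, u] z = f [v, u] \<and> 0 \<le> Im (f [v, u])" if "u \<in> ?C" for u
  proof -
    interpret Tu: tree_op W "subtree V E v u" "max_deg V E" "W_norm W"
      by (rule tree_op_nb_walks[OF subtree_subset])
    have root: "[v, u] \<in> subtree V E v u" using root_in_subtree succs_edge[OF that] by blast
    show ?thesis using Tu.green_exists[OF root z] Tu.Im_green[OF root z] by metis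
  qed
  then obtain G where G: "\<And>u. u \<in> ?C \<Longrightarrow> G u \<in> l2 (subtree V E v u)"
      "\<And>u. u \<in> ?C \<Longrightarrow> shifted W (subtree V E v u) z (G u) = delta_at [v, u]"
      "\<And>u. u \<in> ?C \<Longrightarrow> green W (subtree V E v u) [v, u] z = G u [v, u]"
      "\<And>u. u \<in> ?C \<Longrightarrow> 0 \<le> Im (G u [v, u])" by metis
  define den where "den = of_real (W v) - z - (\<Sum>u\<in>?C. G u [v, u])"
  have "Im den < 0" using z sum_nonneg[of ?C "\<lambda>u. Im (G u [v, u])"] G(4) by (simp add: den_def)
  then have den: "den \<noteq> 0" by auto
  define g where "g = 1 / den"
  define lift where "lift u p = (if p \<noteq> [] \<and> hd p = w then G u (tl p) else 0)" for u p
  \<comment> \<open>Candidate for the solution with source at the root, by block elimination: g at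
    the root and - g times the branch solution on each branch.\<close>
  define U where "U p = g * delta_at [w, v] p + (- g) * (\<Sum>u\<in>?C. lift u p)" for p
  have lift_l2: "lift u \<in> l2 ?S" if u: "u \<in> ?C" for u
  proof (rule l2_inj_image(1)[OF G(1)[OF u], of "Cons w"])
    show "Cons w ` subtree V E v u \<subseteq> ?S" using u E Cons_in_subtree_iff by blast
    show "lift u q = 0" if "q \<notin> Cons w ` subtree V E v u" for q
    proof (cases "q \<noteq> [] \<and> hd q = w")
      case True
      then have "q = w # tl q" by (metis list.collapse)
      then have "tl q \<notin> subtree V E v u" using that by (metis imageI)
      then show ?thesis using l2_outside[OF G(1)[OF u]] by (simp add: lift_def)
    qed (auto simp: lift_def)
  qed (auto simp: lift_def)
  have U_l2: "U \<in> l2 ?S"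
    unfolding U_def using lift_l2 root_in_subtree[OF E]
    by (intro l2_add l2_cmult l2_sum l2_delta_at) auto
  have U_root: "U [w, v] = g"
  proof -
    have "lift u [w, v] = 0" if "u \<in> ?C" for u
      using l2_outside[OF G(1)[OF that], of "[v]"] by (simp add: lift_def subtree_iff)
    then show ?thesis by (simp add: U_def delta_at_def)
  qed
  have U_sub: "U (w # t) = - g * G u t" if u: "u \<in> ?C" and t: "t \<in> subtree V E v u" for u t
  proof -
    have "(\<Sum>u'\<in>?C. lift u' (w # t)) = (\<Sum>u'\<in>?C. if u' = u then G u t else 0)"
    proof (rule sum.cong)
      fix u' assume u': "u' \<in> ?C"
      show "lift u' (w # t) = (if u' = u then G u t else 0)"
        using subtree_disjoint[OF t, of u'] l2_outside[OF G(1)[OF u'], of t] by (auto simp: lift_def)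
    qed simp
    also have "\<dots> = G u t" using u finite_succs by simp
    finally have "(\<Sum>u'\<in>?C. lift u' (w # t)) = G u t" .
    moreover have "w # t \<noteq> [w, v]" using t by (auto simp: subtree_iff)
    ultimately show ?thesis by (simp add: U_def delta_at_def)
  qed
  have "shifted W ?S z U p = delta_at [w, v] p" for p
  proof (cases "p \<in> ?S")
    case False
    then have "p \<noteq> [w, v]" using root_in_subtree[OF E] by auto
    then show ?thesis using False l2_outside[OF U_l2] by (simp add: shifted_def schr_outside delta_at_def)
  next
    case True
    then obtain t where p: "p = w # t" by (auto simp: subtree_iff)
    then consider "t = [v]" | u where "u \<in> ?C" "t \<in> subtree V E v u"
      using True Cons_in_subtree_iff by blast
    then show ?thesis
    proof cases
      case 1
      have "{q \<in> ?S. tadj [w, v] q} = (\<lambda>u. [w, v, u]) ` ?C"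
      proof (intro equalityI subsetI)
        fix q assume q: "q \<in> {q \<in> ?S. tadj [w, v] q}"
        then obtain t where "q = w # t" "t \<noteq> []" by (auto simp: subtree_iff)
        then show "q \<in> (\<lambda>u. [w, v, u]) ` ?C"
          using q Cons_in_subtree_iff[of w t v] by (auto simp: tadj_def subtree_iff)
      next
        fix q assume "q \<in> (\<lambda>u. [w, v, u]) ` ?C"
        then obtain u where u: "u \<in> ?C" "q = [w, v, u]" by blast
        then show "q \<in> {q \<in> ?S. tadj [w, v] q}"
          using Cons_in_subtree_iff[of w "[v, u]" v] E root_in_subtree[OF succs_edge[OF u(1)]]
          by (auto simp: tadj_def)
      qed
      then have "schr W ?S U [w, v] = (\<Sum>u\<in>?C. U [w, v, u]) + of_real (W v) * g"
        using root_in_subtree[OF E] by (simp add: schr_def U_root sum.reindex inj_on_def)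
      also have "(\<Sum>u\<in>?C. U [w, v, u]) = - g * (\<Sum>u\<in>?C. G u [v, u])"
        unfolding sum_distrib_left by (intro sum.cong refl U_sub root_in_subtree succs_edge)
      finally have "shifted W ?S z U [w, v] = g * den"
        by (simp add: shifted_def U_root den_def algebra_simps)
      then show ?thesis using den by (simp add: p 1 g_def delta_at_def)
    next
      case (2 u)
      let ?Su = "subtree V E v u"
      interpret Tu: tree_op W ?Su "max_deg V E" "W_norm W"
        by (rule tree_op_nb_walks[OF subtree_subset])
      \<comment> \<open>Only the top vertex of a branch has a neighbour outside it, the root; the
        value g found there cancels the source of the branch solution.\<close>
      have nbr: "{q \<in> ?S. tadj (w # t) q} = Cons w ` {t' \<in> ?Su. tadj t t'} \<union> (if t = [v, u] then {[w, v]} else {})"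
      proof (intro equalityI subsetI)
        fix q assume q: "q \<in> {q \<in> ?S. tadj (w # t) q}"
        then obtain t' where t': "q = w # t'" by (auto simp: subtree_iff)
        have adj: "tadj t t'" using q t' by (auto simp: tadj_def)
        obtain r where r: "t = v # u # r" using 2(2) by (auto simp: subtree_iff)
        have "t' = [v] \<or> (\<exists>u'\<in>?C. t' \<in> subtree V E v u')"
          using q t' Cons_in_subtree_iff by blast
        then show "q \<in> Cons w ` {t' \<in> ?Su. tadj t t'} \<union> (if t = [v, u] then {[w, v]} else {})"
        proof
          assume "t' = [v]"
          moreover from this have "r = []" using adj r by (auto simp: tadj_def)
          ultimately show ?thesis using t' r by auto
        next
          assume "\<exists>u'\<in>?C. t' \<in> subtree V E v u'"
          then obtain u' r' where u': "t' = v # u' # r'" "t' \<in> subtree V E v u'" by (auto simp: subtree_iff)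
          then have "u' = u" using adj r by (auto simp: tadj_def Cons_eq_append_conv)
          then show ?thesis using u' t' adj by auto
        qed
      next
        fix q assume q: "q \<in> Cons w ` {t' \<in> ?Su. tadj t t'} \<union> (if t = [v, u] then {[w, v]} else {})"
        then consider t' where "q = w # t'" "t' \<in> ?Su" "tadj t t'" | "q = [w, v]" "t = [v, u]"
          by (auto split: if_splits)
        then show "q \<in> {q \<in> ?S. tadj (w # t) q}"
        proof cases
          case 1
          then show ?thesis using Cons_in_subtree_iff 2 E by (auto simp: tadj_def)
        next
          case 2
          then show ?thesis using root_in_subtree[OF E] by (auto simp: tadj_def)
        qed
      qed
      have notin: "[w, v] \<notin> Cons w ` {t' \<in> ?Su. tadj t t'}" by (auto simp: subtree_iff)
      have fin: "finite {t' \<in> ?Su. tadj t t'}" using Tu.finite_nbr 2 by blast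
      have "(\<Sum>q\<in>{q \<in> ?S. tadj (w # t) q}. U q) =
        (\<Sum>q\<in>Cons w ` {t' \<in> ?Su. tadj t t'}. U q) + (if t = [v, u] then g else 0)"
        unfolding nbr using notin fin U_root by (auto simp: add.commute)
      also have "(\<Sum>q\<in>Cons w ` {t' \<in> ?Su. tadj t t'}. U q) = (\<Sum>t'\<in>{t' \<in> ?Su. tadj t t'}. - g * G u t')"
        using U_sub[OF 2(1)] by (subst sum.reindex) auto
      also have "\<dots> = - g * (\<Sum>t'\<in>{t' \<in> ?Su. tadj t t'}. G u t')"
        by (simp only: sum_distrib_left)
      finally have sum: "(\<Sum>q\<in>{q \<in> ?S. tadj (w # t) q}. U q) =
        - g * (\<Sum>t'\<in>{t' \<in> ?Su. tadj t t'}. G u t') + (if t = [v, u] then g else 0)" .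
      have lt: "last (w # t) = last t" using 2(2) by (auto simp: subtree_iff)
      have sU: "shifted W ?S z U p = (\<Sum>q\<in>{q \<in> ?S. tadj (w # t) q}. U q) + of_real (W (last t)) * U (w # t) - z * U (w # t)"
        using True lt unfolding p shifted_def schr_def by simp
      have sG: "shifted W ?Su z (G u) t = (\<Sum>t'\<in>{t' \<in> ?Su. tadj t t'}. G u t') + of_real (W (last t)) * G u t - z * G u t"
        using 2(2) by (simp add: shifted_def schr_def)
      have "shifted W ?S z U p = - g * shifted W ?Su z (G u) t + (if t = [v, u] then g else 0)"
        unfolding sU sG sum U_sub[OF 2] by (simp add: algebra_simps)
      also have "\<dots> = 0" unfolding G(2)[OF 2(1)] by (simp add: delta_at_def)
      finally show ?thesis using 2(2) by (auto simp: p delta_at_def subtree_iff)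
    qed
  qed
  then have "shifted W ?S z U = delta_at [w, v]" by (rule ext)
  then have "green W ?S [w, v] z = g" using T.green_eqI[OF U_l2 _ z] U_root by simp
  then show ?thesis using den G(3) by (simp add: g_def den_def)
qed

lemma zeta_recursion:
  assumes "E w v" "Im z > 0"
  shows "zeta V E W w v z * (of_real (W v) - z + (\<Sum>u\<in>succs w v. zeta V E W v u z)) = - 1"
  using green_recursion[OF assms, of W] by (simp add: zeta_def sum_negf)

lemma Im_zeta_le:
  assumes "E w v" "Im z > 0" shows "Im (zeta V E W w v z) \<le> 0"
  using tree_op.Im_green[OF tree_op_nb_walks[OF subtree_subset] root_in_subtree[OF assms(1)] assms(2), of W]
  by (simp add: zeta_def)

text \<open>The definition of the bulk supplies the limit and a nonzero imaginary part. The sign is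
  inherited from spectral parameters with positive imaginary part, where Im zeta \<le> 0.\<close>

lemma
  assumes bulk: "bulk_spectrum V E W lam" and E: "E w v"
  shows tendsto_zeta0: "((\<lambda>eta. zeta V E W w v (of_real lam + \<i> * of_real eta)) \<longlongrightarrow> zeta0 V E W w v lam) (at_right 0)"
    and Im_zeta0: "Im (zeta0 V E W w v lam) < 0"
proof -
  obtain L where L: "((\<lambda>eta. zeta V E W w v (of_real lam + \<i> * of_real eta)) \<longlongrightarrow> L) (at_right (0::real))" "Im L \<noteq> 0"
    using bulk E edge_V[OF E] sym[OF E] unfolding bulk_spectrum_def by blast
  have "zeta0 V E W w v lam = L" unfolding zeta0_def using L(1) by (intro tendsto_Lim) auto
  then show lim: "((\<lambda>eta. zeta V E W w v (of_real lam + \<i> * of_real eta)) \<longlongrightarrow> zeta0 V E W w v lam) (at_right 0)"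
    using L by simp
  have "\<forall>\<^sub>F eta in at_right (0::real). Im (zeta V E W w v (of_real lam + \<i> * of_real eta)) \<le> 0"
    using Im_zeta_le[OF E] by (auto simp: eventually_at_right_field intro!: exI[of _ 1])
  then have "Im (zeta0 V E W w v lam) \<le> 0"
    using tendsto_upperbound[OF tendsto_Im[OF lim]] by simp
  then show "Im (zeta0 V E W w v lam) < 0" using L \<open>zeta0 V E W w v lam = L\<close> by simp
qed

lemma zeta0_recursion:
  assumes bulk: "bulk_spectrum V E W lam" and E: "E w v"
  shows "zeta0 V E W w v lam * (of_real (W v) - of_real lam + (\<Sum>u\<in>succs w v. zeta0 V E W v u lam)) = - 1"
proof -
  let ?z = "\<lambda>eta::real. complex_of_real lam + \<i> * of_real eta"
  have "((\<lambda>eta. zeta V E W w v (?z eta) * (of_real (W v) - ?z eta + (\<Sum>u\<in>succs w v. zeta V E W v u (?z eta))))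
    \<longlongrightarrow> zeta0 V E W w v lam * (of_real (W v) - (of_real lam + \<i> * of_real 0) + (\<Sum>u\<in>succs w v. zeta0 V E W v u lam))) (at_right 0)"
    by (intro tendsto_intros tendsto_zeta0[OF bulk] E) (auto dest: succs_edge)
  moreover have "\<forall>\<^sub>F eta in at_right (0::real). zeta V E W w v (?z eta) *
      (of_real (W v) - ?z eta + (\<Sum>u\<in>succs w v. zeta V E W v u (?z eta))) = - 1"
    using zeta_recursion[OF E] by (auto simp: eventually_at_right_field intro!: exI[of _ 1])
  ultimately have "((\<lambda>eta::real. - 1) \<longlongrightarrow> zeta0 V E W w v lam * (of_real (W v) - (of_real lam + \<i> * of_real 0) + (\<Sum>u\<in>succs w v. zeta0 V E W v u lam))) (at_right 0)"
    by (rule Lim_transform_eventually)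
  from tendsto_unique[OF trivial_limit_at_right_real this tendsto_const] show ?thesis by simp
qed

end

section \<open>Non-backtracking flow of an eigenfunction\<close>

text \<open>\<open>s\<close> is abstract because the locale is used twice, for the boundary values
  of zeta and for their complex conjugates.\<close>

locale flow = graph V E for V :: "'a set" and E +
  fixes W :: "'a \<Rightarrow> real" and lam z :: real and psi :: "'a \<Rightarrow> complex" and s :: "'a \<Rightarrow> 'a \<Rightarrow> complex"
  assumes eigen: "v \<in> V \<Longrightarrow> (\<Sum>w\<in>{w \<in> V. E v w}. psi w) + of_real (W v) * psi v = of_real lam * psi v"
    and normed: "(\<Sum>v\<in>V. (cmod (psi v))\<^sup>2) = 1"
    and s_rec: "E w v \<Longrightarrow> s w v * (of_real (W v) - of_real lam + (\<Sum>u\<in>succs w v. s v u)) = - 1"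
    and s_Im: "E w v \<Longrightarrow> \<bar>Im (s w v)\<bar> = (cmod (s w v))\<^sup>2 * (\<Sum>u\<in>succs w v. \<bar>Im (s v u)\<bar>)"
    and z_pos: "0 < z" and z_le: "E w v \<Longrightarrow> z \<le> \<bar>Im (s w v)\<bar>"
begin

abbreviation D :: real where "D \<equiv> real (max_deg V E)"

definition I :: "'a \<Rightarrow> 'a \<Rightarrow> real" where "I w v = \<bar>Im (s w v)\<bar>"
text \<open>For Im z > 0 a square summable solution on the branch beyond (w, v) satisfies psi v =
  zeta * psi w; F measures the deviation from this.\<close>

definition F :: "'a \<Rightarrow> 'a \<Rightarrow> complex" where "F w v = psi v - s w v * psi w"
definition Phi :: "'a \<Rightarrow> 'a \<Rightarrow> real" where "Phi w v = (cmod (F w v))\<^sup>2 / I w v"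
definition Tot :: real where "Tot = (\<Sum>(w, v)\<in>(SIGMA w:V. {v \<in> V. E w v}). Phi w v)"

lemma I_pos: "E w v \<Longrightarrow> 0 < I w v"
  using z_le[of w v] z_pos by (simp add: I_def)

lemma Phi_nonneg: "0 \<le> Phi w v"
  by (simp add: Phi_def I_def)

lemma cmod_F_sq: "E w v \<Longrightarrow> (cmod (F w v))\<^sup>2 = I w v * Phi w v"
  using I_pos[of w v] by (simp add: Phi_def)

lemma succs_eq: "succs w v = {u \<in> V. E v u} - {w}"
  by (auto simp: succs_def)

lemma succs_nonempty: "E w v \<Longrightarrow> succs w v \<noteq> {}"
proof
  assume E: "E w v" and "succs w v = {}"
  then have "{u \<in> V. E v u} \<subseteq> {w}" by (auto simp: succs_def)
  then have "deg V E v \<le> card {w}" unfolding deg_def by (intro card_mono) auto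
  then show False using deg_ge_2[of v] edge_V[OF E] by simp
qed

text \<open>There is at least one successor, so \<open>s_Im\<close> gives |s|^2 z <= |Im s| <=
  |s|.\<close>

lemma s_le: "E w v \<Longrightarrow> cmod (s w v) \<le> 1 / z" and s_ge: "E w v \<Longrightarrow> z \<le> cmod (s w v)"
proof -
  assume E: "E w v"
  show ge: "z \<le> cmod (s w v)" using z_le[OF E] abs_Im_le_cmod[of "s w v"] by linarith
  obtain u where u: "u \<in> succs w v" using succs_nonempty[OF E] by blast
  have "z \<le> \<bar>Im (s v u)\<bar>" using z_le succs_edge[OF u] by blast
  also have "\<dots> \<le> (\<Sum>u\<in>succs w v. \<bar>Im (s v u)\<bar>)"
    using u finite_succs by (intro member_le_sum) auto
  finally have "(cmod (s w v))\<^sup>2 * z \<le> \<bar>Im (s w v)\<bar>"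
    unfolding s_Im[OF E] by (intro mult_left_mono) auto
  also have "\<dots> \<le> cmod (s w v)" by (rule abs_Im_le_cmod)
  finally have "cmod (s w v) * (cmod (s w v) * z) \<le> cmod (s w v) * 1" by (simp add: power2_eq_square mult_ac)
  moreover have "0 < cmod (s w v)" using ge z_pos by linarith
  ultimately have "cmod (s w v) * z \<le> 1" by simp
  then show "cmod (s w v) \<le> 1 / z" using z_pos by (simp add: field_simps)
qed

lemma z_le_1: "z \<le> 1"
proof -
  obtain v where v: "v \<in> V" by (rule branch_vertex)
  then obtain w where "E v w" using deg_ge_2[of v] by (fastforce simp: deg_def)
  then have "z \<le> 1 / z" using s_ge s_le by force
  then have "z * z \<le> 1 * 1" using z_pos by (simp add: field_simps)
  then show ?thesis using z_pos by (metis abs_of_pos abs_le_square_iff abs_one power2_eq_square)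
qed

lemma I_le: "E w v \<Longrightarrow> I w v \<le> 1 / z"
  using s_le[of w v] abs_Im_le_cmod[of "s w v"] by (simp add: I_def)

text \<open>The eigenvalue equation at v eliminates the sum of psi over the successors; what remains
  in front of psi v is minus the factor that \<open>s_rec\<close> pairs with s.\<close>

lemma F_rec:
  assumes E: "E w v" shows "F w v = s w v * (\<Sum>u\<in>succs w v. F v u)"
proof -
  have v: "v \<in> V" "w \<in> {u \<in> V. E v u}" using edge_V[OF E] sym[OF E] by auto
  have "(\<Sum>u\<in>succs w v. psi u) = (\<Sum>u\<in>{u \<in> V. E v u}. psi u) - psi w"
    unfolding succs_eq using v finite_nbrs by (simp add: sum_diff1)
  also have "\<dots> = of_real lam * psi v - of_real (W v) * psi v - psi w"
    using eigen[OF v(1)] by (simp add: algebra_simps)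
  finally have sumF: "(\<Sum>u\<in>succs w v. F v u) =
      - (of_real (W v) - of_real lam + (\<Sum>u\<in>succs w v. s v u)) * psi v - psi w"
    by (simp add: F_def sum_subtractf algebra_simps sum_distrib_left)
  have "s w v * (\<Sum>u\<in>succs w v. F v u) =
      - (s w v * (of_real (W v) - of_real lam + (\<Sum>u\<in>succs w v. s v u))) * psi v - s w v * psi w"
    unfolding sumF by (simp add: algebra_simps)
  then show ?thesis unfolding s_rec[OF E] by (simp add: F_def)
qed

lemma cmod_sum_F_sq:
  assumes A: "A \<subseteq> succs w v"
  shows "(cmod (\<Sum>u\<in>A. F v u))\<^sup>2 \<le> (\<Sum>u\<in>A. I v u) * (\<Sum>u\<in>A. Phi v u)"
proof -
  have E: "E v u" if "u \<in> A" for u using that A succs_edge by blast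
  have eq: "cmod (F v u) = sqrt (I v u) * sqrt (Phi v u)" if "u \<in> A" for u
    using cmod_F_sq[OF E[OF that]] by (metis norm_ge_zero real_sqrt_mult real_sqrt_unique)
  have "(cmod (\<Sum>u\<in>A. F v u))\<^sup>2 \<le> (\<Sum>u\<in>A. cmod (F v u))\<^sup>2"
    by (intro power_mono sum_norm_le) auto
  also have "\<dots> = (\<Sum>u\<in>A. sqrt (I v u) * sqrt (Phi v u))\<^sup>2"
    using eq by simp
  also have "\<dots> \<le> (\<Sum>u\<in>A. (sqrt (I v u))\<^sup>2) * (\<Sum>u\<in>A. (sqrt (Phi v u))\<^sup>2)"
    by (rule Cauchy_Schwarz_ineq_sum)
  also have "\<dots> = (\<Sum>u\<in>A. I v u) * (\<Sum>u\<in>A. Phi v u)"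
    using Phi_nonneg by (simp add: I_def)
  finally show ?thesis .
qed

lemma Phi_step:
  assumes E: "E w v" shows "Phi w v \<le> (\<Sum>u\<in>succs w v. Phi v u)"
proof -
  have "I w v * Phi w v = (cmod (s w v))\<^sup>2 * (cmod (\<Sum>u\<in>succs w v. F v u))\<^sup>2"
    unfolding cmod_F_sq[OF E, symmetric] F_rec[OF E] by (simp add: norm_mult power_mult_distrib)
  also have "\<dots> \<le> (cmod (s w v))\<^sup>2 * ((\<Sum>u\<in>succs w v. I v u) * (\<Sum>u\<in>succs w v. Phi v u))"
    using cmod_sum_F_sq[of "succs w v" w v] by (intro mult_left_mono) auto
  also have "\<dots> = I w v * (\<Sum>u\<in>succs w v. Phi v u)"
    using s_Im[OF E] by (simp add: I_def)
  finally show ?thesis using I_pos[OF E] by simp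
qed

definition ext_walks :: "nat \<Rightarrow> 'a \<Rightarrow> 'a \<Rightarrow> 'a list set" where
  "ext_walks k x y = {p. nb_walk V E (x # y # p) \<and> length p = k}"

definition Phi_end :: "'a list \<Rightarrow> real" where
  "Phi_end p = Phi (last (butlast p)) (last p)"

lemma finite_ext_walks: "finite (ext_walks k x y)"
  by (rule finite_subset[OF _ finite_lists_length_eq[OF finite_V, of k]])
    (auto simp: ext_walks_def nb_walk_iff)

lemma Phi_le_walks: "E x y \<Longrightarrow> Phi x y \<le> (\<Sum>p\<in>ext_walks k x y. Phi_end (x # y # p))"
proof (induction k arbitrary: x y)
  case 0
  have "ext_walks 0 x y = {[]}" using 0 edge_V by (auto simp: ext_walks_def nb_walk_iff nbl_Cons_Cons)
  then show ?case by (simp add: Phi_end_def)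
next
  case (Suc k)
  have "Phi x y \<le> (\<Sum>u\<in>succs x y. Phi y u)" by (rule Phi_step[OF Suc.prems])
  also have "\<dots> \<le> (\<Sum>u\<in>succs x y. \<Sum>p\<in>ext_walks k y u. Phi_end (y # u # p))"
    by (intro sum_mono Suc.IH succs_edge)
  also have "\<dots> = (\<Sum>(u, p)\<in>(SIGMA u:succs x y. ext_walks k y u). Phi_end (y # u # p))"
    by (intro sum.Sigma finite_succs ballI finite_ext_walks)
  also have "\<dots> = (\<Sum>p\<in>ext_walks (Suc k) x y. Phi_end (x # y # p))"
  proof (rule sum.reindex_bij_witness[of _ "\<lambda>p. (hd p, tl p)" "\<lambda>(u, p). u # p"])
    fix p assume "p \<in> ext_walks (Suc k) x y"
    then obtain u q where p: "p = u # q" "nb_walk V E (x # y # u # q)" "length q = k"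
      by (cases p) (auto simp: ext_walks_def)
    then show "(hd p, tl p) \<in> (SIGMA u:succs x y. ext_walks k y u)"
      using edge_V by (auto simp: ext_walks_def nb_walk_iff nbl_Cons_Cons succs_def)
    show "(case (hd p, tl p) of (u, p) \<Rightarrow> u # p) = p" using p by simp
  next
    fix a assume a: "a \<in> (SIGMA u:succs x y. ext_walks k y u)"
    then show "(case a of (u, p) \<Rightarrow> u # p) \<in> ext_walks (Suc k) x y"
      using Suc.prems edge_V by (auto simp: ext_walks_def nb_walk_iff nbl_Cons_Cons succs_def)
    show "Phi_end (x # y # (case a of (u, p) \<Rightarrow> u # p)) = (case a of (u, p) \<Rightarrow> Phi_end (y # u # p))"
      by (auto simp: Phi_end_def split: prod.splits)
  qed auto
  finally show ?case .
qed

text \<open>Each of the K generations alone dominates Phi x y, and their last edges are all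
  distinct, so the K sums fit into \<open>Tot\<close> simultaneously.\<close>

lemma tree_like_Phi:
  assumes E: "E x y" and tree: "tree_like K x y"
  shows "K * Phi x y \<le> Tot"
proof -
  let ?P = "{p. nb_walk V E (x # y # p) \<and> length p < K}"
  let ?e = "\<lambda>p. (last (butlast (x # y # p)), last (x # y # p))"
  have P: "?P = (\<Union>k<K. ext_walks k x y)" by (auto simp: ext_walks_def)
  have finP: "finite ?P" unfolding P by (auto intro: finite_ext_walks)
  have inj: "inj_on ?e ?P" using tree unfolding tree_like_def inj_on_def by blast
  have "K * Phi x y = (\<Sum>k<K. Phi x y)" by simp
  also have "\<dots> \<le> (\<Sum>k<K. \<Sum>p\<in>ext_walks k x y. Phi_end (x # y # p))"
    by (intro sum_mono Phi_le_walks E)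
  also have "\<dots> = (\<Sum>p\<in>?P. Phi_end (x # y # p))"
    unfolding P by (intro sum.UNION_disjoint[symmetric]) (auto simp: finite_ext_walks, auto simp: ext_walks_def)
  also have "\<dots> = (\<Sum>(w, v)\<in>?e ` ?P. Phi w v)"
    by (subst sum.reindex[OF inj]) (simp add: Phi_end_def)
  also have "\<dots> \<le> Tot"
    unfolding Tot_def
  proof (rule sum_mono2)
    show "?e ` ?P \<subseteq> (SIGMA w:V. {v \<in> V. E w v})"
    proof clarify
      fix p assume p: "nb_walk V E (x # y # p)"
      let ?q = "butlast (x # y # p)"
      have "x # y # p = butlast ?q @ [last ?q, last (x # y # p)]"
        by (metis append.assoc append_Cons append_Nil append_butlast_last_id butlast.simps(2) list.distinct(1))
      then have "E (last ?q) (last (x # y # p))" using p nb_walk_snoc_iff by metis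
      then show "last ?q \<in> V \<and> last (x # y # p) \<in> {v \<in> V. E (last ?q) v}" using edge_V by blast
    qed
  qed (use finite_V Phi_nonneg in auto)
  finally show ?thesis .
qed

lemma sum_nbrs_sq_le: "(\<Sum>w\<in>V. \<Sum>v\<in>{v \<in> V. E w v}. (cmod (psi w))\<^sup>2) \<le> D"
proof -
  have "(\<Sum>w\<in>V. \<Sum>v\<in>{v \<in> V. E w v}. (cmod (psi w))\<^sup>2) \<le> (\<Sum>w\<in>V. D * (cmod (psi w))\<^sup>2)"
    using deg_le_max_deg by (intro sum_mono) (auto simp: deg_def intro!: mult_right_mono)
  then show ?thesis using normed by (simp flip: sum_distrib_left)
qed

text \<open>|F|^2 is at most 2 / z^2 times the sum of the two squares of psi, and division by I
  costs 1 / z. Each of the two squares, summed over directed edges, contributes at most D.\<close>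

lemma Tot_le: "Tot \<le> 4 * D / z ^ 3"
proof -
  have edge: "Phi w v \<le> 2 / z ^ 3 * ((cmod (psi v))\<^sup>2 + (cmod (psi w))\<^sup>2)" if E: "E w v" for w v
  proof -
    have 1: "1 \<le> 1 / z" using z_pos z_le_1 by simp
    have "cmod (F w v) \<le> cmod (psi v) + cmod (s w v) * cmod (psi w)"
      unfolding F_def using norm_triangle_ineq4[of "psi v" "s w v * psi w"] by (simp add: norm_mult)
    also have "\<dots> \<le> 1 / z * cmod (psi v) + 1 / z * cmod (psi w)"
      using mult_right_mono[OF 1, of "cmod (psi v)"] mult_right_mono[OF s_le[OF E], of "cmod (psi w)"] by simp
    finally have "(cmod (F w v))\<^sup>2 \<le> (1 / z * (cmod (psi v) + cmod (psi w)))\<^sup>2"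
      by (intro power_mono) (auto simp: distrib_left)
    also have "\<dots> \<le> (1 / z)\<^sup>2 * (2 * ((cmod (psi v))\<^sup>2 + (cmod (psi w))\<^sup>2))"
      unfolding power_mult_distrib
      using sum_squares_bound[of "cmod (psi v)" "cmod (psi w)"] by (intro mult_left_mono) (auto simp: power2_sum)
    finally have F: "(cmod (F w v))\<^sup>2 \<le> (1 / z)\<^sup>2 * (2 * ((cmod (psi v))\<^sup>2 + (cmod (psi w))\<^sup>2))" .
    have "Phi w v \<le> (cmod (F w v))\<^sup>2 / z"
      unfolding Phi_def using z_le[OF E] z_pos by (intro divide_left_mono) (auto simp: I_def)
    also have "\<dots> \<le> (1 / z)\<^sup>2 * (2 * ((cmod (psi v))\<^sup>2 + (cmod (psi w))\<^sup>2)) / z"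
      using F z_pos by (intro divide_right_mono) auto
    finally show ?thesis by (simp add: power2_eq_square power3_eq_cube)
  qed
  have swap: "(\<Sum>w\<in>V. \<Sum>v\<in>{v \<in> V. E w v}. (cmod (psi v))\<^sup>2) = (\<Sum>w\<in>V. \<Sum>v\<in>{v \<in> V. E w v}. (cmod (psi w))\<^sup>2)"
  proof -
    have "{w \<in> V. E w v} = {w \<in> V. E v w}" for v using sym by blast
    then show ?thesis
      using sum.swap_restrict[OF finite_V finite_V, of "\<lambda>w v. (cmod (psi v))\<^sup>2" E] by simp
  qed
  have "Tot = (\<Sum>w\<in>V. \<Sum>v\<in>{v \<in> V. E w v}. Phi w v)"
    unfolding Tot_def using finite_V by (intro sum.Sigma[symmetric]) auto
  also have "\<dots> \<le> (\<Sum>w\<in>V. \<Sum>v\<in>{v \<in> V. E w v}. 2 / z ^ 3 * ((cmod (psi v))\<^sup>2 + (cmod (psi w))\<^sup>2))"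
    by (intro sum_mono edge) auto
  also have "\<dots> = 2 / z ^ 3 * ((\<Sum>w\<in>V. \<Sum>v\<in>{v \<in> V. E w v}. (cmod (psi v))\<^sup>2) + (\<Sum>w\<in>V. \<Sum>v\<in>{v \<in> V. E w v}. (cmod (psi w))\<^sup>2))"
    by (simp only: sum.distrib distrib_left sum_distrib_left)
  also have "\<dots> \<le> 2 / z ^ 3 * (D + D)"
    unfolding swap using sum_nbrs_sq_le z_pos by (intro mult_left_mono add_mono) auto
  finally show ?thesis by simp
qed

section \<open>Edges on short cycles\<close>

lemma cyclic_next:
  assumes cyc: "is_cycle_list E V (w # v # c)"
  obtains u c' where "c = u # c'" "is_cycle_list E V (v # u # c' @ [w])" "u \<in> succs w v"
proof -
  obtain u c' where c: "c = u # c'" using cyc by (cases c) (auto simp: is_cycle_list_def)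
  have "is_cycle_list E V (rotate1 (w # v # c))" by (rule is_cycle_list_rotate1[OF cyc])
  then have "is_cycle_list E V (v # u # c' @ [w])" using c by simp
  moreover have "u \<in> succs w v" using cyc c by (auto simp: is_cycle_list_iff succs_def)
  ultimately show thesis using that c by blast
qed

text \<open>At a maximal edge followed by a branching, \<open>\<surd>M \<le> \<surd>p \<surd>M + \<surd>(1 - p) \<surd>T\<close> with \<open>p < 1\<close> the
share of the flow that stays on the cycle and \<open>T\<close> controlled by tree-like edges.\<close>

lemma branching_bound:
  assumes cyc: "is_cycle_list E V (w # v # c)" "length (w # v # c) \<le> ell_G V E"
    and max: "\<And>w' v'. cyclic w' v' \<Longrightarrow> Phi w' v' \<le> Phi w v"
    and branch: "deg V E v \<ge> 3" and K: "0 < K" "K \<le> ell_G V E"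
  shows "Phi w v \<le> 4 * D / (z\<^sup>2 * K) * Tot"
proof -
  obtain u c' where u: "c = u # c'" "is_cycle_list E V (v # u # c' @ [w])" "u \<in> succs w v"
    by (rule cyclic_next[OF cyc(1)])
  have len: "length (v # u # c' @ [w]) \<le> ell_G V E" using cyc(2) u(1) by simp
  have E: "E w v" using cyc(1) by (simp add: is_cycle_list_iff)
  define A where "A = succs w v - {u}"
  define a where "a = (\<Sum>x\<in>A. I v x)"
  define T where "T = (\<Sum>x\<in>A. Phi v x)"
  define M where "M = Phi w v"
  have finA: "finite A" "A \<subseteq> succs w v" by (auto simp: A_def finite_succs)
  have "card A \<ge> 1"
  proof -
    have "card {x \<in> V. E v x} \<le> card A + 2"
    proof -
      have "{x \<in> V. E v x} \<subseteq> A \<union> {w, u}" by (auto simp: A_def succs_def)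
      then have "card {x \<in> V. E v x} \<le> card (A \<union> {w, u})" using finA by (intro card_mono) auto
      also have "\<dots> \<le> card A + card {w, u}" by (rule card_Un_le)
      also have "card {w, u} \<le> 2" by (simp add: card_insert_if)
      finally show ?thesis by simp
    qed
    then show ?thesis using branch by (simp add: deg_def)
  qed
  then obtain x where x: "x \<in> A" by (metis all_not_in_conv card.empty not_one_le_zero)
  have "I v x \<le> a" unfolding a_def using x finA by (intro member_le_sum) (auto simp: I_def)
  then have a: "z \<le> a" using z_le[of v x] x finA succs_edge by (fastforce simp: I_def)
  have I1: "0 < I v u" using I_pos succs_edge[OF u(3)] by blast
  have M0: "0 \<le> M" and T0: "0 \<le> T" by (auto simp: M_def T_def Phi_nonneg sum_nonneg)
  have sumI: "(\<Sum>x\<in>succs w v. I v x) = I v u + a"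
    unfolding a_def A_def using u(3) finite_succs by (simp add: sum.remove)
  have s0: "0 < cmod (s w v)" using s_ge[OF E] z_pos by linarith
  have I0: "I w v = (cmod (s w v))\<^sup>2 * (I v u + a)"
    using s_Im[OF E] sumI by (simp add: I_def)
  have tree: "Phi v x \<le> Tot / K" if "x \<in> A" for x
  proof -
    \<comment> \<open>The neighbours of v on the cycle are u and w, where w is the last entry of the
      rotated list; x is neither.\<close>
    have "x \<noteq> u" "x \<noteq> last (u # c' @ [w])" using that by (auto simp: A_def succs_def)
    then have "tree_like K v x" by (intro tree_like_off_cycle[OF u(2) len _ _ K(2)])
    moreover have "E v x" using that finA succs_edge by blast
    ultimately have "K * Phi v x \<le> Tot" by (rule tree_like_Phi[rotated])
    then show ?thesis using K by (simp add: field_simps)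
  qed
  have Tot0: "0 \<le> Tot" unfolding Tot_def by (intro sum_nonneg) (auto simp: Phi_nonneg)
  have "T \<le> card A * (Tot / K)" unfolding T_def using tree by (rule sum_bounded_above)
  also have "\<dots> \<le> D * (Tot / K)"
  proof (intro mult_right_mono)
    have "card A \<le> deg V E v" unfolding deg_def by (intro card_mono finite_nbrs) (auto simp: A_def succs_def)
    then show "real (card A) \<le> D" using deg_le_max_deg[of v] edge_V[OF E] by simp
  qed (use Tot0 in simp)
  finally have T: "T \<le> D * (Tot / K)" .
  have "cyclic v u" unfolding cyclic_def using u(2) len by auto
  then have "Phi v u \<le> M" using max by (simp add: M_def)
  then have "(cmod (F v u))\<^sup>2 \<le> I v u * M"
    unfolding cmod_F_sq[OF succs_edge[OF u(3)]] using I1 by simp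
  then have F1: "cmod (F v u) \<le> sqrt (I v u * M)" by (rule real_le_rsqrt)
  have F2: "cmod (\<Sum>x\<in>A. F v x) \<le> sqrt (a * T)"
    using cmod_sum_F_sq[OF finA(2)] unfolding a_def T_def by (rule real_le_rsqrt)
  have "sqrt (I w v * M) = cmod (F w v)"
    using cmod_F_sq[OF E] by (simp add: M_def real_sqrt_unique)
  also have "\<dots> = cmod (s w v) * cmod (F v u + (\<Sum>x\<in>A. F v x))"
    unfolding F_rec[OF E] A_def using u(3) finite_succs by (simp add: norm_mult sum.remove)
  also have "\<dots> \<le> cmod (s w v) * (sqrt (I v u * M) + sqrt (a * T))"
    using F1 F2 norm_triangle_ineq[of "F v u" "\<Sum>x\<in>A. F v x"] by (intro mult_left_mono) auto
  also have "sqrt (I w v * M) = cmod (s w v) * sqrt ((I v u + a) * M)"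
    unfolding I0 by (simp add: real_sqrt_mult)
  finally have "sqrt ((I v u + a) * M) \<le> sqrt (I v u * M) + sqrt (a * T)"
    using s0 by simp
  then have key: "(sqrt (I v u + a) - sqrt (I v u)) * sqrt M \<le> sqrt a * sqrt T"
    unfolding real_sqrt_mult left_diff_distrib by linarith
  define r where "r = sqrt (I v u + a)"
  have a0: "0 < a" using a z_pos by linarith
  have r0: "0 < r" using I1 a0 by (simp add: r_def)
  \<comment> \<open>Turns the difference of square roots in \<open>key\<close> into a; the second
    factor is at most 2 r.\<close>
  have "a = (r - sqrt (I v u)) * (r + sqrt (I v u))"
    using I1 a0 by (simp add: r_def algebra_simps)
  also have "\<dots> \<le> (r - sqrt (I v u)) * (2 * r)"
    using a0 by (intro mult_left_mono) (auto simp: r_def)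
  finally have "a * sqrt M \<le> (r - sqrt (I v u)) * (2 * r) * sqrt M"
    using M0 by (intro mult_right_mono) auto
  also have "\<dots> = 2 * r * ((r - sqrt (I v u)) * sqrt M)" by simp
  also have "\<dots> \<le> 2 * r * (sqrt a * sqrt T)"
    using key r0 by (intro mult_left_mono) (auto simp: r_def)
  finally have "(a * sqrt M)\<^sup>2 \<le> (2 * r * (sqrt a * sqrt T))\<^sup>2"
    using a0 M0 by (intro power_mono) auto
  then have "a\<^sup>2 * M \<le> 4 * (I v u + a) * (a * T)"
    using a0 M0 T0 I1 by (simp add: power_mult_distrib r_def)
  then have "a * (a * M) \<le> a * (4 * (I v u + a) * T)" by (simp add: power2_eq_square mult_ac)
  then have aM: "a * M \<le> 4 * (I v u + a) * T" using a0 by simp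
  \<comment> \<open>By \<open>I0\<close> the left side is |Im (s w v)|. Dividing by |s| and using z
    \<le> |s| bounds the total weight I v u + a by 1 / z.\<close>
  have "cmod (s w v) * (cmod (s w v) * (I v u + a)) \<le> cmod (s w v) * 1"
    using I0 abs_Im_le_cmod[of "s w v"] by (simp add: I_def power2_eq_square mult.assoc)
  then have "cmod (s w v) * (I v u + a) \<le> 1" using s0 by simp
  moreover have "z * (I v u + a) \<le> cmod (s w v) * (I v u + a)"
    using s_ge[OF E] I1 a0 by (intro mult_right_mono) auto
  ultimately have zI: "z * (I v u + a) \<le> 1" by linarith
  have "z * z * M \<le> z * (a * M)"
    using a M0 z_pos by (simp add: mult.assoc mult_left_mono mult_right_mono)
  also have "\<dots> \<le> z * (4 * (I v u + a) * T)" using aM z_pos by (intro mult_left_mono) auto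
  also have "\<dots> = 4 * (z * (I v u + a)) * T" by simp
  also have "\<dots> \<le> 4 * 1 * T" using zI T0 by (intro mult_right_mono mult_left_mono) auto
  also have "\<dots> \<le> 4 * (D * (Tot / K))" using T by simp
  finally show ?thesis
    unfolding M_def using z_pos K by (simp add: field_simps power2_eq_square)
qed

text \<open>With a single successor the Cauchy--Schwarz step is an equality, so the flow passes on
  unchanged.\<close>

lemma Phi_degree_2:
  assumes E: "E w v" and succ: "succs w v = {u}"
  shows "Phi v u = Phi w v"
proof -
  have "s w v \<noteq> 0" using s_ge[OF E] z_pos by auto
  moreover have "F w v = s w v * F v u" using F_rec[OF E] succ by simp
  moreover have "I w v = (cmod (s w v))\<^sup>2 * I v u" using s_Im[OF E] succ by (simp add: I_def)
  ultimately show ?thesis by (simp add: Phi_def norm_mult power_mult_distrib)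
qed

text \<open>Follow the cycle from a maximal edge. As long as no branching occurs, Phi stays maximal;
  if none ever occurs, every vertex of the cycle has degree 2, connectedness makes the cycle the
  whole graph, and that is excluded.\<close>

lemma maximal_branching_edge:
  assumes "cyclic w0 v0"
  obtains w v c where "is_cycle_list E V (w # v # c)" "length (w # v # c) \<le> ell_G V E"
    "\<And>w' v'. cyclic w' v' \<Longrightarrow> Phi w' v' \<le> Phi w v" "deg V E v \<ge> 3"
proof -
  note witness = that
  let ?X = "{(w, v). cyclic w v}"
  have "?X \<subseteq> V \<times> V" by (auto simp: cyclic_def is_cycle_list_def)
  then have finX: "finite ?X" using finite_V by (meson finite_SigmaI finite_subset)
  define M where "M = Max ((\<lambda>(w, v). Phi w v) ` ?X)"
  have max: "Phi w v \<le> M" if "cyclic w v" for w v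
    unfolding M_def using finX that by (intro Max_ge) auto
  have "M \<in> (\<lambda>(w, v). Phi w v) ` ?X"
    unfolding M_def using finX assms by (intro Max_in) auto
  then obtain w1 v1 where "cyclic w1 v1" "Phi w1 v1 = M" by auto
  then obtain c1 where c1: "is_cycle_list E V (w1 # v1 # c1)" "length (w1 # v1 # c1) \<le> ell_G V E" "Phi w1 v1 = M"
    unfolding cyclic_def by blast
  show thesis
  proof (rule ccontr)
    assume not_thesis: "\<not> thesis"
    have none: "deg V E v < 3" if "is_cycle_list E V (w # v # c)" "length (w # v # c) \<le> ell_G V E" "Phi w v = M" for w v c
    proof (rule ccontr)
      assume "\<not> deg V E v < 3"
      then have thesis using witness[OF that(1,2)] max that(3) by simp
      then show False using not_thesis by blast
    qed
    \<comment> \<open>The maximal edge occupies the first two positions, so that each rotation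
      advances it by one step along the cycle.\<close>
    define Q where "Q l \<longleftrightarrow> is_cycle_list E V l \<and> length l \<le> ell_G V E \<and> Phi (l ! 0) (l ! 1) = M" for l
    have step: "deg V E (l ! 1) = 2 \<and> {x \<in> V. E (l ! 1) x} \<subseteq> set l \<and> Q (rotate1 l)" if Ql: "Q l" for l
    proof -
      obtain w v c where l: "l = w # v # c"
        using Ql unfolding Q_def is_cycle_list_def by (cases l; cases "tl l") auto
      have cyc: "is_cycle_list E V (w # v # c)" "length (w # v # c) \<le> ell_G V E" "Phi w v = M"
        using that by (auto simp: Q_def l)
      obtain u c' where u: "c = u # c'" "is_cycle_list E V (v # u # c' @ [w])" "u \<in> succs w v"
        by (rule cyclic_next[OF cyc(1)])
      have E: "E w v" using cyc(1) by (simp add: is_cycle_list_iff)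
      have v: "v \<in> V" using edge_V[OF E] by simp
      have deg: "deg V E v = 2" using none[OF cyc] deg_ge_2[OF v] by simp
      have "{w, u} \<subseteq> {x \<in> V. E v x}" "w \<noteq> u" using u(3) sym[OF E] edge_V[OF E] by (auto simp: succs_def)
      then have nb: "{x \<in> V. E v x} = {w, u}"
        using deg card_subset_eq[OF finite_nbrs, of "{w, u}" v] by (simp add: deg_def)
      then have "succs w v = {u}" using \<open>w \<noteq> u\<close> by (auto simp: succs_eq)
      then have "Phi v u = M" using Phi_degree_2[OF E] cyc(3) by simp
      then show ?thesis using deg nb u cyc(2) by (auto simp: l Q_def)
    qed
    have Q: "Q (rotate n (w1 # v1 # c1))" for n
    proof (induction n)
      case 0
      then show ?case using c1 by (simp add: Q_def)
    next
      case (Suc n)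
      then show ?case using step by simp
    qed
    let ?l = "w1 # v1 # c1"
    have all: "deg V E x = 2 \<and> {y \<in> V. E x y} \<subseteq> set ?l" if x: "x \<in> set ?l" for x
    proof -
      obtain j where j: "j < length ?l" "x = ?l ! j" using x by (metis in_set_conv_nth)
      \<comment> \<open>Congruent to j - 1 modulo the cycle length, since the vertex of interest is
        to reach position 1; adding the length avoids truncated subtraction at j = 0.\<close>
      let ?n = "length ?l + j - 1"
      have "rotate ?n ?l ! 1 = ?l ! ((?n + 1) mod length ?l)" by (subst nth_rotate) auto
      also have "(?n + 1) mod length ?l = (length ?l + j) mod length ?l" by simp
      also have "\<dots> = j" using j(1) by (simp only: mod_add_self1 mod_less)
      finally have "rotate ?n ?l ! 1 = x" using j by simp
      then show ?thesis using step[OF Q[of ?n]] by (simp only: set_rotate)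
    qed
    have "x \<in> set ?l" if "x \<in> V" for x
    proof -
      have "w1 \<in> V" using c1(1) by (simp add: is_cycle_list_def)
      then have "(\<lambda>a b. E a b \<and> a \<in> V \<and> b \<in> V)\<^sup>*\<^sup>* w1 x"
        using connected that by (auto simp: g_connected_def)
      then show ?thesis
      proof (induction rule: rtranclp_induct)
        case base
        then show ?case by simp
      next
        case (step y z)
        then show ?case using all[OF step.IH] by blast
      qed
    qed
    then have "is_cycle_graph V E" using all connected by (auto simp: is_cycle_graph_def)
    then show False using not_cycle by blast
  qed
qed

text \<open>Uses |F|^2 = I * Phi with I <= 1 / z. The tree-like case is weakened to the bound 4 D /
  (z^2 K) * \<open>Tot\<close> of the cyclic case.\<close>

lemma F_bound:
  assumes E: "E x y" and good: "tree_like K x y \<or> cyclic x y" and K: "0 < K" "K \<le> ell_G V E"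
  shows "cmod (F x y) \<le> 4 * D / (z ^ 3 * sqrt K)"
proof -
  have Tot0: "0 \<le> Tot" unfolding Tot_def by (intro sum_nonneg) (auto simp: Phi_nonneg)
  have D1: "1 \<le> D" using deg_ge_2[of x] deg_le_max_deg[of x] edge_V[OF E] by simp
  have "Phi x y \<le> 4 * D / (z\<^sup>2 * K) * Tot"
    using good
  proof
    assume "tree_like K x y"
    then have "Phi x y \<le> 1 / K * Tot" using tree_like_Phi[OF E] K by (simp add: field_simps)
    also have "\<dots> \<le> 4 * D / (z\<^sup>2 * K) * Tot"
    proof (intro mult_right_mono Tot0)
      have "z\<^sup>2 \<le> 1" using z_pos z_le_1 by (simp add: power_le_one)
      then have "z\<^sup>2 \<le> 4 * D" using D1 by linarith
      then show "1 / K \<le> 4 * D / (z\<^sup>2 * K)" using K z_pos by (simp add: field_simps)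
    qed
    finally show ?thesis .
  next
    assume cyc: "cyclic x y"
    obtain w v c where wv: "is_cycle_list E V (w # v # c)" "length (w # v # c) \<le> ell_G V E"
        "\<And>w' v'. cyclic w' v' \<Longrightarrow> Phi w' v' \<le> Phi w v" "deg V E v \<ge> 3"
      using maximal_branching_edge[OF cyc] by metis
    have "Phi x y \<le> Phi w v" using wv(3)[OF cyc] .
    also have "\<dots> \<le> 4 * D / (z\<^sup>2 * K) * Tot" by (rule branching_bound[OF wv K])
    finally show ?thesis .
  qed
  also have "\<dots> \<le> 4 * D / (z\<^sup>2 * K) * (4 * D / z ^ 3)"
    using Tot_le z_pos by (intro mult_left_mono) auto
  finally have Phi: "Phi x y \<le> 4 * D / (z\<^sup>2 * K) * (4 * D / z ^ 3)" .
  have "(cmod (F x y))\<^sup>2 \<le> 1 / z * (4 * D / (z\<^sup>2 * K) * (4 * D / z ^ 3))"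
    unfolding cmod_F_sq[OF E] using I_le[OF E] Phi z_pos by (intro mult_mono) (auto simp: Phi_nonneg)
  also have "\<dots> = (4 * D / (z ^ 3 * sqrt K))\<^sup>2"
    using z_pos K by (simp add: power_divide power_mult_distrib power2_eq_square power3_eq_cube)
  finally show ?thesis by (rule power2_le_imp_le) (use z_pos in simp)
qed

end

section \<open>The estimate in the bulk\<close>

context graph
begin

lemma bulk_bound:
  assumes bulk: "bulk_spectrum V E W lam"
    and eigen: "\<And>v. v \<in> V \<Longrightarrow> (\<Sum>w\<in>{w \<in> V. E v w}. psi w) + of_real (W v) * psi v = of_real lam * psi v"
    and normed: "(\<Sum>v\<in>V. (cmod (psi v))\<^sup>2) = 1" and x: "x \<in> V"
  shows "cmod (psi x) * sqrt (real (ell_G V E)) \<le> 8 * real (max_deg V E) / (z_lambda V E W lam) ^ 4"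
proof -
  define s where "s w v = zeta0 V E W w v lam" for w v
  define z where "z = z_lambda V E W lam"
  let ?Z = "{\<bar>Im (zeta0 V E W y x lam)\<bar> | x y. x \<in> V \<and> y \<in> V \<and> E x y}"
  have neg: "Im (s w v) < 0" if "E w v" for w v using Im_zeta0[OF bulk that] by (simp add: s_def)
  have "?Z \<subseteq> (\<lambda>(x, y). \<bar>Im (zeta0 V E W y x lam)\<bar>) ` (V \<times> V)" by auto
  then have finZ: "finite ?Z" using finite_V by (meson finite_SigmaI finite_imageI finite_subset)
  obtain y0 where y0: "E x y0" using tree_like_or_cyclic[OF x, of 0] by auto
  have neZ: "?Z \<noteq> {}" using y0 edge_V[OF y0] by blast
  have z_le: "z \<le> \<bar>Im (s w v)\<bar>" if E: "E w v" for w v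
    unfolding z_def z_lambda_def s_def using sym[OF E] edge_V[OF E] by (intro Min_le finZ) blast
  have "z \<in> ?Z" unfolding z_def z_lambda_def using finZ neZ by (rule Min_in)
  then obtain w v where "z = \<bar>Im (s w v)\<bar>" "E w v" using sym by (auto simp: s_def)
  then have z_pos: "0 < z" using neg[of w v] by simp
  have rec: "s w v * (of_real (W v) - of_real lam + (\<Sum>u\<in>succs w v. s v u)) = - 1" if "E w v" for w v
    using zeta0_recursion[OF bulk that] by (simp add: s_def)
  have Im_eq: "\<bar>Im (s w v)\<bar> = (cmod (s w v))\<^sup>2 * (\<Sum>u\<in>succs w v. \<bar>Im (s v u)\<bar>)" if E: "E w v" for w v
  proof -
    have nz: "s w v \<noteq> 0" using neg[OF E] by auto
    define t where "t = of_real (W v) - of_real lam + (\<Sum>u\<in>succs w v. s v u)"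
    \<comment> \<open>Multiplying the recursion by the conjugate gives |s|^2 t = - cnj s, whose
      imaginary part is the claim because all Im s have the same sign.\<close>
    have "cnj (s w v) * (s w v * t) = - cnj (s w v)" using rec[OF E] by (simp add: t_def)
    then have "of_real ((cmod (s w v))\<^sup>2) * t = - cnj (s w v)"
      by (simp only: complex_norm_square mult_ac)
    then have "Im (of_real ((cmod (s w v))\<^sup>2) * t) = Im (- cnj (s w v))" by (rule arg_cong)
    then have "(cmod (s w v))\<^sup>2 * Im t = Im (s w v)" by (simp only: Im_complex_of_real times_complex.sel) simp
    moreover have "Im t = (\<Sum>u\<in>succs w v. Im (s v u))" by (simp add: t_def)
    moreover have "(\<Sum>u\<in>succs w v. \<bar>Im (s v u)\<bar>) = - (\<Sum>u\<in>succs w v. Im (s v u))"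
      using neg succs_edge by (auto simp: sum_negf[symmetric] intro!: sum.cong abs_of_neg)
    ultimately show ?thesis using neg[OF E] by simp
  qed
  interpret P: flow V E W lam z psi s
    using eigen normed rec Im_eq z_pos z_le by unfold_locales auto
  interpret N: flow V E W lam z psi "\<lambda>w v. cnj (s w v)"
  proof unfold_locales
    fix w v assume "E w v"
    from arg_cong[OF rec[OF this], of cnj]
    show "cnj (s w v) * (of_real (W v) - of_real lam + (\<Sum>u\<in>succs w v. cnj (s v u))) = - 1" by simp
  qed (use eigen normed Im_eq z_pos z_le in auto)
  \<comment> \<open>Rounding up gives 2 K <= \<open>ell_G\<close> + 1, as the choice of neighbour
    requires, and keeps K positive; \<open>ell_G\<close> <= 4 K then supplies the factor 2 sqrt
    K.\<close>
  define K where "K = (ell_G V E + 1) div 2"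
  show ?thesis
  proof (cases "ell_G V E = 0")
    case True
    then show ?thesis using z_pos by (simp add: z_def)
  next
    case False
    have K: "0 < K" "K \<le> ell_G V E" "2 * K \<le> ell_G V E + 1" "ell_G V E \<le> 4 * K"
      using False by (auto simp: K_def)
    obtain y where y: "E x y" "tree_like K x y \<or> cyclic x y" by (rule tree_like_or_cyclic[OF x K(3)])
    define B where "B = 4 * real (max_deg V E) / (z ^ 3 * sqrt K)"
    have FB: "cmod (P.F x y) \<le> B" "cmod (N.F x y) \<le> B"
      using P.F_bound[OF y K(1,2)] N.F_bound[OF y K(1,2)] by (auto simp: B_def)
    \<comment> \<open>The value psi y at the neighbour drops out of the difference.\<close>
    have "N.F x y - P.F x y = 2 * \<i> * Im (s x y) * psi x"
      by (simp add: N.F_def P.F_def complex_eq_iff algebra_simps)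
    then have "2 * \<bar>Im (s x y)\<bar> * cmod (psi x) = cmod (N.F x y - P.F x y)"
      by (simp add: norm_mult)
    also have "\<dots> \<le> 2 * B" using FB norm_triangle_ineq4[of "N.F x y" "P.F x y"] by linarith
    finally have "\<bar>Im (s x y)\<bar> * cmod (psi x) \<le> B" by simp
    moreover have "z * cmod (psi x) \<le> \<bar>Im (s x y)\<bar> * cmod (psi x)"
      using z_le[OF y(1)] by (intro mult_right_mono) auto
    ultimately have psi: "cmod (psi x) \<le> B / z" using z_pos by (simp add: field_simps)
    have "sqrt (ell_G V E) \<le> sqrt (4 * K)" using K(4) by (simp del: real_sqrt_mult)
    then have sq: "sqrt (ell_G V E) \<le> 2 * sqrt K" by (simp add: real_sqrt_mult)
    have B0: "0 \<le> B" using z_pos by (simp add: B_def)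
    have "cmod (psi x) * sqrt (ell_G V E) \<le> B / z * (2 * sqrt K)"
      using psi sq B0 z_pos by (intro mult_mono) auto
    also have "\<dots> = 8 * real (max_deg V E) / z ^ 4"
      using z_pos K(1) by (simp add: B_def field_simps power3_eq_cube power4_eq_xxxx)
    finally show ?thesis by (simp add: z_def)
  qed
qed

end

section \<open>Resolvents of Schroedinger operators\<close>

context tree_op
begin

text \<open>Membership in the resolvent set with an explicit positive bound C, so that distances to
  the spectrum can be read off.\<close>

definition is_resolvent :: "complex \<Rightarrow> real \<Rightarrow> (('a list \<Rightarrow> complex) \<Rightarrow> 'a list \<Rightarrow> complex) \<Rightarrow> bool" where
  "is_resolvent z C T \<longleftrightarrow> 0 < C \<and> (\<forall>f\<in>l2 S. T f \<in> l2 S \<and> shifted W S z (T f) = f \<and>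
     T (shifted W S z f) = f \<and> l2norm S (T f) \<le> C * l2norm S f)"

lemma in_resolvent_set_iff: "in_resolvent_set W S z \<longleftrightarrow> (\<exists>C T. is_resolvent z C T)"
proof
  assume "in_resolvent_set W S z"
  then obtain R C where R: "\<And>f. f \<in> l2 S \<Longrightarrow> R f \<in> l2 S" "\<And>f. f \<in> l2 S \<Longrightarrow> l2norm S (R f) \<le> C * l2norm S f"
     "\<And>f. f \<in> l2 S \<Longrightarrow> shifted W S z (R f) = f" "\<And>f. f \<in> l2 S \<Longrightarrow> R (shifted W S z f) = f"
    unfolding in_resolvent_set_def shifted_def by blast
  have "l2norm S (R f) \<le> max C 1 * l2norm S f" if "f \<in> l2 S" for f
    using R(2)[OF that] mult_right_mono[of C "max C 1" "l2norm S f"] by simp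
  then have "is_resolvent z (max C 1) R" unfolding is_resolvent_def using R by simp
  then show "\<exists>C T. is_resolvent z C T" by blast
next
  assume "\<exists>C T. is_resolvent z C T"
  then show "in_resolvent_set W S z"
    unfolding in_resolvent_set_def is_resolvent_def shifted_def by blast
qed

lemma
  assumes T: "is_resolvent z C T"
  shows resolvent_pos: "0 < C"
    and resolvent_l2: "f \<in> l2 S \<Longrightarrow> T f \<in> l2 S"
    and resolvent_right: "f \<in> l2 S \<Longrightarrow> shifted W S z (T f) = f"
    and resolvent_left: "f \<in> l2 S \<Longrightarrow> T (shifted W S z f) = f"
    and resolvent_bound: "f \<in> l2 S \<Longrightarrow> l2norm S (T f) \<le> C * l2norm S f"
  using T by (auto simp: is_resolvent_def)

lemma resolvent_lower:
  assumes T: "is_resolvent z C T" and f: "f \<in> l2 S"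
  shows "l2norm S f \<le> C * l2norm S (shifted W S z f)"
  using resolvent_bound[OF T shifted_l2[OF f, of z]] resolvent_left[OF T f] by simp

text \<open>T is given merely as a two-sided inverse on \<open>l2 S\<close>; it is additive because
  the operator that it inverts is.\<close>

lemma resolvent_add:
  assumes T: "is_resolvent z C T" and f: "f \<in> l2 S" and g: "g \<in> l2 S"
  shows "T (\<lambda>p. f p + g p) = (\<lambda>p. T f p + T g p)"
proof -
  have "shifted W S z (\<lambda>p. T f p + T g p) = (\<lambda>p. f p + g p)"
    unfolding shifted_add using resolvent_right[OF T] f g by simp
  moreover have "(\<lambda>p. T f p + T g p) \<in> l2 S" using resolvent_l2[OF T] f g by (intro l2_add)
  ultimately show ?thesis using resolvent_left[OF T] by metis
qed

lemma resolvent_cmult: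
  assumes T: "is_resolvent z C T" and f: "f \<in> l2 S"
  shows "T (\<lambda>p. c * f p) = (\<lambda>p. c * T f p)"
proof -
  have "shifted W S z (\<lambda>p. c * T f p) = (\<lambda>p. c * f p)"
    unfolding shifted_cmult using resolvent_right[OF T f] by simp
  moreover have "(\<lambda>p. c * T f p) \<in> l2 S" using resolvent_l2[OF T f] by (rule l2_cmult)
  ultimately show ?thesis using resolvent_left[OF T] by metis
qed

lemma resolvent_diff:
  assumes T: "is_resolvent z C T" and f: "f \<in> l2 S" and g: "g \<in> l2 S"
  shows "T (\<lambda>p. f p - g p) = (\<lambda>p. T f p - T g p)"
  using resolvent_add[OF T f l2_cmult[OF g], of "- 1"] resolvent_cmult[OF T g, of "- 1"] by simp

lemma in_resolvent_setI:
  assumes lower: "\<And>f. f \<in> l2 S \<Longrightarrow> l2norm S f \<le> C * l2norm S (shifted W S z f)"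
    and surj: "\<And>f. f \<in> l2 S \<Longrightarrow> \<exists>u\<in>l2 S. shifted W S z u = f"
  shows "in_resolvent_set W S z"
proof -
  obtain T where T: "\<And>f. f \<in> l2 S \<Longrightarrow> T f \<in> l2 S" "\<And>f. f \<in> l2 S \<Longrightarrow> shifted W S z (T f) = f"
    using surj by metis
  have left: "T (shifted W S z f) = f" if f: "f \<in> l2 S" for f
  proof -
    let ?d = "\<lambda>p. T (shifted W S z f) p - f p"
    have d: "?d \<in> l2 S" by (intro l2_diff T(1) shifted_l2 f)
    have "shifted W S z ?d = (\<lambda>p. 0)"
      unfolding shifted_diff T(2)[OF shifted_l2[OF f]] by simp
    then have "l2norm S ?d \<le> 0" using lower[OF d] by (simp add: l2norm_def)
    then have "?d = (\<lambda>p. 0)" using l2norm_eq_0_iff[OF d] by (simp add: order_antisym)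
    then show ?thesis by (simp add: fun_eq_iff)
  qed
  have "l2norm S (T f) \<le> max C 1 * l2norm S f" if f: "f \<in> l2 S" for f
    using lower[OF T(1)[OF f]] T(2)[OF f] mult_right_mono[of C "max C 1" "l2norm S f"] by simp
  then have "is_resolvent z (max C 1) T" unfolding is_resolvent_def using T left by simp
  then show ?thesis using in_resolvent_set_iff by blast
qed

text \<open>Neumann series: (H - z') v = f is the equation v = T f + (z' - z) T v, a contraction.
  Quantitatively, the spectrum keeps distance at least 1 / C from z.\<close>

lemma resolvent_set_open:
  assumes T: "is_resolvent z C T" and close: "C * cmod (z' - z) < 1"
  shows "in_resolvent_set W S z'"
proof (rule in_resolvent_setI)
  define q where "q = C * cmod (z' - z)"
  have q: "0 \<le> q" "q < 1" using resolvent_pos[OF T] close by (auto simp: q_def)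
  have shift: "shifted W S z f = (\<lambda>p. shifted W S z' f p + (z' - z) * f p)" for f
    by (simp add: shifted_def algebra_simps)
  fix f assume f: "f \<in> l2 S"
  have "l2norm S f \<le> C * (l2norm S (shifted W S z' f) + cmod (z' - z) * l2norm S f)"
    using resolvent_lower[OF T f] resolvent_pos[OF T]
      l2norm_triangle[OF shifted_l2[OF f] l2_cmult[OF f], of z' "z' - z"]
    unfolding shift l2norm_cmult by (meson mult_left_mono order_trans less_imp_le)
  then have "(1 - q) * l2norm S f \<le> C * l2norm S (shifted W S z' f)"
    by (simp add: q_def algebra_simps)
  then show "l2norm S f \<le> C / (1 - q) * l2norm S (shifted W S z' f)"
    using q by (simp add: field_simps)
  obtain v where v: "v \<in> l2 S" "v = (\<lambda>p. T f p + (z' - z) * T v p)"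
  proof (rule l2_neumann[of S "\<lambda>u p. (z' - z) * T u p" q "T f"])
    show "(\<lambda>p. (z' - z) * T u p) \<in> l2 S" if "u \<in> l2 S" for u
      using resolvent_l2[OF T that] by (rule l2_cmult)
    show "(\<lambda>p. (z' - z) * T (\<lambda>p. u p - g p) p) = (\<lambda>p. (z' - z) * T u p - (z' - z) * T g p)"
      if "u \<in> l2 S" "g \<in> l2 S" for u g
      unfolding resolvent_diff[OF T that] by (simp add: right_diff_distrib)
    show "l2norm S (\<lambda>p. (z' - z) * T u p) \<le> q * l2norm S u" if "u \<in> l2 S" for u
      unfolding l2norm_cmult q_def using mult_left_mono[OF resolvent_bound[OF T that], of "cmod (z' - z)"]
      by (simp add: mult_ac)
    show "T f \<in> l2 S" using resolvent_l2[OF T f] .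
  qed (use q in auto)
  have "shifted W S z v = (\<lambda>p. f p + (z' - z) * v p)"
    by (subst v(2)) (simp only: shifted_add shifted_cmult resolvent_right[OF T f] resolvent_right[OF T v(1)])
  then have "shifted W S z' v = f" unfolding shift by (simp add: fun_eq_iff)
  then show "\<exists>u\<in>l2 S. shifted W S z' u = f" using v(1) by blast
qed

section \<open>Norm of the resolvent and distance to the spectrum\<close>

lemma shifted_symmetric:
  assumes f: "f \<in> l2 S" and g: "g \<in> l2 S"
  shows "l2ip S (shifted W S (of_real lam) f) g = l2ip S f (shifted W S (of_real lam) g)"
proof -
  have "l2ip S f (shifted W S (of_real lam) g) = cnj (l2ip S (schr W S g) f - of_real lam * l2ip S g f)"
    unfolding shifted_def by (subst l2ip_commute) (simp only: l2ip_diff_left schr_l2 g f l2_cmult l2ip_cmult_left)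
  also have "\<dots> = l2ip S f (schr W S g) - of_real lam * l2ip S f g"
    by (simp flip: l2ip_commute)
  also have "\<dots> = l2ip S (shifted W S (of_real lam) f) g"
    unfolding shifted_def using f g by (simp only: l2ip_diff_left schr_l2 l2_cmult l2ip_cmult_left schr_symmetric)
  finally show ?thesis by simp
qed

lemma resolvent_symmetric:
  assumes T: "is_resolvent (of_real lam) C T" and f: "f \<in> l2 S" and g: "g \<in> l2 S"
  shows "l2ip S (T f) g = l2ip S f (T g)"
  using shifted_symmetric[OF resolvent_l2[OF T f] resolvent_l2[OF T g], of lam]
  by (simp add: resolvent_right[OF T] f g)

text \<open>A bounded self-adjoint operator of norm \<open>\<tau>\<close> has \<open>\<tau>\<close> or \<open>-\<tau>\<close> in its spectrum, because
\<open>T\<^sup>2 - \<tau>\<^sup>2\<close> is not bounded below; for a resolvent this is a spectral point of \<open>H\<close> at distance \<open>1 / \<tau>\<close>.\<close>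

lemma resolvent_norm_attained:
  assumes T: "is_resolvent (of_real lam) C T" and S: "S \<noteq> {}"
  obtains t where "0 < t" "\<And>f. f \<in> l2 S \<Longrightarrow> l2norm S (T f) \<le> t * l2norm S f"
    "\<not> in_resolvent_set W S (of_real (lam + 1 / t)) \<or> \<not> in_resolvent_set W S (of_real (lam - 1 / t))"
proof -
  define N where "N = {l2norm S (T f) | f. f \<in> l2 S \<and> l2norm S f = 1}"
  define t where "t = Sup N"
  obtain r where r: "r \<in> S" using S by blast
  have rN: "l2norm S (T (delta_at r)) \<in> N"
    unfolding N_def using l2_delta_at[OF r] l2norm_delta_at[OF r] by blast
  have bdd: "bdd_above N"
    unfolding N_def using resolvent_bound[OF T] by (intro bdd_aboveI[of _ C]) fastforce
  have "T (delta_at r) \<noteq> (\<lambda>p. 0)"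
  proof
    assume "T (delta_at r) = (\<lambda>p. 0)"
    then have "delta_at r = shifted W S (of_real lam) (\<lambda>p. 0)"
      using resolvent_right[OF T l2_delta_at[OF r]] by simp
    then have "delta_at r r = 0" by (simp add: shifted_def schr_def)
    then show False by (simp add: delta_at_def)
  qed
  then have "0 < l2norm S (T (delta_at r))"
    using l2norm_eq_0_iff[OF resolvent_l2[OF T l2_delta_at[OF r]]] l2norm_nonneg[of S "T (delta_at r)"] by linarith
  also have "\<dots> \<le> t" unfolding t_def using rN bdd by (rule cSup_upper)
  finally have t0: "0 < t" .
  have bound: "l2norm S (T f) \<le> t * l2norm S f" if f: "f \<in> l2 S" for f
  proof (cases "l2norm S f = 0")
    case True
    then have "l2norm S (T f) \<le> 0" using resolvent_bound[OF T f] by simp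
    then show ?thesis using True by simp
  next
    case False
    define c where "c = complex_of_real (1 / l2norm S f)"
    have c: "cmod c = 1 / l2norm S f" by (simp add: c_def norm_divide)
    have "l2norm S (\<lambda>p. c * f p) = 1" using False by (simp add: l2norm_cmult c)
    then have "l2norm S (T (\<lambda>p. c * f p)) \<in> N" unfolding N_def using l2_cmult[OF f] by blast
    then have "l2norm S (T (\<lambda>p. c * f p)) \<le> t" unfolding t_def using bdd by (rule cSup_upper)
    then have "l2norm S (T f) / l2norm S f \<le> t"
      unfolding resolvent_cmult[OF T f] l2norm_cmult c by simp
    then show ?thesis using False l2norm_nonneg[of S f] by (simp add: field_simps)
  qed
  \<comment> \<open>Since e^2 = 1, applying H - lam - e / t to T g gives - (e / t) (T g - e t g). A
    resolvent at lam + e / t therefore makes T - e t bounded below.\<close>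
  have lower: "\<exists>B>0. \<forall>g\<in>l2 S. l2norm S g \<le> B * l2norm S (\<lambda>p. T g p - of_real (e * t) * g p)"
    if e: "e\<^sup>2 = 1" and res: "in_resolvent_set W S (of_real (lam + e / t))" for e
  proof -
    obtain C' T' where T': "is_resolvent (of_real (lam + e / t)) C' T'"
      using res in_resolvent_set_iff by blast
    have abs_e: "\<bar>e\<bar> = 1" using e by (auto simp: power2_eq_1_iff)
    define B where "B = (C' / t + 1) / t"
    have "0 < B" using resolvent_pos[OF T'] t0 by (simp add: B_def add_pos_pos)
    moreover have "l2norm S g \<le> B * l2norm S (\<lambda>p. T g p - of_real (e * t) * g p)" if g: "g \<in> l2 S" for g
    proof -
      let ?d = "\<lambda>p. T g p - of_real (e * t) * g p"
      have Tg: "T g \<in> l2 S" and d: "?d \<in> l2 S"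
        using resolvent_l2[OF T g] l2_cmult[OF g] by (auto intro: l2_diff)
      have "shifted W S (of_real (lam + e / t)) (T g) p = of_real (- e / t) * ?d p" for p
      proof -
        have "shifted W S (of_real (lam + e / t)) (T g) p = shifted W S (of_real lam) (T g) p - of_real (e / t) * T g p"
          by (simp add: shifted_def algebra_simps)
        also have "\<dots> = g p - of_real (e / t) * T g p" unfolding resolvent_right[OF T g] ..
        also have "g p = of_real (e / t * (e * t)) * g p" using e t0 by (simp add: power2_eq_square)
        finally show ?thesis by (simp add: algebra_simps)
      qed
      then have "shifted W S (of_real (lam + e / t)) (T g) = (\<lambda>p. of_real (- e / t) * ?d p)" by (rule ext)
      then have "l2norm S (shifted W S (of_real (lam + e / t)) (T g)) = l2norm S (\<lambda>p. of_real (- e / t) * ?d p)"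
        by (rule arg_cong)
      also have "\<dots> = cmod (complex_of_real (- e / t)) * l2norm S ?d" by (rule l2norm_cmult)
      also have "cmod (complex_of_real (- e / t)) = 1 / t"
        using abs_e t0 by (simp only: norm_of_real) simp
      finally have "l2norm S (T g) \<le> C' * (1 / t * l2norm S ?d)"
        using resolvent_lower[OF T' Tg] by simp
      moreover have "t * l2norm S g = l2norm S (\<lambda>p. of_real (e * t) * g p)"
        using abs_e t0 by (simp only: l2norm_cmult norm_of_real) (simp add: abs_mult)
      moreover have "(\<lambda>p. of_real (e * t) * g p) = (\<lambda>p. T g p - ?d p)" by simp
      ultimately have "t * l2norm S g \<le> C' * (1 / t * l2norm S ?d) + l2norm S ?d"
        using l2norm_triangle_diff[OF Tg d] by simp
      then show ?thesis using t0 by (simp add: B_def field_simps)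
    qed
    ultimately show ?thesis by blast
  qed
  have "\<not> in_resolvent_set W S (of_real (lam + 1 / t)) \<or> \<not> in_resolvent_set W S (of_real (lam - 1 / t))"
  proof (rule ccontr)
    assume "\<not> ?thesis"
    then obtain B1 B2 where B1: "0 < B1" "\<And>g. g \<in> l2 S \<Longrightarrow> l2norm S g \<le> B1 * l2norm S (\<lambda>p. T g p - of_real (1 * t) * g p)"
      and B2: "0 < B2" "\<And>g. g \<in> l2 S \<Longrightarrow> l2norm S g \<le> B2 * l2norm S (\<lambda>p. T g p - of_real ((- 1) * t) * g p)"
      using lower[of 1] lower[of "- 1"] by auto
    define B where "B = B2 * B1"
    have B: "0 < B" using B1 B2 by (simp add: B_def)
    \<comment> \<open>T^2 - t^2 factors as (T - t) (T + t), and both factors are bounded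
      below.\<close>
    have low: "l2norm S f \<le> B * l2norm S (\<lambda>p. T (T f) p - of_real (t\<^sup>2) * f p)" if f: "f \<in> l2 S" for f
    proof -
      let ?g = "\<lambda>p. T f p - of_real ((- 1) * t) * f p"
      have Tf: "T f \<in> l2 S" using resolvent_l2[OF T f] .
      have g: "?g \<in> l2 S" using Tf l2_cmult[OF f] by (rule l2_diff)
      have "T ?g p - of_real (1 * t) * ?g p = T (T f) p - of_real (t\<^sup>2) * f p" for p
        unfolding resolvent_diff[OF T Tf l2_cmult[OF f]] resolvent_cmult[OF T f]
        by (simp add: power2_eq_square algebra_simps)
      then have "l2norm S ?g \<le> B1 * l2norm S (\<lambda>p. T (T f) p - of_real (t\<^sup>2) * f p)"
        using B1(2)[OF g] by presburger
      then have "B2 * l2norm S ?g \<le> B2 * (B1 * l2norm S (\<lambda>p. T (T f) p - of_real (t\<^sup>2) * f p))"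
        using B2(1) by (intro mult_left_mono) auto
      then show ?thesis using B2(2)[OF f] by (simp add: B_def mult.assoc)
    qed
    \<comment> \<open>Chosen so that \<open>B\<^sup>2\<close> * t^2 * eps * 2 t equals 1 / 2, which
      contradicts \<open>low\<close> for a unit vector.\<close>
    define eps where "eps = 1 / (4 * B\<^sup>2 * t ^ 3)"
    have "t - eps < Sup N" using B t0 by (simp add: t_def[symmetric] eps_def)
    then obtain n where n: "n \<in> N" "t - eps < n" using rN bdd less_cSup_iff[of N "t - eps"] by blast
    then obtain f where f: "f \<in> l2 S" "l2norm S f = 1" "t - eps < l2norm S (T f)"
      unfolding N_def by blast
    define m where "m = l2norm S (T f)"
    have m: "0 \<le> m" "m \<le> t" using bound[OF f(1)] f(2) by (simp_all add: m_def)
    have Tf: "T f \<in> l2 S" "T (T f) \<in> l2 S" using resolvent_l2[OF T] f(1) by blast+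
    let ?h = "\<lambda>p. complex_of_real (- (t\<^sup>2)) * f p"
    have "l2ip S (T (T f)) ?h = cnj (l2ip S ?h (T (T f)))" by (rule l2ip_commute)
    also have "\<dots> = of_real (- (t\<^sup>2)) * l2ip S (T (T f)) f"
      by (simp only: l2ip_cmult_left complex_cnj_mult complex_cnj_complex_of_real flip: l2ip_commute)
    also have "l2ip S (T (T f)) f = of_real (m\<^sup>2)"
      using resolvent_symmetric[OF T Tf(1) f(1)] l2ip_self[OF Tf(1)] by (simp add: m_def)
    finally have ip: "Re (l2ip S (T (T f)) ?h) = - (t\<^sup>2 * m\<^sup>2)" by simp
    have h: "l2norm S ?h = t\<^sup>2" by (simp only: l2norm_cmult norm_of_real f(2)) simp
    \<comment> \<open>By symmetry of T the cross term is - 2 t^2 ||T f||^2, so the expression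
      becomes small at a near-maximiser of ||T f||.\<close>
    have "(l2norm S (\<lambda>p. T (T f) p - of_real (t\<^sup>2) * f p))\<^sup>2 = (l2norm S (\<lambda>p. T (T f) p + ?h p))\<^sup>2"
      by simp
    also have "\<dots> = (l2norm S (T (T f)))\<^sup>2 + (t\<^sup>2)\<^sup>2 + 2 * (- (t\<^sup>2 * m\<^sup>2))"
      unfolding l2norm_add_sq[OF Tf(2) l2_cmult[OF f(1)]] ip h ..
    also have "\<dots> \<le> (t * m)\<^sup>2 + (t\<^sup>2)\<^sup>2 + 2 * (- (t\<^sup>2 * m\<^sup>2))"
      using bound[OF Tf(1)] by (intro add_right_mono power_mono) (auto simp: m_def)
    also have "\<dots> = t\<^sup>2 * ((t - m) * (t + m))"
      by (simp add: power2_eq_square algebra_simps)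
    also have "\<dots> \<le> t\<^sup>2 * (eps * (2 * t))"
      using m f(3) t0 by (intro mult_left_mono mult_mono) (auto simp: m_def)
    finally have "(l2norm S (\<lambda>p. T (T f) p - of_real (t\<^sup>2) * f p))\<^sup>2 \<le> t\<^sup>2 * (eps * (2 * t))" .
    then have "B\<^sup>2 * (l2norm S (\<lambda>p. T (T f) p - of_real (t\<^sup>2) * f p))\<^sup>2 \<le> B\<^sup>2 * (t\<^sup>2 * (eps * (2 * t)))"
      by (intro mult_left_mono) auto
    also have "\<dots> = 1 / 2"
      using B t0 by (simp add: eps_def power2_eq_square power3_eq_cube)
    finally have "(B * l2norm S (\<lambda>p. T (T f) p - of_real (t\<^sup>2) * f p))\<^sup>2 \<le> 1 / 2"
      by (simp add: power_mult_distrib)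
    moreover have "1 \<le> (B * l2norm S (\<lambda>p. T (T f) p - of_real (t\<^sup>2) * f p))\<^sup>2"
      using low[OF f(1)] f(2) by (simp add: one_le_power)
    ultimately show False by linarith
  qed
  then show thesis using that t0 bound by blast
qed

text \<open>The spectral point at distance 1 / t shows that the spectrum is nonempty and bounds the
  norm t by the inverse distance; openness keeps the distance positive. Nonemptiness matters because
  \<open>infdist\<close> to the empty set is 0.\<close>

lemma resolvent_norm_dist:
  fixes lam :: real
  defines "spec \<equiv> {lam. \<not> in_resolvent_set W S (of_real lam)}"
  assumes lam: "lam \<notin> spec" and S: "S \<noteq> {}"
  obtains T where "0 < infdist lam spec" "is_resolvent (of_real lam) (1 / infdist lam spec) T"
proof -
  obtain C T where T: "is_resolvent (of_real lam) C T"
    using lam in_resolvent_set_iff by (auto simp: spec_def)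
  obtain t where t: "0 < t" "\<And>f. f \<in> l2 S \<Longrightarrow> l2norm S (T f) \<le> t * l2norm S f"
    "\<not> in_resolvent_set W S (of_real (lam + 1 / t)) \<or> \<not> in_resolvent_set W S (of_real (lam - 1 / t))"
    using resolvent_norm_attained[OF T S] by blast
  define d where "d = infdist lam spec"
  have "lam + 1 / t \<in> spec \<or> lam - 1 / t \<in> spec"
    using t(3) unfolding spec_def mem_Collect_eq .
  moreover have "dist lam (lam + 1 / t) = 1 / t" "dist lam (lam - 1 / t) = 1 / t"
    using t(1) by (simp_all add: dist_real_def)
  ultimately obtain mu where mu: "mu \<in> spec" "dist lam mu = 1 / t" by blast
  have d_le: "d \<le> 1 / t" unfolding d_def using infdist_le[OF mu(1), of lam] mu(2) by simp
  have C: "0 < C" using resolvent_pos[OF T] .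
  have "1 / C \<le> dist lam nu" if "nu \<in> spec" for nu
  proof (rule ccontr)
    assume "\<not> 1 / C \<le> dist lam nu"
    then have "C * \<bar>nu - lam\<bar> < 1" using C by (simp add: dist_real_def field_simps abs_minus_commute)
    then have "C * cmod (of_real nu - of_real lam) < 1" by (simp flip: of_real_diff)
    then show False using resolvent_set_open[OF T, of "of_real nu"] that by (simp add: spec_def)
  qed
  then have "1 / C \<le> d"
    unfolding d_def using mu(1) by (subst infdist_notempty) (auto intro!: cINF_greatest)
  then have d: "0 < d" using C by (meson less_le_trans zero_less_divide_1_iff)
  have "t \<le> 1 / d" using d_le d t(1) by (simp add: field_simps)
  then have "l2norm S (T f) \<le> 1 / d * l2norm S f" if "f \<in> l2 S" for f
    using t(2)[OF that] mult_right_mono[of t "1 / d" "l2norm S f"] by simp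
  then have "is_resolvent (of_real lam) (1 / d) T"
    using T d unfolding is_resolvent_def by auto
  then show thesis using that d by (simp add: d_def)
qed

end

text \<open>The bijection induces the isometry \<open>push\<close>, with inverse
  \<open>pull\<close>, and it intertwines the two operators.\<close>

lemma in_resolvent_set_transport:
  assumes S: "tree_op W S D w" and S': "tree_op W S' D' w'" and bij: "bij_betw h S S'"
    and adj: "\<And>p q. p \<in> S \<Longrightarrow> q \<in> S \<Longrightarrow> tadj (h p) (h q) \<longleftrightarrow> tadj p q"
    and last: "\<And>p. p \<in> S \<Longrightarrow> last (h p) = last p"
    and res: "in_resolvent_set W S z"
  shows "in_resolvent_set W S' z"
proof -
  interpret A: tree_op W S D w by fact
  interpret B: tree_op W S' D' w' by fact
  define k where "k = inv_into S h"
  have inj: "inj_on h S" and img: "h ` S = S'" using bij by (auto simp: bij_betw_def)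
  have kS: "k q \<in> S" "h (k q) = q" if "q \<in> S'" for q
    using that img by (auto simp: k_def inv_into_into f_inv_into_f)
  have kh: "k (h p) = p" if "p \<in> S" for p using that inj by (simp add: k_def)
  have injk: "inj_on k S'" and imgk: "k ` S' = S" 
    using bij_betw_inv_into[OF bij] by (simp_all add: bij_betw_def k_def)
  define push where "push f q = (if q \<in> S' then f (k q) else (0::complex))" for f q
  define pull where "pull g p = (if p \<in> S then g (h p) else (0::complex))" for g p
  have push: "push f \<in> l2 S'" "l2norm S' (push f) = l2norm S f" if "f \<in> l2 S" for f
    by (rule l2_inj_image[OF that inj, of S' "push f"]; use img kh in \<open>auto simp: push_def\<close>)+
  have pull: "pull g \<in> l2 S" if "g \<in> l2 S'" for g
    by (rule l2_inj_image(1)[OF that injk, of S "pull g"]; use imgk kS in \<open>auto simp: pull_def\<close>)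
  have push_pull: "push (pull g) = g" if "g \<in> l2 S'" for g
    using kS l2_outside[OF that] by (auto simp: push_def pull_def fun_eq_iff)
  have shifted_push: "shifted W S' z (push f) = push (shifted W S z f)" for f
  proof
    fix q show "shifted W S' z (push f) q = push (shifted W S z f) q"
    proof (cases "q \<in> S'")
      case False
      then show ?thesis by (simp add: shifted_def push_def schr_outside)
    next
      case True
      define p where "p = k q"
      have p: "p \<in> S" "q = h p" using kS[OF True] by (auto simp: p_def)
      have "{q' \<in> S'. tadj q q'} = h ` {p' \<in> S. tadj p p'}"
        using adj[OF p(1)] img p(2) by auto
      then have "(\<Sum>q'\<in>{q' \<in> S'. tadj q q'}. push f q') = (\<Sum>p'\<in>{p' \<in> S. tadj p p'}. push f (h p'))"
        using inj by (simp add: sum.reindex inj_on_subset[of h S])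
      also have "\<dots> = (\<Sum>p'\<in>{p' \<in> S. tadj p p'}. f p')"
        using img kh by (intro sum.cong) (auto simp: push_def)
      finally show ?thesis
        using True p last[OF p(1)] kh[OF p(1)] by (simp add: shifted_def schr_def push_def)
    qed
  qed
  obtain C T where T: "A.is_resolvent z C T" using res A.in_resolvent_set_iff by blast
  show ?thesis
  proof (rule B.in_resolvent_setI)
    fix g assume g: "g \<in> l2 S'"
    have "l2norm S' (push (pull g)) \<le> C * l2norm S' (shifted W S' z (push (pull g)))"
      unfolding shifted_push push(2)[OF pull[OF g]] push(2)[OF A.shifted_l2[OF pull[OF g]]]
      by (rule A.resolvent_lower[OF T pull[OF g]])
    then show "l2norm S' g \<le> C * l2norm S' (shifted W S' z g)" unfolding push_pull[OF g] .
    have "shifted W S' z (push (T (pull g))) = g"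
      unfolding shifted_push A.resolvent_right[OF T pull[OF g]] push_pull[OF g] ..
    then show "\<exists>u\<in>l2 S'. shifted W S' z u = g" using push(1) A.resolvent_l2[OF T pull[OF g]] by blast
  qed
qed

section \<open>Changing the root of the universal cover\<close>

text \<open>Isomorphism between the covers rooted at adjacent vertices: put the edge from r' in
  front of the walk and cancel the backtracking r', r, r' if it arises.\<close>

definition reroot :: "'a \<Rightarrow> 'a list \<Rightarrow> 'a list" where
  "reroot r' p = (if hd (tl p) = r' \<and> tl p \<noteq> [] then tl p else r' # p)"

context graph
begin

lemma cover_verts_iff: "p \<in> cover_verts V E r \<longleftrightarrow> nb_walk V E p \<and> (\<exists>q. p = r # q)"
  by (cases p) (auto simp: cover_verts_def nb_walk_iff)

lemma reroot_props:
  assumes E: "E r r'" and p: "p \<in> cover_verts V E r"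
  shows "reroot r' p \<in> cover_verts V E r'" "reroot r (reroot r' p) = p" "last (reroot r' p) = last p"
proof -
  obtain q where q: "p = r # q" "nb_walk V E (r # q)" using p by (auto simp: cover_verts_iff)
  have r: "r \<in> V" "r' \<in> V" "E r' r" using E edge_V sym by auto
  show "reroot r' p \<in> cover_verts V E r'" "reroot r (reroot r' p) = p" "last (reroot r' p) = last p"
    using q r E by (cases q; cases "tl q"; auto simp: reroot_def cover_verts_iff nb_walk_iff nbl_Cons_Cons)+
qed

lemma reroot_adj:
  assumes E: "E r r'" and p: "p \<in> cover_verts V E r" and q: "q \<in> cover_verts V E r" and adj: "tadj p q"
  shows "tadj (reroot r' p) (reroot r' q)"
proof -
  have child: "tadj (reroot r' p) (reroot r' (p @ [z]))" if cov: "p \<in> cover_verts V E r" for p z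
  proof -
    obtain q where "p = r # q" using cov by (auto simp: cover_verts_iff)
    then show ?thesis by (cases q) (auto simp: reroot_def tadj_def)
  qed
  from adj consider z where "q = p @ [z]" | z where "p = q @ [z]" by (auto simp: tadj_def)
  then show ?thesis
    using child[OF p] child[OF q] by cases (auto simp: tadj_sym)
qed

lemma cover_tree_op: "tree_op W (cover_verts V E r) (max_deg V E) (W_norm W)"
  by (rule tree_op_nb_walks) (auto simp: cover_verts_def)

lemma in_resolvent_set_reroot:
  assumes E: "E r r'" and res: "in_resolvent_set W (cover_verts V E r) z"
  shows "in_resolvent_set W (cover_verts V E r') z"
proof (rule in_resolvent_set_transport[OF cover_tree_op cover_tree_op _ _ _ res])
  show "bij_betw (reroot r') (cover_verts V E r) (cover_verts V E r')"
    using reroot_props[OF E] reroot_props[OF sym[OF E]]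
    by (intro bij_betw_byWitness[of _ "reroot r"]) auto
  fix p q assume p: "p \<in> cover_verts V E r" and q: "q \<in> cover_verts V E r"
  show "tadj (reroot r' p) (reroot r' q) \<longleftrightarrow> tadj p q"
    using reroot_adj[OF E p q] reroot_adj[OF sym[OF E] reroot_props(1)[OF E p] reroot_props(1)[OF E q]]
      reroot_props(2)[OF E p] reroot_props(2)[OF E q] by auto
  show "last (reroot r' p) = last p" by (rule reroot_props(3)[OF E p])
qed

text \<open>The spectrum is defined at an arbitrarily chosen root. Moving the root edge by edge
  along a path brings it to the vertex x at which psi is to be estimated.\<close>

lemma cover_spectrum_root:
  assumes x: "x \<in> V"
  shows "cover_spectrum V E W = {lam. \<not> in_resolvent_set W (cover_verts V E x) (of_real lam)}"
proof -
  let ?R = "\<lambda>a b. E a b \<and> a \<in> V \<and> b \<in> V"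
  have "cover_root V \<in> V" unfolding cover_root_def using x by (rule someI)
  then have "?R\<^sup>*\<^sup>* (cover_root V) x" "?R\<^sup>*\<^sup>* x (cover_root V)"
    using connected x by (auto simp: g_connected_def)
  moreover have "in_resolvent_set W (cover_verts V E a) z \<Longrightarrow> in_resolvent_set W (cover_verts V E b) z"
    if "?R\<^sup>*\<^sup>* a b" for a b z
    using that by (induction rule: rtranclp_induct) (auto intro: in_resolvent_set_reroot)
  ultimately show ?thesis unfolding cover_spectrum_def by blast
qed

section \<open>Eigenfunctions outside the spectrum of the cover\<close>

text \<open>Lists of length \<open>Suc (ell_G V E)\<close> are walks of \<open>ell_G\<close> steps,
  the longest guaranteed to stay in the ball, so \<open>card_nbl_le_3\<close> applies to each end
  vertex.\<close>

lemma sum_sphere_le: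
  assumes x: "x \<in> V" and h: "\<And>v. v \<in> V \<Longrightarrow> 0 \<le> h v"
  shows "(\<Sum>p\<in>{p \<in> cover_verts V E x. length p = Suc (ell_G V E)}. h (last p)) \<le> 3 * (\<Sum>v\<in>V. h v :: real)"
proof -
  let ?B = "ball_G V E x (ell_G V E)"
  let ?L = "{p \<in> cover_verts V E x. length p = Suc (ell_G V E)}"
  obtain a b where "almost_acyclic E ?B a b"
    using almost_acyclicI[of E ?B] sym irrefl ell_G_spec[OF x] by blast
  then interpret A: almost_acyclic E ?B a b .
  have finB: "finite ?B" using ball_subset finite_V by (rule finite_subset)
  have finL: "finite ?L"
    by (rule finite_subset[OF _ finite_lists_length_eq[OF finite_V, of "Suc (ell_G V E)"]])
      (auto simp: cover_verts_def nb_walk_iff)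
  have card: "card {p \<in> ?L. last p = v} \<le> 3" for v
  proof -
    let ?P = "{p. nbl E p \<and> set p \<subseteq> ?B \<and> p \<noteq> [] \<and> hd p = x \<and> last p = v \<and> length p = Suc (ell_G V E)}"
    have "?P \<subseteq> {p. set p \<subseteq> ?B \<and> length p = Suc (ell_G V E)}" by auto
    then have "finite ?P" using finite_lists_length_eq[OF finB] by (rule finite_subset)
    moreover have "{p \<in> ?L. last p = v} \<subseteq> ?P"
    proof
      fix p assume p: "p \<in> {p \<in> ?L. last p = v}"
      then have "set p \<subseteq> ?B"
        using walk_subset_ball[of p "ell_G V E"] by (auto simp: cover_verts_def nb_walk_def)
      then show "p \<in> ?P" using p by (simp add: cover_verts_def nb_walk_iff)
    qed
    ultimately show ?thesis by (rule order_trans[OF card_mono A.card_nbl_le_3[OF finB]])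
  qed
  have "(\<Sum>p\<in>?L. h (last p)) = (\<Sum>v\<in>V. \<Sum>p\<in>{p \<in> ?L. last p = v}. h (last p))"
    using finL finite_V by (intro sum.group[symmetric]) (auto simp: cover_verts_def nb_walk_last)
  also have "\<dots> = (\<Sum>v\<in>V. card {p \<in> ?L. last p = v} * h v)"
    by (intro sum.cong) auto
  also have "\<dots> \<le> (\<Sum>v\<in>V. 3 * h v)"
    using card h by (intro sum_mono mult_right_mono) auto
  finally show ?thesis by (simp add: sum_distrib_left)
qed

text \<open>Combes--Thomas estimate: conjugation by \<open>\<kappa>\<^bsup>depth\<^esup>\<close> perturbs \<open>H\<close> by at most \<open>\<delta> / 2\<close>. The weight
is truncated at depth \<open>n\<close> to keep the weighted function square summable a priori.\<close>

lemma combes_thomas: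
  fixes n :: nat and d :: real
  assumes T: "tree_op.is_resolvent W (cover_verts V E x) (of_real lam) (1 / d) T" and x: "x \<in> V" and d: "0 < d"
  defines "kap \<equiv> 1 + d / (2 * real (max_deg V E))"
  shows "l2norm (cover_verts V E x) (\<lambda>p. of_real (kap ^ min (length p - 1) n) * T (delta_at [x]) p) \<le> 2 / d"
    and "(\<lambda>p. of_real (kap ^ min (length p - 1) n) * T (delta_at [x]) p) \<in> l2 (cover_verts V E x)"
proof -
  let ?S = "cover_verts V E x" and ?z = "complex_of_real lam"
  interpret S: tree_op W ?S "max_deg V E" "W_norm W" by (rule cover_tree_op)
  define D where "D = real (max_deg V E)"
  have D: "0 < D" using deg_ge_2[OF x] deg_le_max_deg[OF x] by (simp add: D_def)
  \<comment> \<open>A perturbation of half the gap d is what degrades the resolvent bound from 1 / d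
    only to 2 / d.\<close>
  have kap: "1 \<le> kap" "(kap - 1) * D = d / 2" using d D by (auto simp: kap_def D_def[symmetric])
  define m where "m p = kap ^ min (length p - 1) n" for p :: "'a list"
  define u where "u = T (delta_at [x])"
  define f where "f p = of_real (m p) * u p" for p
  have m: "0 < m p" "m p \<le> kap ^ n" for p
    using kap by (auto simp: m_def intro!: power_increasing)
  have root: "[x] \<in> ?S" using x by (simp add: cover_verts_def nb_walk_iff)
  have delta: "delta_at [x] \<in> l2 ?S" using l2_delta_at[OF root] .
  have u: "u \<in> l2 ?S" "shifted W ?S ?z u = delta_at [x]"
    using S.resolvent_l2[OF T delta] S.resolvent_right[OF T delta] by (auto simp: u_def)
  have "cmod (f p) \<le> kap ^ n * cmod (u p)" for p
    using m[of p] by (simp add: f_def norm_mult mult_right_mono)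
  then have f: "f \<in> l2 ?S" using l2_dominated(1)[OF u(1), of f "kap ^ n"] kap by simp
  \<comment> \<open>The commutator of the weight with the adjacency operator, expressed through f: k
    p q * f q = f q - m p * u q.\<close>
  define k where "k p q = complex_of_real (1 - m p / m q)" for p q
  have k: "cmod (k p q) \<le> kap - 1" if "p \<in> ?S" "q \<in> S.nbr p" for p q
  proof -
    have len: "length q = Suc (length p) \<or> length p = Suc (length q)" "0 < length p" "0 < length q"
      using that by (auto simp: tadj_def cover_verts_iff)
    have "m q = m p \<or> m q = kap * m p \<or> m p = kap * m q"
    proof (cases "length q = Suc (length p)")
      case True
      then have "length q - 1 = Suc (length p - 1)" using len by simp
      then show ?thesis unfolding m_def by (cases "length p - 1 < n") (auto simp: min_def)
    next
      case False
      then have "length p - 1 = Suc (length q - 1)" using len by simp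
      then show ?thesis unfolding m_def by (cases "length q - 1 < n") (auto simp: min_def)
    qed
    then have "m p / m q = 1 \<or> m p / m q = 1 / kap \<or> m p / m q = kap" using m[of p] m[of q] by auto
    moreover have "\<bar>1 - 1 / kap\<bar> \<le> kap - 1"
    proof -
      have "1 - 1 / kap = (kap - 1) / kap" using kap by (simp add: field_simps)
      also have "\<dots> \<le> (kap - 1) / 1" using kap by (intro divide_left_mono) auto
      finally show ?thesis using kap by (simp add: field_simps abs_if)
    qed
    ultimately have "\<bar>1 - m p / m q\<bar> \<le> kap - 1" using kap by auto
    then show ?thesis unfolding k_def norm_of_real .
  qed
  let ?b = "\<lambda>p. if p \<in> ?S then \<Sum>q\<in>S.nbr p. k p q * f q else 0"
  have b: "?b \<in> l2 ?S" "l2norm ?S ?b \<le> (kap - 1) * max_deg V E * l2norm ?S f"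
    using S.l2_band[OF f k] S.l2norm_band[OF f k] kap by auto
  have "shifted W ?S ?z f = (\<lambda>p. delta_at [x] p + ?b p)"
  proof
    fix p show "shifted W ?S ?z f p = delta_at [x] p + ?b p"
    proof (cases "p \<in> ?S")
      case False
      then show ?thesis using root l2_outside[OF f] by (auto simp: shifted_def schr_outside delta_at_def)
    next
      case True
      have "k p q * f q = f q - of_real (m p) * u q" for q
        using m[of q] by (simp add: k_def f_def field_simps)
      then have bp: "?b p = (\<Sum>q\<in>S.nbr p. f q) - of_real (m p) * (\<Sum>q\<in>S.nbr p. u q)"
        using True by (simp add: sum_subtractf sum_distrib_left)
      have up: "(\<Sum>q\<in>S.nbr p. u q) + of_real (W (last p)) * u p - ?z * u p = delta_at [x] p"
        using fun_cong[OF u(2), of p] True by (simp add: shifted_def schr_def)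
      have "shifted W ?S ?z f p = (\<Sum>q\<in>S.nbr p. f q) + of_real (W (last p)) * f p - ?z * f p"
        using True by (simp add: shifted_def schr_def)
      also have "\<dots> = ?b p + of_real (m p) * ((\<Sum>q\<in>S.nbr p. u q) + of_real (W (last p)) * u p - ?z * u p)"
        unfolding bp by (simp add: f_def[of p] algebra_simps)
      \<comment> \<open>The source sits at the root, where the weight is 1, so weighting leaves it
        unchanged.\<close>
      also have "of_real (m p) * ((\<Sum>q\<in>S.nbr p. u q) + of_real (W (last p)) * u p - ?z * u p) = delta_at [x] p"
        unfolding up by (auto simp: delta_at_def m_def)
      finally show ?thesis by simp
    qed
  qed
  then have "l2norm ?S f \<le> 1 / d * l2norm ?S (\<lambda>p. delta_at [x] p + ?b p)"
    using S.resolvent_lower[OF T f] by simp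
  also have "\<dots> \<le> 1 / d * (1 + d / 2 * l2norm ?S f)"
    using l2norm_triangle[OF delta b(1)] b(2) d kap(2) unfolding l2norm_delta_at[OF root] D_def
    by (intro mult_left_mono) auto
  also have "\<dots> = 1 / d + l2norm ?S f / 2" using d by (simp add: field_simps)
  \<comment> \<open>The norm of f is finite thanks to the truncated weight, so half of it can be
    absorbed on the left.\<close>
  finally have "l2norm ?S f \<le> 2 / d" by (simp add: field_simps)
  moreover have "(\<lambda>p. of_real (kap ^ min (length p - 1) n) * T (delta_at [x]) p) = f"
    by (simp add: f_def m_def u_def fun_eq_iff)
  ultimately show "l2norm ?S (\<lambda>p. of_real (kap ^ min (length p - 1) n) * T (delta_at [x]) p) \<le> 2 / d"
    "(\<lambda>p. of_real (kap ^ min (length p - 1) n) * T (delta_at [x]) p) \<in> l2 ?S"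
    using f by simp_all
qed

end

section \<open>Pairing the resolvent with the cut-off lift of psi\<close>

context graph
begin

lemma outside_bound:
  assumes lam: "lam \<notin> cover_spectrum V E W"
    and eigen: "\<And>v. v \<in> V \<Longrightarrow> (\<Sum>w\<in>{w \<in> V. E v w}. psi w) + of_real (W v) * psi v = of_real lam * psi v"
    and normed: "(\<Sum>v\<in>V. (cmod (psi v))\<^sup>2) = 1" and x: "x \<in> V"
  defines "d \<equiv> infdist lam (cover_spectrum V E W)"
  shows "cmod (psi x) \<le> 8 * real (max_deg V E) / d / (1 + d / (2 * real (max_deg V E))) ^ ell_G V E"
proof -
  let ?S = "cover_verts V E x" and ?z = "complex_of_real lam"
  interpret S: tree_op W ?S "max_deg V E" "W_norm W" by (rule cover_tree_op)
  define l where "l = ell_G V E"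
  define D where "D = real (max_deg V E)"
  define kap where "kap = 1 + d / (2 * D)"
  have D1: "1 \<le> D" using deg_ge_2[OF x] deg_le_max_deg[OF x] by (simp add: D_def)
  have root: "[x] \<in> ?S" using x by (simp add: cover_verts_def nb_walk_iff)
  have spec: "cover_spectrum V E W = {lam. \<not> in_resolvent_set W ?S (of_real lam)}"
    by (rule cover_spectrum_root[OF x])
  have "lam \<notin> {lam. \<not> in_resolvent_set W ?S (of_real lam)}" "?S \<noteq> {}" using lam spec root by auto
  then obtain T where d: "0 < d" and T: "S.is_resolvent ?z (1 / d) T"
    unfolding d_def spec by (rule S.resolvent_norm_dist)
  have kap: "1 \<le> kap" using d D1 by (simp add: kap_def)
  define u where "u = T (delta_at [x])"
  have delta: "delta_at [x] \<in> l2 ?S" using l2_delta_at[OF root] .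
  have u: "u \<in> l2 ?S" "shifted W ?S ?z u = delta_at [x]"
    using S.resolvent_l2[OF T delta] S.resolvent_right[OF T delta] by (auto simp: u_def)
  \<comment> \<open>List length minus one is the depth; truncating the weight at depth l + 1 leaves
    it untruncated on both boundary layers.\<close>
  define f where "f p = of_real (kap ^ min (length p - 1) (Suc l)) * u p" for p :: "'a list"
  have f: "f \<in> l2 ?S" "l2norm ?S f \<le> 2 / d"
    using combes_thomas[OF T x d, of "Suc l"] unfolding f_def u_def kap_def D_def by auto
  have level: "L2_set (\<lambda>p. cmod (u p)) A \<le> 2 / d / kap ^ l"
    if A: "finite A" "\<And>p. p \<in> A \<Longrightarrow> length p = Suc l \<or> length p = Suc (Suc l)" for A
  proof -
    have "kap ^ l * L2_set (\<lambda>p. cmod (u p)) A = L2_set (\<lambda>p. kap ^ l * cmod (u p)) A"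
      using kap by (intro L2_set_right_distrib) auto
    also have "\<dots> \<le> L2_set (\<lambda>p. cmod (f p)) A"
    proof (rule L2_set_mono)
      fix p assume "p \<in> A"
      then have "l \<le> min (length p - 1) (Suc l)" using A(2) by fastforce
      then have "kap ^ l \<le> kap ^ min (length p - 1) (Suc l)" using kap by (rule power_increasing)
      then have "kap ^ l * cmod (u p) \<le> kap ^ min (length p - 1) (Suc l) * cmod (u p)"
        by (rule mult_right_mono) simp
      also have "\<dots> = cmod (f p)" using kap by (simp only: f_def norm_mult norm_of_real) simp
      finally show "kap ^ l * cmod (u p) \<le> cmod (f p)" .
    qed (use kap in auto)
    also have "\<dots> \<le> 2 / d" using L2_set_le_l2norm[OF f(1) A(1)] f(2) by linarith
    finally have "L2_set (\<lambda>p. cmod (u p)) A * kap ^ l \<le> 2 / d" by (simp add: mult.commute)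
    moreover have "0 < kap ^ l" using kap by simp
    ultimately show ?thesis by (simp only: pos_le_divide_eq)
  qed
  \<comment> \<open>Lift of psi along the covering map, cut off beyond depth l. Applying H - lam
    leaves only depth l (\<open>L1\<close>), where children are missing, and depth l + 1
    (\<open>L2\<close>), where the parent is still seen.\<close>
  define phi where "phi p = (if p \<in> ?S \<and> length p \<le> Suc l then psi (last p) else 0)" for p
  define phi1 where "phi1 p = (if p \<in> ?S \<and> length p = Suc l then psi (last p) else 0)" for p
  define L1 where "L1 = {p \<in> ?S. length p = Suc l}"
  define L2 where "L2 = {p \<in> ?S. length p = Suc (Suc l)}"
  have fin: "finite {p \<in> ?S. length p \<le> n}" for n
    by (rule finite_subset[OF _ finite_lists_length_le[OF finite_V, of n]])
      (auto simp: cover_verts_def nb_walk_iff)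
  have finL: "finite L1" "finite L2"
    unfolding L1_def L2_def by (rule finite_subset[OF _ fin[of "Suc (Suc l)"]]; auto)+
  have phi: "phi \<in> l2 ?S" by (rule l2_finite_support[OF fin[of "Suc l"]]) (auto simp: phi_def)
  have phi1: "phi1 \<in> l2 ?S" by (rule l2_finite_support[OF finL(1)]) (auto simp: phi1_def L1_def)
  define g where "g = shifted W ?S ?z phi"
  have nbr_sum: "(\<Sum>q\<in>S.nbr p. h (last q)) = (\<Sum>v\<in>{v \<in> V. E (last p) v}. h v)" if "p \<in> ?S" for p and h :: "'a \<Rightarrow> 'b::comm_monoid_add"
    using sum.reindex_bij_betw[OF bij_betw_last_cover[OF that], of h] .
  have nbr_len: "length q \<le> Suc (length p)" "length p \<le> Suc (length q)" if "q \<in> S.nbr p" for p q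
    using that by (auto simp: tadj_def)
  \<comment> \<open>The lifted eigenvalue equation holds because the covering map is bijective on
    neighbours; only the neighbours that were cut away remain.\<close>
  have inner: "g p = - (\<Sum>q\<in>S.nbr p. psi (last q) - phi q)" if p: "p \<in> ?S" "length p \<le> Suc l" for p
  proof -
    have "last p \<in> V" using p(1) nb_walk_last by (simp add: cover_verts_def)
    then have ev: "(\<Sum>q\<in>S.nbr p. psi (last q)) + of_real (W (last p)) * psi (last p) = ?z * psi (last p)"
      unfolding nbr_sum[OF p(1)] by (rule eigen)
    have "g p = (\<Sum>q\<in>S.nbr p. phi q) + of_real (W (last p)) * psi (last p) - ?z * psi (last p)"
      using p by (simp add: g_def shifted_def schr_def phi_def)
    then show ?thesis unfolding ev[symmetric] by (simp add: sum_subtractf)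
  qed
  have g_small: "g p = 0" if p: "p \<in> ?S" "length p \<le> l" for p
  proof -
    have "phi q = psi (last q)" if "q \<in> S.nbr p" for q
      using that nbr_len(1)[OF that] p(2) by (simp add: phi_def)
    then show ?thesis using inner[of p] p by simp
  qed
  have g_L1: "(cmod (g p))\<^sup>2 \<le> D * (\<Sum>v\<in>{v \<in> V. E (last p) v}. (cmod (psi v))\<^sup>2)" if p: "p \<in> L1" for p
  proof -
    have pS: "p \<in> ?S" "length p \<le> Suc l" using p by (auto simp: L1_def)
    have "cmod (g p) \<le> (\<Sum>q\<in>S.nbr p. cmod (psi (last q)))"
      unfolding inner[OF pS] norm_minus_cancel by (intro sum_norm_le) (auto simp: phi_def)
    also have "\<dots> = (\<Sum>v\<in>{v \<in> V. E (last p) v}. cmod (psi v))" by (rule nbr_sum[OF pS(1)])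
    finally have "(cmod (g p))\<^sup>2 \<le> (\<Sum>v\<in>{v \<in> V. E (last p) v}. cmod (psi v))\<^sup>2"
      by (intro power_mono) auto
    also have "\<dots> \<le> real (card {v \<in> V. E (last p) v}) * (\<Sum>v\<in>{v \<in> V. E (last p) v}. (cmod (psi v))\<^sup>2)"
      by (rule sum_sq_le_card)
    also have "\<dots> \<le> D * (\<Sum>v\<in>{v \<in> V. E (last p) v}. (cmod (psi v))\<^sup>2)"
      using deg_le_max_deg[of "last p"] nb_walk_last[of p] pS(1)
      by (intro mult_right_mono sum_nonneg) (auto simp: deg_def D_def cover_verts_def)
    finally show ?thesis .
  qed
  have "(\<Sum>p\<in>L1. (cmod (g p))\<^sup>2) \<le> (\<Sum>p\<in>L1. D * (\<Sum>v\<in>{v \<in> V. E (last p) v}. (cmod (psi v))\<^sup>2))"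
    by (rule sum_mono[OF g_L1])
  also have "\<dots> \<le> 3 * (\<Sum>w\<in>V. D * (\<Sum>v\<in>{v \<in> V. E w v}. (cmod (psi v))\<^sup>2))"
    unfolding L1_def l_def using D1 by (intro sum_sphere_le x mult_nonneg_nonneg sum_nonneg) auto
  also have "\<dots> = 3 * D * (\<Sum>w\<in>V. \<Sum>v\<in>{v \<in> V. E w v}. (cmod (psi v))\<^sup>2)"
    by (simp add: sum_distrib_left mult.assoc)
  also have "(\<Sum>w\<in>V. \<Sum>v\<in>{v \<in> V. E w v}. (cmod (psi v))\<^sup>2) = (\<Sum>v\<in>V. \<Sum>w\<in>{w \<in> V. E w v}. (cmod (psi v))\<^sup>2)"
    by (rule sum.swap_restrict[OF finite_V finite_V])
  also have "\<dots> \<le> (\<Sum>v\<in>V. D * (cmod (psi v))\<^sup>2)"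
  proof (rule sum_mono)
    fix v assume v: "v \<in> V"
    have "{w \<in> V. E w v} = {w \<in> V. E v w}" using sym by blast
    then show "(\<Sum>w\<in>{w \<in> V. E w v}. (cmod (psi v))\<^sup>2) \<le> D * (cmod (psi v))\<^sup>2"
      using deg_le_max_deg[OF v] by (auto simp: deg_def D_def intro!: mult_right_mono)
  qed
  also have "\<dots> = D" using normed by (simp flip: sum_distrib_left)
  finally have "(\<Sum>p\<in>L1. (cmod (g p))\<^sup>2) \<le> 3 * D * D" using D1 by simp
  \<comment> \<open>The factor 3 from the sphere count is rounded up to 4 to have a simple square
    root; the same happens for \<open>phi1\<close> below.\<close>
  also have "\<dots> \<le> (2 * D)\<^sup>2" by (simp add: power2_eq_square)
  finally have gL1: "L2_set (\<lambda>p. cmod (g p)) L1 \<le> 2 * D"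
    unfolding L2_set_def using D1 by (intro real_le_lsqrt) (auto intro: sum_nonneg)
  let ?b = "\<lambda>p. if p \<in> ?S then \<Sum>q\<in>S.nbr p. 1 * phi1 q else 0"
  have b: "?b \<in> l2 ?S" "l2norm ?S ?b \<le> 1 * D * l2norm ?S phi1"
    using S.l2_band[OF phi1, of "\<lambda>_ _. 1" 1] S.l2norm_band[OF phi1, of "\<lambda>_ _. 1" 1] by (auto simp: D_def)
  \<comment> \<open>At depth l + 1 the function phi vanishes and is seen only through the layer at
    depth l, so g is the adjacency operator, of norm at most D, applied to
    \<open>phi1\<close>.\<close>
  have "g p = ?b p" if p: "p \<in> L2" for p
  proof -
    have "phi q = phi1 q" if "q \<in> S.nbr p" for q
      using that nbr_len(2)[OF that] p by (auto simp: phi_def phi1_def L2_def)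
    then have "(\<Sum>q\<in>S.nbr p. phi q) = (\<Sum>q\<in>S.nbr p. phi1 q)" by (rule sum.cong[OF refl])
    then show ?thesis using p by (simp add: g_def shifted_def schr_def L2_def phi_def[of p])
  qed
  then have "L2_set (\<lambda>p. cmod (g p)) L2 = L2_set (\<lambda>p. cmod (?b p)) L2" by (intro L2_set_cong) auto
  also have "\<dots> \<le> D * l2norm ?S phi1" using L2_set_le_l2norm[OF b(1) finL(2)] b(2) by simp
  also have "\<dots> \<le> D * 2"
  proof (rule mult_left_mono)
    show "l2norm ?S phi1 \<le> 2"
    proof (rule l2norm_le)
      fix A :: "'a list set" assume A: "finite A"
      have "(\<Sum>p\<in>A. (cmod (phi1 p))\<^sup>2) = (\<Sum>p\<in>A \<inter> L1. (cmod (psi (last p)))\<^sup>2)"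
        using A by (intro sum.mono_neutral_cong_right) (auto simp: phi1_def L1_def)
      also have "\<dots> \<le> (\<Sum>p\<in>L1. (cmod (psi (last p)))\<^sup>2)" using finL by (intro sum_mono2) auto
      also have "\<dots> \<le> 3 * (\<Sum>v\<in>V. (cmod (psi v))\<^sup>2)"
        unfolding L1_def l_def by (intro sum_sphere_le x) auto
      finally show "L2_set (\<lambda>p. cmod (phi1 p)) A \<le> 2"
        unfolding L2_set_def normed by (intro real_le_lsqrt) (auto intro: sum_nonneg)
    qed (simp add: phi1_def)
  qed (use D1 in simp)
  finally have gL2: "L2_set (\<lambda>p. cmod (g p)) L2 \<le> 2 * D" by simp
  have g_large: "g p = 0" if p: "p \<in> ?S" "Suc (Suc l) < length p" for p
  proof -
    have "phi q = 0" if "q \<in> S.nbr p" for q using nbr_len(2)[OF that] p(2) by (simp add: phi_def)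
    then show ?thesis using p by (simp add: g_def shifted_def schr_def phi_def[of p])
  qed
  have g0: "g p * cnj (u p) = 0" if "p \<in> ?S - (L1 \<union> L2)" for p
    using that g_small[of p] g_large[of p] by (cases "length p \<le> l") (auto simp: L1_def L2_def)
  have "l2ip ?S g u = infsum (\<lambda>p. g p * cnj (u p)) (L1 \<union> L2)"
    unfolding l2ip_def using g0 by (intro infsum_cong_neutral) (auto simp: L1_def L2_def)
  also have "\<dots> = (\<Sum>p\<in>L1. g p * cnj (u p)) + (\<Sum>p\<in>L2. g p * cnj (u p))"
    using finL by (subst infsum_finite) (auto intro!: sum.union_disjoint simp: L1_def L2_def)
  finally have ip: "l2ip ?S g u = (\<Sum>p\<in>L1. g p * cnj (u p)) + (\<Sum>p\<in>L2. g p * cnj (u p))" .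
  \<comment> \<open>Moving H - lam onto u produces the point mass at the root, so the pairing
    evaluates to psi x.\<close>
  have "l2ip ?S g u = l2ip ?S phi (shifted W ?S ?z u)"
    unfolding g_def by (rule S.shifted_symmetric[OF phi u(1)])
  also have "\<dots> = cnj (l2ip ?S (delta_at [x]) phi)" unfolding u(2) by (rule l2ip_commute)
  also have "\<dots> = phi [x]" by (simp add: l2ip_delta_at_left[OF root])
  also have "\<dots> = psi x" using root by (simp add: phi_def)
  finally have psi: "psi x = (\<Sum>p\<in>L1. g p * cnj (u p)) + (\<Sum>p\<in>L2. g p * cnj (u p))" using ip by simp
  have part: "cmod (\<Sum>p\<in>A. g p * cnj (u p)) \<le> 2 * D * (2 / d / kap ^ l)"
    if A: "finite A" "\<And>p. p \<in> A \<Longrightarrow> length p = Suc l \<or> length p = Suc (Suc l)"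
      "L2_set (\<lambda>p. cmod (g p)) A \<le> 2 * D" for A
  proof -
    have "cmod (\<Sum>p\<in>A. g p * cnj (u p)) \<le> (\<Sum>p\<in>A. \<bar>cmod (g p)\<bar> * \<bar>cmod (u p)\<bar>)"
      by (intro sum_norm_le) (simp add: norm_mult)
    also have "\<dots> \<le> L2_set (\<lambda>p. cmod (g p)) A * L2_set (\<lambda>p. cmod (u p)) A"
      by (rule L2_set_mult_ineq)
    also have "\<dots> \<le> 2 * D * (2 / d / kap ^ l)"
      using A(3) level[OF A(1,2)] D1 by (intro mult_mono) auto
    finally show ?thesis .
  qed
  have "cmod (psi x) \<le> cmod (\<Sum>p\<in>L1. g p * cnj (u p)) + cmod (\<Sum>p\<in>L2. g p * cnj (u p))"
    unfolding psi by (rule norm_triangle_ineq)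
  also have "\<dots> \<le> 2 * D * (2 / d / kap ^ l) + 2 * D * (2 / d / kap ^ l)"
    using finL gL1 gL2 by (intro add_mono part) (auto simp: L1_def L2_def)
  also have "\<dots> = 8 * D / d / kap ^ l" by simp
  finally show ?thesis by (simp add: D_def kap_def l_def)
qed

end

theorem theorem1p3:
  fixes V :: "'a set" and E :: "'a \<Rightarrow> 'a \<Rightarrow> bool" and W :: "'a \<Rightarrow> real"
    and psi :: "'a \<Rightarrow> complex" and lam :: real
  assumes graph: "fin_graph V E"
    and conn: "g_connected V E"
    and mindeg: "\<forall>v\<in>V. deg V E v \<ge> 2"
    and not_cycle: "\<not> is_cycle_graph V E"
    and eigen: "\<forall>v\<in>V. (\<Sum>w\<in>{w\<in>V. E v w}. psi w) + of_real (W v) * psi v = of_real lam * psi v"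
    and normed: "(\<Sum>v\<in>V. (cmod (psi v))\<^sup>2) = 1"
  shows "(bulk_spectrum V E W lam \<longrightarrow>
            sup_norm V psi * sqrt (real (ell_G V E))
              \<le> 8 * real (max_deg V E) / (z_lambda V E W lam) ^ 4)
       \<and> (lam \<notin> cover_spectrum V E W \<longrightarrow>
            (let \<delta> = infdist lam (cover_spectrum V E W) in
             sup_norm V psi \<le> 8 * real (max_deg V E) / \<delta>
               / (1 + \<delta> / (2 * real (max_deg V E))) ^ ell_G V E))"
proof -
  interpret graph V E using graph conn mindeg not_cycle by unfold_locales auto
  have "V \<noteq> {}" using conn by (simp add: g_connected_def)
  then have "sup_norm V psi \<in> (\<lambda>v. cmod (psi v)) ` V"
    unfolding sup_norm_def using finite_V by (intro Max_in) auto
  then obtain x where x: "x \<in> V" "sup_norm V psi = cmod (psi x)" by blast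
  show ?thesis
    unfolding Let_def x(2)
    using bulk_bound[of W lam psi x] outside_bound[of lam W psi x] eigen normed x(1) by blast
qed

end
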